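(* Let $(D_1,D_2,D_3)$ be a triple of oriented straight lines of $\mathbb{R}^3$ in generic position, with invariants $\alpha_0,\beta_0,\gamma_0\in(0,1)$, $A,B,C\in\mathbb{R}^*$ and $\varepsilon_0\in\{1,-1\}$, and let $\alpha\in\alpha_0+2\mathbb{Z}$, $\beta\in\beta_0+2\mathbb{Z}$, $\gamma\in\gamma_0+2\mathbb{Z}$. Then, up to direct isometries of $\mathbb{R}^3$, there exist at most four conformal minimal immersions $x:\Sigma\to\mathbb{R}^3$ that are bounded by $(D_1,D_2,D_3)$ or by its dual configuration and have helicoidal ends of parameters $(A,\alpha)$, $(B,\beta)$ and $(C,\gamma)$ at $0$, $\infty$ and $1$ respectively (the immersions for both configurations being counted together).
   Context: $\Sigma=\{z\in\mathbb{C}:\operatorname{Im}z\geq 0\}\setminus\{0,1\}$. Lines. Generic position: $D_1,D_2,D_3$ are oriented lines directed by unit vectors $\vec u_1,\vec u_2,\vec u_3$, no two of them intersect or are parallel, and they do not lie in parallel planes ($\vec u_1,\vec u_2,\vec u_3$ are linearly independent). For nonparallel, nonconcurrent oriented lines $D,D'$ directed by unit vectors $\vec u,\vec u'$, the vector associated to $(D,D')$ is $\vec v=\vec u\times(-\vec u')/\|\vec u\times\vec u'\|$ and the signed distance is $\mathrm{D}(D,D')=\langle\overrightarrow{pp'},\vec v\rangle$ for any $p\in D$, $p'\in D'$. The invariants of $(D_1,D_2,D_3)$ are: $\pi\alpha_0,\pi\beta_0,\pi\gamma_0\in(0,\pi)$, the angles between $\vec u_1$ and $-\vec u_2$, between $\vec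 u_3$ and $-\vec u_1$, between $\vec u_2$ and $-\vec u_3$ respectively; $A=-\mathrm{D}(D_1,D_2)$, $B=-\mathrm{D}(D_3,D_1)$, $C=-\mathrm{D}(D_2,D_3)$; and $\varepsilon_0$, the sign of $\det(\vec u_1,\vec u_2,\vec u_3)$. These invariants determine the triple up to direct isometry. The dual configuration of $(D_1,D_2,D_3)$ is the triple (up to direct isometry) with the same $\alpha_0,\beta_0,\gamma_0,A,B,C$ and opposite $\varepsilon_0$. Weierstrass data. A conformal minimal immersion is written $x=x(z_0)+\operatorname{Re}\int_{z_0}^z(1-g^2,i(1+g^2),2g)\,\omega$; $(g,\omega)$ are its Weierstrass data, $Q=\omega\,dg$ its Hopf differential, and $\mathrm{S}_zg=\left(\left(\frac{g''}{g'}\right)'-\frac12\left(\frac{g''}{g'}\right)^2\right)dz^2$ the Schwarzian derivative of $g$. Helicoidal ends. Let $U$ be a neighbourhood of $0$ in $\mathbb{C}$ symmetric about the real axis and $x:\Sigma\cap U\to\mathbb{R}^3$ a conformal minimal immersion, complete at $0$. Let $D,D'$ be nonparallel, nonconcurrent lines oriented by $\vec u,\vec u'$ with associated vector $\vec v$. $x$ has a helicoidal end at $0$ bounded by $(D,D')$ if: $x$ maps $U\cap(-\infty,0)$ into $D$ with $\langle x(z),\vec u\rangle\to+\infty$ as $z\to0^-$; $x$ maps $U\cap(0,\infty)\cap\Sigma$ (near $0$) into $D'$ with $\langle x(z),\vec u'\rangle\to-\infty$ as $z\to0^+$; the Gauss map of $x$ has a limit as $z\to0$; and $\langle x(z),\vec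 v\rangle$ is bounded as $z\to 0$. In that case there are $A\in\mathbb{R}^*$, $\alpha\in\mathbb{R}\setminus\mathbb{Z}$, with $(A,\alpha)$ unique up to a common sign, such that $Q\sim i\frac{A\alpha}{2\pi}z^{-2}dz^2$ and $\mathrm{S}_zg\sim\frac{1-\alpha^2}{2}z^{-2}dz^2$ as $z\to0$; the end is then said to have parameters $(A,\alpha)$. The same definitions apply at $z_1\in\mathbb{R}$ using the coordinate $z-z_1$, and at $\infty$ using the coordinate $-1/z$. An immersion $x:\Sigma\to\mathbb{R}^3$ is bounded by $(D_1,D_2,D_3)$ with helicoidal ends of the given parameters at $0,\infty,1$ if it maps $(-\infty,0)$, $(0,1)$, $(1,\infty)$ onto $D_1,D_2,D_3$ respectively, and has helicoidal ends of these parameters bounded by $(D_1,D_2)$ at $0$, by $(D_2,D_3)$ at $1$ and by $(D_3,D_1)$ at $\infty$. *)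

theory Defs
  imports
    "HOL-Analysis.Analysis"
    "HOL-Analysis.Cross3"
    "HOL-Complex_Analysis.Complex_Analysis"
    "HOL-Library.Landau_Symbols"
begin

section \<open>Oriented lines\<close>

datatype oriented_line = Line (base: "real^3") (dir: "real^3")

definition points :: "oriented_line \<Rightarrow> (real^3) set" where
  "points D = {base D + t *\<^sub>R dir D | t. t \<in> (UNIV :: real set)}"

definition skew_lines :: "oriented_line \<Rightarrow> oriented_line \<Rightarrow> bool" where
  "skew_lines D D' \<longleftrightarrow> norm (dir D) = 1 \<and> norm (dir D') = 1 \<and>
     cross3 (dir D) (dir D') \<noteq> 0 \<and> points D \<inter> points D' = {}"

definition assoc_vector :: "oriented_line \<Rightarrow> oriented_line \<Rightarrow> real^3" where
  "assoc_vector D D' =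
     (1 / norm (cross3 (dir D) (dir D'))) *\<^sub>R cross3 (dir D) (- dir D')"

text \<open>The base points serve as the points $p \in D$, $p' \in D'$;
  the lemma below shows that the choice is immaterial.\<close>

definition signed_distance :: "oriented_line \<Rightarrow> oriented_line \<Rightarrow> real" where
  "signed_distance D D' = (base D' - base D) \<bullet> assoc_vector D D'"

lemma signed_distance_eq:
  assumes "p \<in> points D" "p' \<in> points D'"
  shows "(p' - p) \<bullet> assoc_vector D D' = signed_distance D D'"
proof -
  from assms obtain s t where p: "p = base D + s *\<^sub>R dir D" "p' = base D' + t *\<^sub>R dir D'"
    by (auto simp: points_def)
  have "dir D \<bullet> assoc_vector D D' = 0" "dir D' \<bullet> assoc_vector D D' = 0"
    by (simp_all add: assoc_vector_def dot_cross_self)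
  then show ?thesis
    by (simp add: p signed_distance_def inner_diff_left inner_add_left)
qed

text \<open>The angle between the first direction and the opposite of the second one, divided by $\pi$.\<close>

definition normalized_angle :: "oriented_line \<Rightarrow> oriented_line \<Rightarrow> real" where
  "normalized_angle D D' =
     arccos ((dir D \<bullet> (- dir D')) / (norm (dir D) * norm (- dir D'))) / pi"

definition generic_position :: "oriented_line \<Rightarrow> oriented_line \<Rightarrow> oriented_line \<Rightarrow> bool" where
  "generic_position D1 D2 D3 \<longleftrightarrow>
     skew_lines D1 D2 \<and> skew_lines D2 D3 \<and> skew_lines D3 D1 \<and>
     det (vector [dir D1, dir D2, dir D3] :: real^3^3) \<noteq> 0"

text \<open>The invariants in the order
  $(\alpha_0, \beta_0, \gamma_0, A, B, C, \varepsilon_0)$.\<close>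

definition line_invariants ::
  "oriented_line \<Rightarrow> oriented_line \<Rightarrow> oriented_line \<Rightarrow>
     real \<times> real \<times> real \<times> real \<times> real \<times> real \<times> real" where
  "line_invariants D1 D2 D3 =
     (normalized_angle D1 D2, normalized_angle D3 D1, normalized_angle D2 D3,
      - signed_distance D1 D2, - signed_distance D3 D1, - signed_distance D2 D3,
      sgn (det (vector [dir D1, dir D2, dir D3] :: real^3^3)))"

lemma normalized_angle_bounds:
  assumes "skew_lines D D'"
  shows "normalized_angle D D' \<in> {0<..<1}"
proof -
  have n: "norm (dir D) = 1" "norm (dir D') = 1" and c: "cross3 (dir D) (dir D') \<noteq> 0"
    using assms by (auto simp: skew_lines_def)
  have "(norm (cross3 (dir D) (dir D')))\<^sup>2 + (dir D \<bullet> dir D')\<^sup>2 = 1"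
    using norm_cross_dot[of "dir D" "dir D'"] n by simp
  moreover have "(norm (cross3 (dir D) (dir D')))\<^sup>2 > 0" using c by simp
  ultimately have "(dir D \<bullet> dir D')\<^sup>2 < 1" by linarith
  then have "\<bar>dir D \<bullet> dir D'\<bar> < 1" by (simp add: abs_square_less_1)
  then show ?thesis
    using arccos_lt_bounded[of "- (dir D \<bullet> dir D')"]
    by (simp add: normalized_angle_def n abs_less_iff)
qed

lemma signed_distance_nonzero:
  assumes "skew_lines D D'"
  shows "signed_distance D D' \<noteq> 0"
proof
  assume z: "signed_distance D D' = 0"
  define u u' w n where "u = dir D" and "u' = dir D'" and "w = base D' - base D"
    and "n = cross3 u u'"
  have n0: "n \<noteq> 0" and disj: "points D \<inter> points D' = {}"
    using assms by (auto simp: skew_lines_def n_def u_def u'_def)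
  have wn: "w \<bullet> n = 0"
    using z n0 unfolding signed_distance_def assoc_vector_def
    by (simp add: n_def u_def u'_def w_def)
  have "cross3 (cross3 n w) n = (n \<bullet> n) *\<^sub>R w - (w \<bullet> n) *\<^sub>R n"
    by (simp add: cross3_simps forall_3)
  moreover have "cross3 n w = (w \<bullet> u) *\<^sub>R u' - (w \<bullet> u') *\<^sub>R u"
    unfolding n_def by (simp add: cross3_simps forall_3)
  moreover have "cross3 u' n = (u' \<bullet> u') *\<^sub>R u - (u \<bullet> u') *\<^sub>R u'"
    "cross3 u n = (u \<bullet> u') *\<^sub>R u - (u \<bullet> u) *\<^sub>R u'"
    unfolding n_def by (simp_all add: cross3_simps forall_3)
  ultimately obtain a b where ab: "(n \<bullet> n) *\<^sub>R w = a *\<^sub>R u + b *\<^sub>R u'"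
  proof -
    assume that: "\<And>a b. (n \<bullet> n) *\<^sub>R w = a *\<^sub>R u + b *\<^sub>R u' \<Longrightarrow> thesis"
      and h: "cross3 (cross3 n w) n = (n \<bullet> n) *\<^sub>R w - (w \<bullet> n) *\<^sub>R n"
        "cross3 n w = (w \<bullet> u) *\<^sub>R u' - (w \<bullet> u') *\<^sub>R u"
        "cross3 u' n = (u' \<bullet> u') *\<^sub>R u - (u \<bullet> u') *\<^sub>R u'"
        "cross3 u n = (u \<bullet> u') *\<^sub>R u - (u \<bullet> u) *\<^sub>R u'"
    have "(n \<bullet> n) *\<^sub>R w = (w \<bullet> u) *\<^sub>R cross3 u' n - (w \<bullet> u') *\<^sub>R cross3 u n"
      using h(1) unfolding h(2) by (simp add: wn Cross3.left_diff_distrib cross_mult_left)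
    also have "\<dots> = ((w \<bullet> u) * (u' \<bullet> u') - (w \<bullet> u') * (u \<bullet> u')) *\<^sub>R u
        + ((w \<bullet> u') * (u \<bullet> u) - (w \<bullet> u) * (u \<bullet> u')) *\<^sub>R u'"
      unfolding h(3,4) by (simp add: algebra_simps)
    finally show thesis by (rule that)
  qed
  define c where "c = n \<bullet> n"
  have c: "c \<noteq> 0" using n0 by (simp add: c_def)
  have "w = (1 / c) *\<^sub>R (c *\<^sub>R w)" using c by simp
  also have "\<dots> = (a / c) *\<^sub>R u + (b / c) *\<^sub>R u'"
    using ab by (simp add: c_def scaleR_add_right)
  finally have "base D + (a / c) *\<^sub>R u = base D' + (- b / c) *\<^sub>R u'"
    by (simp add: w_def algebra_simps)
  moreover have "base D + (a / c) *\<^sub>R u \<in> points D"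
    "base D' + (- b / c) *\<^sub>R u' \<in> points D'"
    unfolding points_def u_def u'_def by blast+
  ultimately have "base D + (a / c) *\<^sub>R u \<in> points D \<inter> points D'" by simp
  then show False using disj by blast
qed

lemma line_invariants_ranges:
  assumes "generic_position D1 D2 D3"
    and "line_invariants D1 D2 D3 = (\<alpha>\<^sub>0, \<beta>\<^sub>0, \<gamma>\<^sub>0, A, B, C, \<epsilon>\<^sub>0)"
  shows "\<alpha>\<^sub>0 \<in> {0<..<1}" "\<beta>\<^sub>0 \<in> {0<..<1}" "\<gamma>\<^sub>0 \<in> {0<..<1}"
    and "A \<noteq> 0" "B \<noteq> 0" "C \<noteq> 0" "\<epsilon>\<^sub>0 \<in> {1, -1}"
  using assms normalized_angle_bounds signed_distance_nonzero
  by (auto simp: generic_position_def line_invariants_def sgn_if split: if_splits)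

definition dual_configuration ::
  "oriented_line \<Rightarrow> oriented_line \<Rightarrow> oriented_line \<Rightarrow>
   oriented_line \<Rightarrow> oriented_line \<Rightarrow> oriented_line \<Rightarrow> bool" where
  "dual_configuration D1 D2 D3 E1 E2 E3 \<longleftrightarrow>
     generic_position E1 E2 E3 \<and>
     (\<exists>\<alpha>\<^sub>0 \<beta>\<^sub>0 \<gamma>\<^sub>0 A B C \<epsilon>\<^sub>0.
        line_invariants D1 D2 D3 = (\<alpha>\<^sub>0, \<beta>\<^sub>0, \<gamma>\<^sub>0, A, B, C, \<epsilon>\<^sub>0) \<and>
        line_invariants E1 E2 E3 = (\<alpha>\<^sub>0, \<beta>\<^sub>0, \<gamma>\<^sub>0, A, B, C, - \<epsilon>\<^sub>0))"


section \<open>Conformal minimal immersions\<close>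

text \<open>All derivatives are taken within the domain, so that they are one-sided at its boundary.
  The domains below are relatively open subsets of the closed upper half-plane, where
  derivatives within the domain are unique.\<close>

definition partial_on :: "complex set \<Rightarrow> complex \<Rightarrow> (complex \<Rightarrow> real^3) \<Rightarrow> complex \<Rightarrow> real^3" where
  "partial_on S e x z = frechet_derivative x (at z within S) e"

abbreviation "du S \<equiv> partial_on S 1"
abbreviation "dv S \<equiv> partial_on S \<i>"

primrec Ck_on :: "nat \<Rightarrow> complex set \<Rightarrow> (complex \<Rightarrow> real^3) \<Rightarrow> bool" where
  "Ck_on 0 S x \<longleftrightarrow> continuous_on S x"
| "Ck_on (Suc k) S x \<longleftrightarrow> x differentiable_on S \<and> Ck_on k S (du S x) \<and> Ck_on k S (dv S x)"

definition smooth_on :: "complex set \<Rightarrow> (complex \<Rightarrow> real^3) \<Rightarrow> bool" where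
  "smooth_on S x \<longleftrightarrow> (\<forall>k. Ck_on k S x)"

definition conformal_immersion_at :: "complex set \<Rightarrow> (complex \<Rightarrow> real^3) \<Rightarrow> complex \<Rightarrow> bool" where
  "conformal_immersion_at S x z \<longleftrightarrow>
     norm (du S x z) = norm (dv S x z) \<and> du S x z \<bullet> dv S x z = 0 \<and> du S x z \<noteq> 0"

definition gauss_map :: "complex set \<Rightarrow> (complex \<Rightarrow> real^3) \<Rightarrow> complex \<Rightarrow> real^3" where
  "gauss_map S x z =
     (1 / norm (cross3 (du S x z) (dv S x z))) *\<^sub>R cross3 (du S x z) (dv S x z)"

definition mean_curvature :: "complex set \<Rightarrow> (complex \<Rightarrow> real^3) \<Rightarrow> complex \<Rightarrow> real" where
  "mean_curvature S x z =
    (let E = du S x z \<bullet> du S x z;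
         F = du S x z \<bullet> dv S x z;
         G = dv S x z \<bullet> dv S x z;
         N = gauss_map S x z;
         l = du S (du S x) z \<bullet> N;
         m = dv S (du S x) z \<bullet> N;
         n = dv S (dv S x) z \<bullet> N
     in (l * G - 2 * m * F + n * E) / (2 * (E * G - F\<^sup>2)))"

definition conformal_minimal_immersion :: "complex set \<Rightarrow> (complex \<Rightarrow> real^3) \<Rightarrow> bool" where
  "conformal_minimal_immersion S x \<longleftrightarrow> smooth_on S x \<and>
     (\<forall>z\<in>S. conformal_immersion_at S x z \<and> mean_curvature S x z = 0)"


section \<open>Weierstrass data\<close>

text \<open>Here $\omega = f\,dz$. Since poles of $g$ are isolated and $g$ takes the junk value $0$
  there, integration paths have to avoid them.\<close>

definition weierstrass_data ::
  "complex set \<Rightarrow> (complex \<Rightarrow> real^3) \<Rightarrow> (complex \<Rightarrow> complex) \<Rightarrow> (complex \<Rightarrow> complex) \<Rightarrow> bool" where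
  "weierstrass_data \<Omega> x g f \<longleftrightarrow>
     g nicely_meromorphic_on \<Omega> \<and> f holomorphic_on \<Omega> \<and>
     (\<forall>p. valid_path p \<and> path_image p \<subseteq> \<Omega> - {z. is_pole g z} \<longrightarrow>
        x (pathfinish p) = x (pathstart p) +
          vector [Re (contour_integral p (\<lambda>z. (1 - (g z)\<^sup>2) * f z)),
                  Re (contour_integral p (\<lambda>z. \<i> * (1 + (g z)\<^sup>2) * f z)),
                  Re (contour_integral p (\<lambda>z. 2 * g z * f z))])"

text \<open>Coefficients of $dz^2$ in the Hopf differential and in the Schwarzian derivative.
  The function \<^const>\<open>remove_sings\<close> supplies the values at poles of $g$, where these expressions
  may have removable singularities.\<close>

definition hopf_coeff :: "(complex \<Rightarrow> complex) \<Rightarrow> (complex \<Rightarrow> complex) \<Rightarrow> complex \<Rightarrow> complex" where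
  "hopf_coeff g f = remove_sings (\<lambda>z. f z * deriv g z)"

definition schwarzian :: "(complex \<Rightarrow> complex) \<Rightarrow> complex \<Rightarrow> complex" where
  "schwarzian g =
    (let h = (\<lambda>z. deriv (deriv g) z / deriv g z)
     in remove_sings (\<lambda>z. deriv h z - (1 / 2) * (h z)\<^sup>2))"


section \<open>Helicoidal ends\<close>

definition punctured_half_plane :: "complex set" where
  "punctured_half_plane = {z. Im z \<ge> 0} - {0}"

text \<open>Every $C^1$ path in the domain tending to $0$ has an image of infinite length: its speed is
  continuous and nonnegative, so it is integrable iff the length is finite.\<close>

definition complete_at_0 :: "complex set \<Rightarrow> (complex \<Rightarrow> real^3) \<Rightarrow> bool" where
  "complete_at_0 S x \<longleftrightarrow>
     (\<forall>c :: real \<Rightarrow> complex.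
        c C1_differentiable_on {0..<1} \<and> c ` {0..<1} \<subseteq> S \<and> (c \<longlongrightarrow> 0) (at_left 1) \<longrightarrow>
        \<not> (\<lambda>t. norm (vector_derivative (x \<circ> c) (at t within {0..<1}))) integrable_on {0..<1})"

definition helicoidal_end_bounded_on ::
  "complex set \<Rightarrow> (complex \<Rightarrow> real^3) \<Rightarrow> oriented_line \<Rightarrow> oriented_line \<Rightarrow> bool" where
  "helicoidal_end_bounded_on U x D D' \<longleftrightarrow>
     skew_lines D D' \<and>
     open U \<and> 0 \<in> U \<and> cnj ` U = U \<and>
     conformal_minimal_immersion (punctured_half_plane \<inter> U) x \<and>
     complete_at_0 (punctured_half_plane \<inter> U) x \<and>
     (\<forall>t::real. t < 0 \<and> of_real t \<in> U \<longrightarrow> x (of_real t) \<in> points D) \<and>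
     filterlim (\<lambda>t::real. x (of_real t) \<bullet> dir D) at_top (at_left 0) \<and>
     (\<forall>t::real. t > 0 \<and> of_real t \<in> U \<longrightarrow> x (of_real t) \<in> points D') \<and>
     filterlim (\<lambda>t::real. x (of_real t) \<bullet> dir D') at_bot (at_right 0) \<and>
     (\<exists>L. (gauss_map (punctured_half_plane \<inter> U) x \<longlongrightarrow> L) (at 0 within punctured_half_plane)) \<and>
     (\<exists>M. \<forall>\<^sub>F z in at 0 within punctured_half_plane. \<bar>x z \<bullet> assoc_vector D D'\<bar> \<le> M)"

text \<open>The asymptotics are taken along interior points, where the Weierstrass data are defined
  without any extension across the boundary.\<close>

definition has_helicoidal_end ::
  "(complex \<Rightarrow> real^3) \<Rightarrow> oriented_line \<Rightarrow> oriented_line \<Rightarrow> real \<Rightarrow> real \<Rightarrow> bool" where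
  "has_helicoidal_end x D D' A \<alpha> \<longleftrightarrow>
     A \<noteq> 0 \<and> \<alpha> \<notin> \<int> \<and>
     (\<exists>U. helicoidal_end_bounded_on U x D D' \<and>
       (\<exists>g f. weierstrass_data {z \<in> U. Im z > 0} x g f \<and>
          hopf_coeff g f \<sim>[at 0 within {z. Im z > 0}]
            (\<lambda>z. \<i> * of_real (A * \<alpha> / (2 * pi)) / z\<^sup>2) \<and>
          schwarzian g \<sim>[at 0 within {z. Im z > 0}]
            (\<lambda>z. of_real ((1 - \<alpha>\<^sup>2) / 2) / z\<^sup>2)))"

text \<open>In the local coordinates $w = z - z_1$ and $w = -1/z$.\<close>

definition has_helicoidal_end_at ::
  "real \<Rightarrow> (complex \<Rightarrow> real^3) \<Rightarrow> oriented_line \<Rightarrow> oriented_line \<Rightarrow> real \<Rightarrow> real \<Rightarrow> bool" where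
  "has_helicoidal_end_at z1 x = has_helicoidal_end (\<lambda>w. x (of_real z1 + w))"

definition has_helicoidal_end_at_infinity ::
  "(complex \<Rightarrow> real^3) \<Rightarrow> oriented_line \<Rightarrow> oriented_line \<Rightarrow> real \<Rightarrow> real \<Rightarrow> bool" where
  "has_helicoidal_end_at_infinity x = has_helicoidal_end (\<lambda>w. x (- 1 / w))"


section \<open>Immersions bounded by three lines\<close>

definition Sigma01 :: "complex set" where
  "Sigma01 = {z. Im z \<ge> 0} - {0, 1}"

text \<open>The parameters are $(A,\alpha)$ at $0$, $(B,\beta)$ at $\infty$ and $(C,\gamma)$ at $1$.\<close>

definition bounded_with_helicoidal_ends ::
  "(complex \<Rightarrow> real^3) \<Rightarrow> oriented_line \<Rightarrow> oriented_line \<Rightarrow> oriented_line \<Rightarrow>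
     real \<times> real \<Rightarrow> real \<times> real \<Rightarrow> real \<times> real \<Rightarrow> bool" where
  "bounded_with_helicoidal_ends x D1 D2 D3 p0 pinf p1 \<longleftrightarrow>
     x ` (of_real ` {..<0}) = points D1 \<and>
     x ` (of_real ` {0<..<1}) = points D2 \<and>
     x ` (of_real ` {1<..}) = points D3 \<and>
     has_helicoidal_end_at 0 x D1 D2 (fst p0) (snd p0) \<and>
     has_helicoidal_end_at_infinity x D3 D1 (fst pinf) (snd pinf) \<and>
     has_helicoidal_end_at 1 x D2 D3 (fst p1) (snd p1)"

definition direct_isometry :: "(real^3 \<Rightarrow> real^3) \<Rightarrow> bool" where
  "direct_isometry T \<longleftrightarrow>
     (\<exists>(R :: real^3^3) c. rotation_matrix R \<and> T = (\<lambda>p. R *v p + c))"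

text \<open>Maps are compared on $\Sigma$ only, because their values elsewhere are meaningless.\<close>

definition congruent_immersions :: "((complex \<Rightarrow> real^3) \<times> (complex \<Rightarrow> real^3)) set" where
  "congruent_immersions =
     {(x, y). \<exists>T. direct_isometry T \<and> (\<forall>z\<in>Sigma01. y z = T (x z))}"

lemma equiv_congruent_immersions: "equiv UNIV congruent_immersions"
proof (rule equivI)
  show "congruent_immersions \<subseteq> UNIV \<times> UNIV" by simp
  have "rotation_matrix (mat 1 :: real^3^3)"
    by (simp add: rotation_matrix_def orthogonal_matrix_id)
  then have "direct_isometry (\<lambda>p. p)"
    unfolding direct_isometry_def
    by (intro exI[of _ "mat 1"] exI[of _ 0]) auto
  then show "refl_on UNIV congruent_immersions"
    by (auto simp: refl_on_def congruent_immersions_def)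
  show "sym congruent_immersions"
  proof (rule symI)
    fix x y assume "(x, y) \<in> congruent_immersions"
    then obtain R :: "real^3^3" and c where R: "rotation_matrix R"
      and xy: "\<And>z. z \<in> Sigma01 \<Longrightarrow> y z = R *v x z + c"
      by (auto simp: congruent_immersions_def direct_isometry_def)
    have "rotation_matrix (transpose R)"
      using R by (simp add: rotation_matrix_def)
    moreover have "x z = transpose R *v y z + (- (transpose R *v c))" if "z \<in> Sigma01" for z
    proof -
      have "transpose R *v y z = (transpose R ** R) *v x z + transpose R *v c"
        by (simp add: xy[OF that] matrix_vector_right_distrib matrix_vector_mul_assoc)
      then show ?thesis
        using R by (simp add: rotation_matrix_def orthogonal_matrix_def)
    qed
    ultimately show "(y, x) \<in> congruent_immersions"
      unfolding congruent_immersions_def direct_isometry_def by blast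
  qed
  show "trans congruent_immersions"
  proof (rule transI)
    fix x y w assume "(x, y) \<in> congruent_immersions" "(y, w) \<in> congruent_immersions"
    then obtain R R' :: "real^3^3" and c c' where R: "rotation_matrix R" "rotation_matrix R'"
      and xy: "\<And>z. z \<in> Sigma01 \<Longrightarrow> y z = R *v x z + c"
        "\<And>z. z \<in> Sigma01 \<Longrightarrow> w z = R' *v y z + c'"
      by (auto simp: congruent_immersions_def direct_isometry_def)
    have "rotation_matrix (R' ** R)"
      using R by (simp add: rotation_matrix_def orthogonal_matrix_mul det_mul)
    moreover have "w z = (R' ** R) *v x z + (R' *v c + c')" if "z \<in> Sigma01" for z
      by (simp add: xy that matrix_vector_right_distrib matrix_vector_mul_assoc)
    ultimately show "(x, w) \<in> congruent_immersions"
      unfolding congruent_immersions_def direct_isometry_def by blast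
  qed
qed

definition admissible_immersions ::
  "oriented_line \<Rightarrow> oriented_line \<Rightarrow> oriented_line \<Rightarrow>
     real \<times> real \<Rightarrow> real \<times> real \<Rightarrow> real \<times> real \<Rightarrow> (complex \<Rightarrow> real^3) set" where
  "admissible_immersions D1 D2 D3 p0 pinf p1 =
     {x. conformal_minimal_immersion Sigma01 x \<and>
         (bounded_with_helicoidal_ends x D1 D2 D3 p0 pinf p1 \<or>
          (\<exists>E1 E2 E3. dual_configuration D1 D2 D3 E1 E2 E3 \<and>
             bounded_with_helicoidal_ends x E1 E2 E3 p0 pinf p1))}"

end

theory Submission
  imports Defs
begin

text \<open>
  A conformal minimal immersion $x$ of the half-plane is the real part of a primitive of the null
  curve $\phi = x_u - i x_v$ in $\mathbb{C}^3$.  Locally $\phi$ is the square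
  $(s^2 - t^2, i(s^2 + t^2), 2st)$ of a spinor $(s,t)$, and both $s$ and $t$ solve the linear equation
  $q y'' - q' y' + p y = 0$, where $q = s t' - t s'$ is the coefficient of the Hopf differential and
  $p = s' t'' - t' s''$.  The pair $(q, p)$ carries the same information as the Hopf differential
  together with the Schwarzian of the Gauss map, which equals $2p/q + q''/q - (3/2)(q'/q)^2$; the
  advantage of $p$ is that it stays holomorphic where $q$ vanishes.

  If a boundary arc lies on a line, Schwarz reflection continues $\phi$ across that arc, the reflected
  values being turned by $\pi$ about the line.  The continuations through the three arcs are different,
  but $q$ and $p$ do not see rotations, so they are single-valued on the plane without $0$ and $1$
  (\<open>glued_null_data\<close>).  The helicoidal ends prescribe the leading terms of $q$ and $p$ at the three
  cusps (\<open>helicoidal_end_asymptotics\<close>).  By Liouville's theorem $q = (i/2\pi) P/h$ and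
  $p = (i/2\pi) N/h^2$ with $h = z^2(z-1)^2$; the quadratic polynomial $P$ is completely determined, and
  the quartic polynomial $N$ is known up to two complex parameters
  (\<open>bounded_immersion_numerator\<close>).

  At a zero of $P$ the linear equation is singular, and yet it has a holomorphic solution that does not
  vanish there, because an immersion has no branch points.  This is a polynomial condition on
  $N$.  Two simple zeros of $P$ give two quadratic equations whose leading forms are the squares of two
  independent linear forms, hence at most four solutions; a double zero of $P$ gives one linear and one
  cubic equation, hence at most three (\<open>card_admissible_numerators_le\<close>).

  Finally $N$ determines the immersion up to a direct isometry.  Two immersions with the same $N$ have
  spinors solving the same linear equation, so their null curves differ by a constant matrix
  $M \in SO(3,\mathbb{C})$.  Since $M$ intertwines the reflections along three linearly independent
  directions, it is real (\<open>rotation_between_null_curves\<close>).  The two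
  immersions may be bounded by different triples of lines, so this counts both dual configurations
  together.
\<close>

\<comment> \<open>From here on $ always denotes the component of a vector.\<close>
no_notation fps_nth (infixl \<open>$\<close> 75)

section \<open>Null curves and their invariants q and p\<close>

definition cdot :: "complex^3 \<Rightarrow> complex^3 \<Rightarrow> complex" where
  "cdot v w = v$1 * w$1 + v$2 * w$2 + v$3 * w$3"

definition ccross :: "complex^3 \<Rightarrow> complex^3 \<Rightarrow> complex^3" where
  "ccross v w = vector [v$2 * w$3 - v$3 * w$2, v$3 * w$1 - v$1 * w$3, v$1 * w$2 - v$2 * w$1]"

definition vderiv :: "(complex \<Rightarrow> complex^3) \<Rightarrow> complex \<Rightarrow> complex^3" where
  "vderiv F z = (\<chi> k. deriv (\<lambda>w. F w $ k) z)"

definition vholo :: "(complex \<Rightarrow> complex^3) \<Rightarrow> complex set \<Rightarrow> bool" where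
  "vholo F \<Omega> \<longleftrightarrow> (\<forall>k. (\<lambda>w. F w $ k) holomorphic_on \<Omega>)"

definition null_curve :: "complex set \<Rightarrow> (complex \<Rightarrow> complex^3) \<Rightarrow> bool" where
  "null_curve \<Omega> F \<longleftrightarrow> vholo F \<Omega> \<and> (\<forall>z\<in>\<Omega>. F z \<noteq> 0 \<and> cdot (F z) (F z) = 0)"

text \<open>The first relation says that the cross product of a null vector with a tangent vector orthogonal to it
  is a multiple of the null vector; the factor is the Hopf coefficient.  The second one isolates $p$: it
  is the component of $\phi' \times \phi''$ along $\phi$ that is left when the part forced by $q$ is
  removed.  Cross products are used because they make the invariance under rotations evident.\<close>

definition jet_data :: "complex^3 \<Rightarrow> complex^3 \<Rightarrow> complex^3 \<Rightarrow> complex \<Rightarrow> complex \<Rightarrow> complex \<Rightarrow> bool" where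
  "jet_data v0 v1 v2 q q' p \<longleftrightarrow> ccross v0 v1 = (2 * \<i> * q) *s v0 \<and>
     ccross v1 v2 = (2 * \<i>) *s (q *s v2 - q' *s v1 + (4 * p) *s v0)"

definition null_data ::
  "complex set \<Rightarrow> (complex \<Rightarrow> complex^3) \<Rightarrow> (complex \<Rightarrow> complex) \<Rightarrow> (complex \<Rightarrow> complex) \<Rightarrow> bool" where
  "null_data \<Omega> F q p \<longleftrightarrow> null_curve \<Omega> F \<and> q holomorphic_on \<Omega> \<and> p holomorphic_on \<Omega> \<and>
     (\<forall>z\<in>\<Omega>. jet_data (F z) (vderiv F z) (vderiv (vderiv F) z) (q z) (deriv q z) (p z))"

lemma vec3_eq_iff: "(v :: complex^3) = w \<longleftrightarrow> v$1 = w$1 \<and> v$2 = w$2 \<and> v$3 = w$3"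
  by (simp add: vec_eq_iff forall_3)

lemma ccross_nth [simp]:
  "ccross v w $ 1 = v$2 * w$3 - v$3 * w$2"
  "ccross v w $ 2 = v$3 * w$1 - v$1 * w$3"
  "ccross v w $ 3 = v$1 * w$2 - v$2 * w$1"
  by (simp_all add: ccross_def)

lemma vderiv_nth [simp]: "vderiv F z $ k = deriv (\<lambda>w. F w $ k) z"
  by (simp add: vderiv_def)

lemma vholo_nth: "vholo F \<Omega> \<Longrightarrow> (\<lambda>w. F w $ k) holomorphic_on \<Omega>"
  by (simp add: vholo_def)

lemma vholo_subset: "vholo F \<Omega> \<Longrightarrow> \<Omega>' \<subseteq> \<Omega> \<Longrightarrow> vholo F \<Omega>'"
  by (auto simp: vholo_def intro: holomorphic_on_subset)

lemma vholo_vderiv: "vholo F \<Omega> \<Longrightarrow> open \<Omega> \<Longrightarrow> vholo (vderiv F) \<Omega>"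
  by (simp add: vholo_def holomorphic_deriv)

lemma vderiv_cong:
  assumes "open \<Omega>" "z \<in> \<Omega>" "\<And>w. w \<in> \<Omega> \<Longrightarrow> F w = G w"
  shows "vderiv F z = vderiv G z"
proof -
  have ev: "\<forall>\<^sub>F w in nhds z. w \<in> \<Omega>" using assms by (simp add: eventually_nhds_in_open)
  have "deriv (\<lambda>w. F w $ k) z = deriv (\<lambda>w. G w $ k) z" for k
    by (intro deriv_cong_ev eventually_mono[OF ev]) (auto simp: assms(3))
  then show ?thesis by (simp add: vderiv_def)
qed

lemma vderiv2_cong:
  assumes "open \<Omega>" "z \<in> \<Omega>" "\<And>w. w \<in> \<Omega> \<Longrightarrow> F w = G w"
  shows "vderiv (vderiv F) z = vderiv (vderiv G) z"
  using assms by (intro vderiv_cong[OF assms(1,2)] vderiv_cong[OF assms(1)]) auto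

lemma null_data_cong:
  assumes "null_data \<Omega> F q p" "open \<Omega>'" "\<Omega>' \<subseteq> \<Omega>"
    and "\<And>z. z \<in> \<Omega>' \<Longrightarrow> F z = G z" "\<And>z. z \<in> \<Omega>' \<Longrightarrow> q z = q' z" "\<And>z. z \<in> \<Omega>' \<Longrightarrow> p z = p' z"
  shows "null_data \<Omega>' G q' p'"
proof -
  have F: "vholo F \<Omega>'" and q: "q holomorphic_on \<Omega>'" and p: "p holomorphic_on \<Omega>'"
    using assms(1,3) by (auto simp: null_data_def null_curve_def intro: vholo_subset holomorphic_on_subset)
  have "vholo G \<Omega>'" using F assms(4) by (force simp: vholo_def intro: holomorphic_transform)
  moreover have "q' holomorphic_on \<Omega>'" "p' holomorphic_on \<Omega>'"
    using p q assms(5,6) by (auto intro: holomorphic_transform)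
  moreover have "jet_data (G z) (vderiv G z) (vderiv (vderiv G) z) (q' z) (deriv q' z) (p' z)"
    if z: "z \<in> \<Omega>'" for z
  proof -
    have "deriv q z = deriv q' z"
      using eventually_nhds_in_open[OF assms(2) z] assms(5)
      by (intro deriv_cong_ev) (auto elim: eventually_mono)
    then show ?thesis
      using assms(1,3) z assms(4,5,6)[OF z] vderiv_cong[OF assms(2) z assms(4)]
        vderiv2_cong[OF assms(2) z assms(4)]
      by (force simp: null_data_def)
  qed
  ultimately show ?thesis
    using assms(1,3,4) by (force simp: null_data_def null_curve_def)
qed

lemma jet_q_unique:
  assumes "jet_data v0 v1 v2 q q' p" "jet_data v0 v1 v2 r r' p'" "v0 \<noteq> 0"
  shows "q = r"
proof -
  from assms(3) obtain k where k: "v0 $ k \<noteq> 0" by (auto simp: vec_eq_iff)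
  have "(2 * \<i> * q) * v0 $ k = (2 * \<i> * r) * v0 $ k"
    using assms(1,2) by (metis jet_data_def vector_smult_component)
  then show "q = r" using k by simp
qed

lemma jet_data_unique:
  assumes "jet_data v0 v1 v2 q q' p" "jet_data v0 v1 v2 r q' p'" "v0 \<noteq> 0"
  shows "q = r \<and> p = p'"
proof -
  from assms(3) obtain k where k: "v0 $ k \<noteq> 0" by (auto simp: vec_eq_iff)
  have qr: "q = r" by (rule jet_q_unique[OF assms])
  have "(2 * \<i>) * (q * v2 $ k - q' * v1 $ k + 4 * p * v0 $ k)
     = (2 * \<i>) * (q * v2 $ k - q' * v1 $ k + 4 * p' * v0 $ k)"
  proof -
    have "(2 * \<i>) *s (q *s v2 - q' *s v1 + (4 * p) *s v0) = (2 * \<i>) *s (q *s v2 - q' *s v1 + (4 * p') *s v0)"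
      using assms(1,2) unfolding jet_data_def qr by metis
    then have "((2 * \<i>) *s (q *s v2 - q' *s v1 + (4 * p) *s v0)) $ k
        = ((2 * \<i>) *s (q *s v2 - q' *s v1 + (4 * p') *s v0)) $ k"
      by (rule arg_cong[where f = "\<lambda>v. v $ k"])
    then show ?thesis by (simp only: vector_smult_component vector_add_component vector_minus_component)
  qed
  then have "4 * p * v0 $ k = 4 * p' * v0 $ k" by simp
  then show ?thesis using k qr by auto
qed

text \<open>The null curve is nowhere zero, so the two defining relations can be solved for $q$ and then for $p$.\<close>

lemma null_data_unique:
  assumes "null_data \<Omega> F q p" "null_data \<Omega>' G r s" "open U" "U \<subseteq> \<Omega>" "U \<subseteq> \<Omega>'"
    and "\<And>z. z \<in> U \<Longrightarrow> F z = G z" and z: "z \<in> U"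
  shows "q z = r z" "p z = s z"
proof -
  have G: "null_data U F r s"
    using null_data_cong[OF assms(2,3,5), of F] assms(6) by simp
  have F: "null_data U F q p"
    using null_data_cong[OF assms(1,3,4), of F] by simp
  have qr: "q w = r w" if "w \<in> U" for w
    using F G that jet_q_unique by (fastforce simp: null_data_def null_curve_def)
  then show "q z = r z" using z by simp
  have "deriv q z = deriv r z"
    using eventually_nhds_in_open[OF assms(3) z] qr
    by (intro deriv_cong_ev) (auto elim: eventually_mono)
  then show "p z = s z"
    using F G z jet_data_unique qr by (fastforce simp: null_data_def null_curve_def)
qed

text \<open>Near each point some component of $F$ does not vanish, and there the factor is a quotient of
  holomorphic functions.\<close>

lemma holomorphic_factor_of_parallel:
  assumes F: "vholo F \<Omega>" and V: "vholo V \<Omega>" and "open \<Omega>"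
    and nz: "\<And>z. z \<in> \<Omega> \<Longrightarrow> F z \<noteq> 0"
    and par: "\<And>z. z \<in> \<Omega> \<Longrightarrow> ccross (F z) (V z) = 0"
  obtains c where "c holomorphic_on \<Omega>" "\<And>z. z \<in> \<Omega> \<Longrightarrow> V z = c z *s F z"
proof -
  have swap: "F z $ i * V z $ j = F z $ j * V z $ i" if "z \<in> \<Omega>" for z i j
  proof -
    have "\<forall>i j. F z $ i * V z $ j = F z $ j * V z $ i"
      using par[OF that] by (simp add: vec3_eq_iff forall_3 mult.commute)
    then show ?thesis by blast
  qed
  define c where "c z = (let k = (SOME k. F z $ k \<noteq> 0) in V z $ k / F z $ k)" for z
  have c: "c z = V z $ k / F z $ k" if "z \<in> \<Omega>" "F z $ k \<noteq> 0" for z k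
  proof -
    define l where "l = (SOME k. F z $ k \<noteq> 0)"
    have "F z $ l \<noteq> 0" unfolding l_def using that(2) by (rule someI)
    then show ?thesis using swap[OF that(1), of k l] that(2)
      by (simp add: c_def Let_def field_simps flip: l_def)
  qed
  have "c holomorphic_on \<Omega>"
  proof -
    have "\<exists>e>0. c holomorphic_on ball z e" if z: "z \<in> \<Omega>" for z
    proof -
      obtain k where k: "F z $ k \<noteq> 0" using nz[OF z] by (auto simp: vec_eq_iff)
      have "open {w \<in> \<Omega>. F w $ k \<noteq> 0}"
        using continuous_open_preimage[of \<Omega> "\<lambda>w. F w $ k" "- {0}"] F \<open>open \<Omega>\<close> open_delete[OF open_UNIV, of 0]
        by (simp add: vholo_def holomorphic_on_imp_continuous_on Int_def vimage_def Compl_eq_Diff_UNIV)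
      then obtain e where e: "e > 0" "ball z e \<subseteq> {w \<in> \<Omega>. F w $ k \<noteq> 0}"
        using z k openE by blast
      have "(\<lambda>w. V w $ k / F w $ k) holomorphic_on ball z e"
        using e F V by (intro holomorphic_on_divide) (auto simp: vholo_def intro: holomorphic_on_subset)
      then have "c holomorphic_on ball z e"
        using e by (elim holomorphic_transform) (auto simp: c subset_iff)
      then show ?thesis using e by blast
    qed
    then show ?thesis
      by (metis \<open>open \<Omega>\<close> analytic_on_def analytic_on_open)
  qed
  moreover have "V z = c z *s F z" if z: "z \<in> \<Omega>" for z
  proof -
    obtain k where k: "F z $ k \<noteq> 0" using nz[OF z] by (auto simp: vec_eq_iff)
    show ?thesis using swap[OF z, of k] k by (simp add: c[OF z k] vec_eq_iff field_simps)
  qed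
  ultimately show thesis by (rule that)
qed

lemma has_field_derivative_vderiv:
  assumes "vholo F \<Omega>" "open \<Omega>" "z \<in> \<Omega>"
  shows "((\<lambda>w. F w $ k) has_field_derivative vderiv F z $ k) (at z)"
  unfolding vderiv_nth by (rule holomorphic_derivI[OF vholo_nth[OF assms(1)] assms(2,3)])

lemma deriv_zero_on_open:
  assumes "open \<Omega>" "z \<in> \<Omega>" "\<And>w. w \<in> \<Omega> \<Longrightarrow> f w = 0" "(f has_field_derivative D) (at z)"
  shows "D = 0"
proof -
  have "((\<lambda>_. 0) has_field_derivative D) (at z)"
    using DERIV_cong_ev[of z z f "\<lambda>_. 0" D D] assms eventually_nhds_in_open[OF assms(1,2)]
    by (metis (mono_tags, lifting) eventually_mono)
  then show "D = 0" by (metis DERIV_const DERIV_unique)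
qed

text \<open>Derivatives of the identity $\phi \cdot \phi = 0$.\<close>

lemma null_curve_jets:
  assumes N: "null_curve \<Omega> F" and "open \<Omega>" "z \<in> \<Omega>"
  defines "a \<equiv> F z" and "b \<equiv> vderiv F z" and "c \<equiv> vderiv (vderiv F) z"
  shows "cdot a a = 0" "cdot a b = 0" "cdot b b + cdot a c = 0"
proof -
  have F: "vholo F \<Omega>" using N by (simp add: null_curve_def)
  note d = has_field_derivative_vderiv[OF F assms(2)]
    has_field_derivative_vderiv[OF vholo_vderiv[OF F assms(2)] assms(2)]
  show "cdot a a = 0" using N assms(3) by (simp add: null_curve_def a_def)
  have 1: "cdot (F w) (vderiv F w) = 0" if w: "w \<in> \<Omega>" for w
  proof -
    have "((\<lambda>w. F w$1 * F w$1 + F w$2 * F w$2 + F w$3 * F w$3) has_field_derivative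
       2 * cdot (F w) (vderiv F w)) (at w)"
      by (rule derivative_eq_intros d(1)[OF w] refl)+ (simp add: cdot_def algebra_simps)
    from deriv_zero_on_open[OF assms(2) w _ this] N have "2 * cdot (F w) (vderiv F w) = 0"
      unfolding null_curve_def cdot_def by blast
    then show ?thesis by simp
  qed
  then show "cdot a b = 0" using assms(3) by (simp add: a_def b_def)
  have "((\<lambda>w. F w$1 * vderiv F w$1 + F w$2 * vderiv F w$2 + F w$3 * vderiv F w$3) has_field_derivative
       cdot b b + cdot a c) (at z)"
    by (rule derivative_eq_intros d(1)[OF assms(3)] d(2)[OF assms(3)] refl)+
      (simp add: cdot_def algebra_simps a_def b_def c_def)
  from deriv_zero_on_open[OF assms(2,3) _ this] 1 show "cdot b b + cdot a c = 0"
    by (auto simp: cdot_def)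
qed

lemma vholo_intros:
  assumes "vholo F \<Omega>" "vholo G \<Omega>"
  shows "vholo (\<lambda>z. F z + G z) \<Omega>" "vholo (\<lambda>z. F z - G z) \<Omega>" "vholo (\<lambda>z. ccross (F z) (G z)) \<Omega>"
  using assms by (auto simp: vholo_def forall_3 intro!: holomorphic_intros)

lemma vholo_smult: "c holomorphic_on \<Omega> \<Longrightarrow> vholo F \<Omega> \<Longrightarrow> vholo (\<lambda>z. c z *s F z) \<Omega>"
  by (auto simp: vholo_def intro!: holomorphic_intros)

lemma jet_parallel_1:
  assumes "cdot a a = 0" "cdot a b = 0"
  shows "ccross a (ccross a b) = 0"
  using assms unfolding vec3_eq_iff ccross_nth cdot_def zero_index by algebra

lemma jet_dot_q:
  assumes "cdot a b = 0" "ccross a b = (2*\<i>*q) *s a" "a \<noteq> 0"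
  shows "cdot b b = 4 * q\<^sup>2"
proof -
  have i: "\<i> * \<i> = -1" by simp
  have "(cdot b b - 4 * q\<^sup>2) * a$1 = 0 \<and> (cdot b b - 4 * q\<^sup>2) * a$2 = 0 \<and> (cdot b b - 4 * q\<^sup>2) * a$3 = 0"
    using assms(1,2) i unfolding vec3_eq_iff ccross_nth cdot_def vector_smult_component
    by algebra
  then show ?thesis using assms(3) by (auto simp: vec3_eq_iff)
qed

text \<open>The identities $\phi \times (\phi' \times \phi'') = -4 q^2 \phi'$ and
  $\phi \times \phi'' = 2i(q'\phi + q\phi')$ make the three contributions cancel; this is what makes
  $p$ well defined even at the zeros of $q$.\<close>

lemma jet_parallel_2:
  assumes "cdot a a = 0" "cdot a b = 0" "cdot b b + cdot a c = 0"
    and "ccross a b = (2*\<i>*q) *s a" "a \<noteq> 0"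
    and "ccross a c = (2*\<i>) *s (r *s a + q *s b)"
  shows "ccross a ((1/(2*\<i>)) *s ccross b c - q *s c + r *s b) = 0"
proof -
  have i: "\<i> * \<i> = -1" and h: "2 * (1/(2*\<i>)) = -\<i>" by simp_all
  define j where "j = 1/(2*\<i>)"
  have j: "2 * j = -\<i>" using h by (simp add: j_def)
  have bb: "cdot b b = 4 * q\<^sup>2" using jet_dot_q assms by blast
  have 1: "ccross a (ccross b c) = (- (4 * q\<^sup>2)) *s b" 
    using assms(2,3) bb unfolding vec3_eq_iff ccross_nth cdot_def vector_smult_component by algebra
  have "ccross a (j *s ccross b c - q *s c + r *s b)
     = j *s ccross a (ccross b c) - q *s ccross a c + r *s ccross a b"
    unfolding vec3_eq_iff ccross_nth vector_smult_component vector_add_component vector_minus_component by algebra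
  also have "\<dots> = 0" unfolding 1 assms(4,6) vec3_eq_iff ccross_nth vector_smult_component
     vector_add_component vector_minus_component zero_index using i j by algebra
  finally show ?thesis by (simp add: j_def)
qed

lemma differentiated_cross_relation:
  assumes F: "vholo F \<Omega>" and O: "open \<Omega>" and q: "q holomorphic_on \<Omega>"
    and q1: "\<And>w. w \<in> \<Omega> \<Longrightarrow> ccross (F w) (vderiv F w) = (2*\<i>*q w) *s F w" and z: "z \<in> \<Omega>"
  shows "ccross (F z) (vderiv (vderiv F) z) = (2*\<i>) *s (deriv q z *s F z + q z *s vderiv F z)"
proof -
  note d = has_field_derivative_vderiv[OF F O] has_field_derivative_vderiv[OF vholo_vderiv[OF F O] O]
  note dq = holomorphic_derivI[OF q O]
  have D: "((\<lambda>w. F w$i * vderiv F w$j - F w$j * vderiv F w$i - 2*\<i>*q w * F w$k) has_field_derivative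
      (F z$i * vderiv (vderiv F) z$j - F z$j * vderiv (vderiv F) z$i
        - 2*\<i>*(deriv q z * F z$k + q z * vderiv F z$k))) (at z)" for i j k
    by (rule derivative_eq_intros d(1)[OF z] d(2)[OF z] dq[OF z] refl)+ (simp add: algebra_simps)
  have e: "F w$2 * vderiv F w$3 - F w$3 * vderiv F w$2 - 2*\<i>*q w * F w$1 = 0"
     "F w$3 * vderiv F w$1 - F w$1 * vderiv F w$3 - 2*\<i>*q w * F w$2 = 0"
     "F w$1 * vderiv F w$2 - F w$2 * vderiv F w$1 - 2*\<i>*q w * F w$3 = 0" if "w \<in> \<Omega>" for w
    using q1[OF that] unfolding vec3_eq_iff ccross_nth vector_smult_component by simp_all
  show ?thesis
    using deriv_zero_on_open[OF O z e(1) D] deriv_zero_on_open[OF O z e(2) D]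
      deriv_zero_on_open[OF O z e(3) D]
    unfolding vec3_eq_iff ccross_nth vector_smult_component vector_add_component by simp
qed

lemma null_data_exists:
  assumes N: "null_curve \<Omega> F" and O: "open \<Omega>"
  obtains q p where "null_data \<Omega> F q p"
proof -
  have F: "vholo F \<Omega>" and nz: "\<And>z. z \<in> \<Omega> \<Longrightarrow> F z \<noteq> 0" using N by (auto simp: null_curve_def)
  note F' = vholo_vderiv[OF F O] and F'' = vholo_vderiv[OF vholo_vderiv[OF F O] O]
  note j = null_curve_jets[OF N O]
  obtain q0 where q0: "q0 holomorphic_on \<Omega>"
      "\<And>z. z \<in> \<Omega> \<Longrightarrow> ccross (F z) (vderiv F z) = q0 z *s F z"
    using holomorphic_factor_of_parallel[OF F vholo_intros(3)[OF F F'] O nz jet_parallel_1] j by metis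
  define q where "q z = q0 z / (2*\<i>)" for z
  have q: "q holomorphic_on \<Omega>" unfolding q_def by (intro holomorphic_intros q0) auto
  have q1: "ccross (F z) (vderiv F z) = (2*\<i>*q z) *s F z" if "z \<in> \<Omega>" for z
    using q0(2)[OF that] by (simp add: q_def)
  have q2: "ccross (F z) (vderiv (vderiv F) z) = (2*\<i>) *s (deriv q z *s F z + q z *s vderiv F z)"
    if "z \<in> \<Omega>" for z
    by (rule differentiated_cross_relation[OF F O q q1 that])
  define V where "V z = (1/(2*\<i>)) *s ccross (vderiv F z) (vderiv (vderiv F) z) - q z *s vderiv (vderiv F) z
      + deriv q z *s vderiv F z" for z
  have V: "vholo V \<Omega>" unfolding V_def
    by (intro vholo_intros vholo_smult F' F'' q holomorphic_deriv O holomorphic_on_const)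
  have "ccross (F z) (V z) = 0" if z: "z \<in> \<Omega>" for z
    unfolding V_def by (rule jet_parallel_2[OF j[OF z] q1[OF z] nz[OF z] q2[OF z]])
  then obtain p0 where p0: "p0 holomorphic_on \<Omega>" "\<And>z. z \<in> \<Omega> \<Longrightarrow> V z = p0 z *s F z"
    using holomorphic_factor_of_parallel[OF F V O nz] by metis
  define p where "p z = p0 z / 4" for z
  have p: "p holomorphic_on \<Omega>" unfolding p_def by (intro holomorphic_intros p0) auto
  have "jet_data (F z) (vderiv F z) (vderiv (vderiv F) z) (q z) (deriv q z) (p z)" if z: "z \<in> \<Omega>" for z
  proof -
    let ?c = "ccross (vderiv F z) (vderiv (vderiv F) z)"
    have *: "V z = (4 * p z) *s F z" using p0(2)[OF z] by (simp add: p_def)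
    have "?c $ k = 2 * \<i> * (q z * vderiv (vderiv F) z $ k - deriv q z * vderiv F z $ k + 4 * p z * F z $ k)" for k
    proof -
      have "V z $ k = 4 * p z * F z $ k" using * by simp
      then show ?thesis unfolding V_def vector_add_component vector_minus_component vector_smult_component
        by (simp add: field_simps)
    qed
    then show ?thesis unfolding jet_data_def using q1[OF z]
      unfolding vec_eq_iff vector_smult_component vector_add_component vector_minus_component by blast
  qed
  then have "null_data \<Omega> F q p" using N q p by (simp add: null_data_def)
  then show thesis by (rule that)
qed

section \<open>Spinors\<close>

lemma index_3_cases: "P 1 \<Longrightarrow> P 2 \<Longrightarrow> P 3 \<Longrightarrow> P (k :: 3)"
  using exhaust_3[of k] by blast

lemma jets_of_components:
  fixes F D E :: "complex \<Rightarrow> complex^3"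
  assumes O: "open \<Omega>"
    and 1: "\<And>w k. w \<in> \<Omega> \<Longrightarrow> ((\<lambda>w. F w $ k) has_field_derivative D w $ k) (at w)"
    and 2: "\<And>w k. w \<in> \<Omega> \<Longrightarrow> ((\<lambda>w. D w $ k) has_field_derivative E w $ k) (at w)"
    and z: "z \<in> \<Omega>"
  shows "vderiv F z = D z" "vderiv (vderiv F) z = E z"
proof -
  have D: "vderiv F w = D w" if "w \<in> \<Omega>" for w
    using 1[OF that] by (simp add: vec_eq_iff DERIV_imp_deriv)
  then show "vderiv F z = D z" using z by blast
  have "vderiv (vderiv F) z = vderiv D z" by (rule vderiv_cong[OF O z D])
  also have "\<dots> = E z" using 2[OF z] by (simp add: vec_eq_iff DERIV_imp_deriv)
  finally show "vderiv (vderiv F) z = E z" .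
qed

definition spinor_vec :: "complex \<Rightarrow> complex \<Rightarrow> complex^3" where
  "spinor_vec s t = vector [s\<^sup>2 - t\<^sup>2, \<i> * (s\<^sup>2 + t\<^sup>2), 2 * s * t]"

text \<open>For a spinor, $q$ and $p$ are the Wronskian of the two components and the Wronskian of their
  derivatives.\<close>

lemma jet_data_spinor: "jet_data (vector [s\<^sup>2 - t\<^sup>2, \<i> * (s\<^sup>2 + t\<^sup>2), 2 * s * t])
  (vector [2 * s * s1 - 2 * t * t1, \<i> * (2 * s * s1 + 2 * t * t1), 2 * (s * t1 + s1 * t)])
  (vector [2 * s1\<^sup>2 + 2 * s * s2 - 2 * t1\<^sup>2 - 2 * t * t2,
       \<i> * (2 * s1\<^sup>2 + 2 * s * s2 + 2 * t1\<^sup>2 + 2 * t * t2), 2 * (s * t2 + 2 * s1 * t1 + s2 * t)])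
  (s * t1 - t * s1) (s * t2 - t * s2) (s1 * t2 - t1 * s2)"
  unfolding jet_data_def vec3_eq_iff ccross_nth vector_smult_component vector_add_component
    vector_minus_component vector_3
  by (simp add: algebra_simps power2_eq_square)

text \<open>The same invariants in terms of the Gauss map $g$ and the form $f\,dz$; the hypothesis is the spinor
  formula for $p$ with $s^2 = f$ and $t = g s$, freed of square roots.\<close>

lemma jet_data_chart:
  assumes "4 * p * f = 2 * f * (g2 * f1 - g1 * f2) + 3 * g1 * f1\<^sup>2"
  shows "jet_data (vector [(1 - g\<^sup>2) * f, \<i> * (1 + g\<^sup>2) * f, 2 * g * f])
    (vector [(1 - g\<^sup>2) * f1 - 2 * g * g1 * f, \<i> * ((1 + g\<^sup>2) * f1 + 2 * g * g1 * f), 2 * (g * f1 + g1 * f)])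
    (vector [(1 - g\<^sup>2) * f2 - 4 * g * g1 * f1 - 2 * (g1\<^sup>2 + g * g2) * f,
       \<i> * ((1 + g\<^sup>2) * f2 + 4 * g * g1 * f1 + 2 * (g1\<^sup>2 + g * g2) * f),
       2 * (g * f2 + 2 * g1 * f1 + g2 * f)])
    (f * g1) (f * g2 + f1 * g1) p"
proof -
  let ?r = "2 * f * (g2 * f1 - g1 * f2) + 3 * g1 * f1\<^sup>2"
  have r: "4 * p * ((1 - g\<^sup>2) * f) = (1 - g\<^sup>2) * ?r" "4 * p * (\<i> * (1 + g\<^sup>2) * f) = \<i> * (1 + g\<^sup>2) * ?r"
    "4 * p * (2 * g * f) = 2 * g * ?r"
    using assms by algebra+
  show ?thesis
    unfolding jet_data_def vec3_eq_iff ccross_nth vector_smult_component vector_add_component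
      vector_minus_component vector_3 r
    by (simp add: algebra_simps power2_eq_square)
qed

lemma spinor_data:
  assumes O: "open \<Omega>" and s: "s holomorphic_on \<Omega>" and t: "t holomorphic_on \<Omega>"
    and F: "\<And>z. z \<in> \<Omega> \<Longrightarrow> F z = spinor_vec (s z) (t z)" and N: "null_data \<Omega> F q p" and z: "z \<in> \<Omega>"
  shows "q z = s z * deriv t z - t z * deriv s z"
    and "deriv q z = s z * deriv (deriv t) z - t z * deriv (deriv s) z"
    and "p z = deriv s z * deriv (deriv t) z - deriv t z * deriv (deriv s) z"
proof -
  note s' = holomorphic_deriv[OF s O] and t' = holomorphic_deriv[OF t O]
  note s'' = holomorphic_deriv[OF s' O] and t'' = holomorphic_deriv[OF t' O]
  note d = holomorphic_derivI[OF s O] holomorphic_derivI[OF t O]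
    holomorphic_derivI[OF s' O] holomorphic_derivI[OF t' O]
  define G where "G z = spinor_vec (s z) (t z)" for z
  define r where "r z = s z * deriv t z - t z * deriv s z" for z
  define u where "u z = deriv s z * deriv (deriv t) z - deriv t z * deriv (deriv s) z" for z
  have r': "(r has_field_derivative s z * deriv (deriv t) z - t z * deriv (deriv s) z) (at z)" if "z \<in> \<Omega>" for z
    unfolding r_def by (rule derivative_eq_intros d that refl)+ (simp add: algebra_simps)
  define D E where
    "D z = (vector [2 * s z * deriv s z - 2 * t z * deriv t z, \<i> * (2 * s z * deriv s z + 2 * t z * deriv t z),
       2 * (s z * deriv t z + deriv s z * t z)] :: complex^3)"
    and "E z = (vector [2 * (deriv s z)\<^sup>2 + 2 * s z * deriv (deriv s) z - 2 * (deriv t z)\<^sup>2 - 2 * t z * deriv (deriv t) z,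
       \<i> * (2 * (deriv s z)\<^sup>2 + 2 * s z * deriv (deriv s) z + 2 * (deriv t z)\<^sup>2 + 2 * t z * deriv (deriv t) z),
       2 * (s z * deriv (deriv t) z + 2 * deriv s z * deriv t z + deriv (deriv s) z * t z)] :: complex^3)" for z
  have 1: "((\<lambda>w. G w $ k) has_field_derivative D w $ k) (at w)" if w: "w \<in> \<Omega>" for w k
    unfolding G_def D_def spinor_vec_def
    by (induct k rule: index_3_cases; simp only: vector_3; (rule derivative_eq_intros d w refl)+; simp add: algebra_simps)
  have 2: "((\<lambda>w. D w $ k) has_field_derivative E w $ k) (at w)" if w: "w \<in> \<Omega>" for w k
    unfolding E_def D_def
    by (induct k rule: index_3_cases; simp only: vector_3; (rule derivative_eq_intros d w refl)+; simp add: algebra_simps power2_eq_square)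
  have nd: "null_data \<Omega> G r u"
    unfolding null_data_def
  proof (intro conjI ballI)
    show "null_curve \<Omega> G" using null_data_cong[OF N O order_refl, of G] F by (simp add: null_data_def G_def)
    show "r holomorphic_on \<Omega>" "u holomorphic_on \<Omega>"
      unfolding r_def u_def by (intro holomorphic_intros s t s' t' s'' t'')+
  next
    fix z assume z: "z \<in> \<Omega>"
    have i: "\<i> * \<i> = -1" by simp
    have jets: "vderiv G z = D z" "vderiv (vderiv G) z = E z"
      by (rule jets_of_components[where F = G and D = D and E = E, OF O 1 2 z]; assumption)+
    show "jet_data (G z) (vderiv G z) (vderiv (vderiv G) z) (r z) (deriv r z) (u z)"
      unfolding jets DERIV_imp_deriv[OF r'[OF z]]
      unfolding G_def D_def E_def spinor_vec_def r_def u_def by (rule jet_data_spinor)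
  qed
  have e: "q w = r w" if "w \<in> \<Omega>" for w
    by (rule null_data_unique(1)[OF N nd O order_refl order_refl _ that]) (simp add: F G_def)
  then show "q z = s z * deriv t z - t z * deriv s z" using z by (simp add: r_def)
  have "p z = u z"
    by (rule null_data_unique(2)[OF N nd O order_refl order_refl _ z]) (simp add: F G_def)
  then show "p z = deriv s z * deriv (deriv t) z - deriv t z * deriv (deriv s) z" by (simp add: u_def)
  have "deriv q z = deriv r z"
    using eventually_nhds_in_open[OF O z] e by (intro deriv_cong_ev) (auto elim: eventually_mono)
  then show "deriv q z = s z * deriv (deriv t) z - t z * deriv (deriv s) z"
    using DERIV_imp_deriv[OF r'[OF z]] by simp
qed

lemma chart_data:
  assumes O: "open \<Omega>" and g: "g holomorphic_on \<Omega>" and f: "f holomorphic_on \<Omega>"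
    and F: "\<And>z. z \<in> \<Omega> \<Longrightarrow> F z = vector [(1 - (g z)\<^sup>2) * f z, \<i> * (1 + (g z)\<^sup>2) * f z, 2 * g z * f z]"
    and N: "null_data \<Omega> F q p" and z: "z \<in> \<Omega>"
  shows "f z \<noteq> 0" and "q z = f z * deriv g z"
    and "4 * p z * f z = 2 * f z * (deriv (deriv g) z * deriv f z - deriv g z * deriv (deriv f) z)
           + 3 * deriv g z * (deriv f z)\<^sup>2"
proof -
  have fz: "f w \<noteq> 0" if "w \<in> \<Omega>" for w
    using N F[OF that] that by (auto simp: null_data_def null_curve_def vec3_eq_iff)
  then show "f z \<noteq> 0" using z .
  note s' = holomorphic_deriv[OF g O] and t' = holomorphic_deriv[OF f O]
  note s'' = holomorphic_deriv[OF s' O] and t'' = holomorphic_deriv[OF t' O]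
  note d = holomorphic_derivI[OF g O] holomorphic_derivI[OF f O]
    holomorphic_derivI[OF s' O] holomorphic_derivI[OF t' O]
  define G where "G z = (vector [(1 - (g z)\<^sup>2) * f z, \<i> * (1 + (g z)\<^sup>2) * f z, 2 * g z * f z] :: complex^3)" for z
  define r where "r z = f z * deriv g z" for z
  define u where "u z = (2 * f z * (deriv (deriv g) z * deriv f z - deriv g z * deriv (deriv f) z)
      + 3 * deriv g z * (deriv f z)\<^sup>2) / (4 * f z)" for z
  have r': "(r has_field_derivative f z * deriv (deriv g) z + deriv f z * deriv g z) (at z)" if "z \<in> \<Omega>" for z
    unfolding r_def by (rule derivative_eq_intros d that refl)+ (simp add: algebra_simps)
  define D E where
    "D z = (vector [(1 - (g z)\<^sup>2) * deriv f z - 2 * g z * deriv g z * f z,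
        \<i> * ((1 + (g z)\<^sup>2) * deriv f z + 2 * g z * deriv g z * f z),
        2 * (g z * deriv f z + deriv g z * f z)] :: complex^3)"
    and "E z = (vector [(1 - (g z)\<^sup>2) * deriv (deriv f) z - 4 * g z * deriv g z * deriv f z
           - 2 * ((deriv g z)\<^sup>2 + g z * deriv (deriv g) z) * f z,
        \<i> * ((1 + (g z)\<^sup>2) * deriv (deriv f) z + 4 * g z * deriv g z * deriv f z
           + 2 * ((deriv g z)\<^sup>2 + g z * deriv (deriv g) z) * f z),
        2 * (g z * deriv (deriv f) z + 2 * deriv g z * deriv f z + deriv (deriv g) z * f z)] :: complex^3)" for z
  have 1: "((\<lambda>w. G w $ k) has_field_derivative D w $ k) (at w)" if w: "w \<in> \<Omega>" for w k
    unfolding G_def D_def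
    by (induct k rule: index_3_cases; simp only: vector_3; (rule derivative_eq_intros d w refl)+; simp add: algebra_simps)
  have 2: "((\<lambda>w. D w $ k) has_field_derivative E w $ k) (at w)" if w: "w \<in> \<Omega>" for w k
    unfolding E_def D_def
    by (induct k rule: index_3_cases; simp only: vector_3; (rule derivative_eq_intros d w refl)+; simp add: algebra_simps power2_eq_square)
  have nd: "null_data \<Omega> G r u"
    unfolding null_data_def
  proof (intro conjI ballI)
    show "null_curve \<Omega> G" using null_data_cong[OF N O order_refl, of G] F by (simp add: null_data_def G_def)
    show "r holomorphic_on \<Omega>" "u holomorphic_on \<Omega>"
      unfolding r_def u_def by (intro holomorphic_intros g f s' t' s'' t'', (simp_all add: fz)?)+
  next
    fix z assume z: "z \<in> \<Omega>"
    have i: "\<i> * \<i> = -1" by simp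
    have jets: "vderiv G z = D z" "vderiv (vderiv G) z = E z"
      by (rule jets_of_components[where F = G and D = D and E = E, OF O 1 2 z]; assumption)+
    have m: "4 * u z * f z = 2 * f z * (deriv (deriv g) z * deriv f z - deriv g z * deriv (deriv f) z)
           + 3 * deriv g z * (deriv f z)\<^sup>2" using fz[OF z] by (simp add: u_def)
    show "jet_data (G z) (vderiv G z) (vderiv (vderiv G) z) (r z) (deriv r z) (u z)"
      unfolding jets DERIV_imp_deriv[OF r'[OF z]] G_def r_def D_def E_def by (rule jet_data_chart[OF m])
  qed
  have "q z = r z"
    by (rule null_data_unique(1)[OF N nd O order_refl order_refl _ z]) (simp add: F G_def)
  then show "q z = f z * deriv g z" using z by (simp add: r_def)
  have "p z = u z"
    by (rule null_data_unique(2)[OF N nd O order_refl order_refl _ z]) (simp add: F G_def)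
  then show "4 * p z * f z = 2 * f z * (deriv (deriv g) z * deriv f z - deriv g z * deriv (deriv f) z)
           + 3 * deriv g z * (deriv f z)\<^sup>2" using fz[OF z] by (simp add: u_def)
qed

text \<open>A square root of $(\phi_1 - i\phi_2)/2$ serves as $s$; the third component then forces $t$, and the
  null condition does the rest.\<close>

lemma spinor_exists:
  fixes F :: "complex \<Rightarrow> complex^3"
  assumes C: "convex B" and O: "open B" and N: "null_curve B F"
    and nz: "\<And>z. z \<in> B \<Longrightarrow> F z $ 1 - \<i> * F z $ 2 \<noteq> 0"
  obtains s t where "s holomorphic_on B" "t holomorphic_on B" "\<And>z. z \<in> B \<Longrightarrow> s z \<noteq> 0"
    "\<And>z. z \<in> B \<Longrightarrow> F z = spinor_vec (s z) (t z)"
proof -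
  have F: "\<And>k. (\<lambda>w. F w $ k) holomorphic_on B" using N by (simp add: null_curve_def vholo_def)
  have hol: "(\<lambda>z. (F z $ 1 - \<i> * F z $ 2) / 2) holomorphic_on B"
    by (intro holomorphic_intros F) auto
  then obtain l where l: "l holomorphic_on B"
     "\<And>z. z \<in> B \<Longrightarrow> exp (l z) = (F z $ 1 - \<i> * F z $ 2) / 2"
  proof (cases "B = {}")
    case False
    then obtain z0 where "z0 \<in> B" by blast
    with holomorphic_logarithm_exists[OF C O hol _ this] nz that show ?thesis by auto
  qed (use that in auto)
  define s t where "s z = exp (l z / 2)" and "t z = F z $ 3 / (2 * exp (l z / 2))" for z
  have s2: "(s z)\<^sup>2 = (F z $ 1 - \<i> * F z $ 2) / 2" if "z \<in> B" for z
    using l(2)[OF that] by (simp add: s_def exp_double[symmetric])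
  show thesis
  proof (rule that[of s t])
    show "s holomorphic_on B" "t holomorphic_on B" unfolding s_def t_def
      by (intro holomorphic_intros l F; simp)+
    show "s z \<noteq> 0" for z by (simp add: s_def)
    then have s0: "s z \<noteq> 0" for z .
    show "F z = spinor_vec (s z) (t z)" if z: "z \<in> B" for z
    proof -
      have st: "2 * s z * t z = F z $ 3" by (simp add: s_def t_def)
      have c: "F z $ 1 * F z $ 1 + F z $ 2 * F z $ 2 + F z $ 3 * F z $ 3 = 0"
        using N z by (simp add: null_curve_def cdot_def)
      have i: "\<i> * \<i> = -1" by simp
      have "(s z)\<^sup>2 * (2 * (t z)\<^sup>2) = (s z)\<^sup>2 * (- (F z $ 1 + \<i> * F z $ 2))"
        using s2[OF z] st c i by algebra
      then have t2: "2 * (t z)\<^sup>2 = - (F z $ 1 + \<i> * F z $ 2)" using s0 by simp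
      have "(s z)\<^sup>2 - (t z)\<^sup>2 = F z $ 1" using s2[OF z] t2 by algebra
      moreover have "\<i> * ((s z)\<^sup>2 + (t z)\<^sup>2) = F z $ 2"
        using s2[OF z] t2 i by algebra
      ultimately show ?thesis using st by (simp add: vec3_eq_iff spinor_vec_def)
    qed
  qed
qed

text \<open>A cyclic permutation of the axes is a rotation.  It moves a point where
  $\phi_1 - i\phi_2$ vanishes into the domain of the spinor construction.\<close>

lemma null_curve_cyclic:
  assumes "null_data \<Omega> F q p" "open \<Omega>"
  shows "null_data \<Omega> (\<lambda>z. vector [F z $ 2, F z $ 3, F z $ 1]) q p"
proof -
  define G where "G z = (vector [F z $ 2, F z $ 3, F z $ 1] :: complex^3)" for z
  have 1: "vderiv G z = vector [vderiv F z $ 2, vderiv F z $ 3, vderiv F z $ 1]" for z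
    by (simp add: vec3_eq_iff G_def)
  have 2: "vderiv (vderiv G) z = vector [vderiv (vderiv F) z $ 2, vderiv (vderiv F) z $ 3, vderiv (vderiv F) z $ 1]" for z
    by (simp add: vec3_eq_iff G_def)
  have "null_data \<Omega> G q p"
    using assms(1) unfolding null_data_def null_curve_def jet_data_def 2 unfolding 1
    by (auto simp: vholo_def forall_3 G_def vec3_eq_iff cdot_def algebra_simps)
  then show ?thesis by (simp add: G_def[abs_def])
qed

text \<open>The first spinor component is such a solution.  At a point where $q$ vanishes this rules out a
  logarithmic term in the solutions of the equation.  It expresses that the immersion has no branch points.\<close>

lemma solution_near_point:
  assumes N: "null_data \<Omega> F q p" and O: "open \<Omega>" and a: "a \<in> \<Omega>"
  obtains e s where "e > 0" "ball a e \<subseteq> \<Omega>" "s holomorphic_on ball a e" "s a \<noteq> 0"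
    "\<And>z. z \<in> ball a e \<Longrightarrow> q z * deriv (deriv s) z - deriv q z * deriv s z + p z * s z = 0"
proof -
  note result = that
  have main: thesis if N: "null_data \<Omega> G q p" and nz: "G a $ 1 - \<i> * G a $ 2 \<noteq> 0" for G
  proof -
    have G: "\<And>k. (\<lambda>w. G w $ k) holomorphic_on \<Omega>" using N by (simp add: null_data_def null_curve_def vholo_def)
    have "continuous_on \<Omega> (\<lambda>z. G z $ 1 - \<i> * G z $ 2)"
      by (intro holomorphic_on_imp_continuous_on holomorphic_intros G)
    then have "open {z \<in> \<Omega>. G z $ 1 - \<i> * G z $ 2 \<noteq> 0}"
      using continuous_open_preimage[OF _ O, of "\<lambda>z. G z $ 1 - \<i> * G z $ 2" "- {0}"] open_delete[OF open_UNIV, of 0]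
      by (simp add: Int_def vimage_def Compl_eq_Diff_UNIV)
    then obtain e where e: "e > 0" "ball a e \<subseteq> {z \<in> \<Omega>. G z $ 1 - \<i> * G z $ 2 \<noteq> 0}"
      using a nz openE by blast
    have N': "null_data (ball a e) G q p" using null_data_cong[OF N open_ball, of a e] e by auto
    then obtain s t where s: "s holomorphic_on ball a e" "t holomorphic_on ball a e" "\<And>z. z \<in> ball a e \<Longrightarrow> s z \<noteq> 0"
      "\<And>z. z \<in> ball a e \<Longrightarrow> G z = spinor_vec (s z) (t z)"
      using spinor_exists[OF convex_ball open_ball, of a e G] e unfolding null_data_def by blast
    show thesis
    proof (rule result[OF e(1) _ s(1)])
      show "ball a e \<subseteq> \<Omega>" "s a \<noteq> 0" using e s(3) by auto
      show "q z * deriv (deriv s) z - deriv q z * deriv s z + p z * s z = 0" if "z \<in> ball a e" for z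
        using spinor_data[where F = G and s = s and t = t, OF open_ball s(1,2,4) N' that] by algebra
    qed
  qed
  show thesis
  proof (cases "F a $ 1 - \<i> * F a $ 2 = 0")
    case False then show ?thesis using main N by blast
  next
    case True
    have i: "\<i> * \<i> = -1" by simp
    have c: "F a $ 1 * F a $ 1 + F a $ 2 * F a $ 2 + F a $ 3 * F a $ 3 = 0" and F0: "F a \<noteq> 0"
      using N a by (auto simp: null_data_def null_curve_def cdot_def)
    have "(F a $ 3)\<^sup>2 = 0" using True c i by algebra
    then have "F a $ 3 = 0" by simp
    moreover from this have "F a $ 2 \<noteq> 0" using True F0 by (auto simp: vec3_eq_iff)
    ultimately have "F a $ 2 - \<i> * F a $ 3 \<noteq> 0" by simp
    then show ?thesis using main[OF null_curve_cyclic[OF N O]] by simp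
  qed
qed

text \<open>Abel's formula: the Wronskian of two solutions satisfies $W' = (q'/q) W$.\<close>

lemma wronskian_quotient_constant:
  assumes B: "convex B" "open B" and q: "q holomorphic_on B" "\<And>z. z \<in> B \<Longrightarrow> q z \<noteq> 0"
    and y: "y holomorphic_on B" "\<And>z. z \<in> B \<Longrightarrow> q z * deriv (deriv y) z - deriv q z * deriv y z + p z * y z = 0"
    and x: "x holomorphic_on B" "\<And>z. z \<in> B \<Longrightarrow> q z * deriv (deriv x) z - deriv q z * deriv x z + p z * x z = 0"
  obtains c where "\<And>z. z \<in> B \<Longrightarrow> x z * deriv y z - y z * deriv x z = c * q z"
proof -
  note d = holomorphic_derivI[OF q(1) B(2)] holomorphic_derivI[OF y(1) B(2)] holomorphic_derivI[OF x(1) B(2)]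
    holomorphic_derivI[OF holomorphic_deriv[OF y(1) B(2)] B(2)] holomorphic_derivI[OF holomorphic_deriv[OF x(1) B(2)] B(2)]
  have d0: "((\<lambda>z. (x z * deriv y z - y z * deriv x z) / q z) has_field_derivative 0) (at z within B)" if z: "z \<in> B" for z
  proof -
    have "((\<lambda>z. (x z * deriv y z - y z * deriv x z) / q z) has_field_derivative
       (((x z * deriv (deriv y) z - y z * deriv (deriv x) z) * q z - (x z * deriv y z - y z * deriv x z) * deriv q z)
         / (q z * q z))) (at z)"
      by (rule derivative_eq_intros d(1)[OF z] d(2)[OF z] d(3)[OF z] d(4)[OF z] d(5)[OF z] refl q(2)[OF z])+
        (simp add: algebra_simps)
    moreover have "(x z * deriv (deriv y) z - y z * deriv (deriv x) z) * q z - (x z * deriv y z - y z * deriv x z) * deriv q z = 0"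
      using y(2)[OF z] x(2)[OF z] by algebra
    ultimately show ?thesis by (simp add: has_field_derivative_at_within)
  qed
  obtain c where c: "\<forall>z\<in>B. (x z * deriv y z - y z * deriv x z) / q z = c"
    using has_field_derivative_zero_constant[OF B(1) d0] by blast
  show thesis
  proof (rule that[of c])
    show "x z * deriv y z - y z * deriv x z = c * q z" if "z \<in> B" for z
      using c that q(2)[OF that] by (metis nonzero_eq_divide_eq)
  qed
qed

lemma matrix3_mult_nth:
  fixes M :: "complex^3^3"
  shows "(M *v v) $ i = M$i$1 * v$1 + M$i$2 * v$2 + M$i$3 * v$3"
  by (simp add: matrix_vector_mult_def sum_3)

text \<open>The second spinor is expressed through the first one by Cramer's rule, and the coefficients are
  quotients of Wronskians, hence constant.  The matrix $M$ is the action on $\mathbb{C}^3$ of the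
  resulting element of $SL(2,\mathbb{C})$, so it is complex orthogonal of determinant one.\<close>

lemma matrix_of_same_null_data:
  fixes F G :: "complex \<Rightarrow> complex^3"
  assumes B: "convex B" "open B" "z0 \<in> B" and F: "null_data B F q p" and G: "null_data B G q p"
    and q0: "\<And>z. z \<in> B \<Longrightarrow> q z \<noteq> 0"
    and nz: "\<And>z. z \<in> B \<Longrightarrow> F z $ 1 - \<i> * F z $ 2 \<noteq> 0" "\<And>z. z \<in> B \<Longrightarrow> G z $ 1 - \<i> * G z $ 2 \<noteq> 0"
  obtains M :: "complex^3^3" where "transpose M ** M = mat 1" "det M = 1" "\<And>z. z \<in> B \<Longrightarrow> G z = M *v F z"
proof -
  have q: "q holomorphic_on B" using F by (simp add: null_data_def)
  have NF: "null_curve B F" and NG: "null_curve B G" using F G by (simp_all add: null_data_def)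
  obtain s t where s: "s holomorphic_on B" "t holomorphic_on B" "\<And>z. z \<in> B \<Longrightarrow> s z \<noteq> 0"
    "\<And>z. z \<in> B \<Longrightarrow> F z = spinor_vec (s z) (t z)"
    by (rule spinor_exists[OF B(1,2) NF nz(1)]) (assumption | rule that)+
  obtain S T where S: "S holomorphic_on B" "T holomorphic_on B" "\<And>z. z \<in> B \<Longrightarrow> S z \<noteq> 0"
    "\<And>z. z \<in> B \<Longrightarrow> G z = spinor_vec (S z) (T z)"
    by (rule spinor_exists[OF B(1,2) NG nz(2)]) (assumption | rule that)+
  have ds: "q z = s z * deriv t z - t z * deriv s z"
      "deriv q z = s z * deriv (deriv t) z - t z * deriv (deriv s) z"
      "p z = deriv s z * deriv (deriv t) z - deriv t z * deriv (deriv s) z" if "z \<in> B" for z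
    by (rule spinor_data[where F = F, OF B(2) s(1,2) _ F that], erule s(4))+
  have dS: "q z = S z * deriv T z - T z * deriv S z"
      "deriv q z = S z * deriv (deriv T) z - T z * deriv (deriv S) z"
      "p z = deriv S z * deriv (deriv T) z - deriv T z * deriv (deriv S) z" if "z \<in> B" for z
    by (rule spinor_data[where F = G, OF B(2) S(1,2) _ G that], erule S(4))+
  have es: "q z * deriv (deriv s) z - deriv q z * deriv s z + p z * s z = 0"
     "q z * deriv (deriv t) z - deriv q z * deriv t z + p z * t z = 0" if "z \<in> B" for z
    using ds[OF that] by algebra+
  have eS: "q z * deriv (deriv S) z - deriv q z * deriv S z + p z * S z = 0"
     "q z * deriv (deriv T) z - deriv q z * deriv T z + p z * T z = 0" if "z \<in> B" for z
    using dS[OF that] by algebra+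
  note w = wronskian_quotient_constant[where p = p and q = q, OF B(1,2) q]
  obtain a where a: "\<And>z. z \<in> B \<Longrightarrow> S z * deriv t z - t z * deriv S z = a * q z"
    by (rule w[where y = t and x = S]) (erule q0 s S es eS | rule q0 s S es eS that | assumption)+
  obtain b where b: "\<And>z. z \<in> B \<Longrightarrow> s z * deriv S z - S z * deriv s z = b * q z"
    by (rule w[where y = S and x = s]) (erule q0 s S es eS | rule q0 s S es eS that | assumption)+
  obtain c where c: "\<And>z. z \<in> B \<Longrightarrow> T z * deriv t z - t z * deriv T z = c * q z"
    by (rule w[where y = t and x = T]) (erule q0 s S es eS | rule q0 s S es eS that | assumption)+
  obtain d where d: "\<And>z. z \<in> B \<Longrightarrow> s z * deriv T z - T z * deriv s z = d * q z"
    by (rule w[where y = T and x = s]) (erule q0 s S es eS | rule q0 s S es eS that | assumption)+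
  have ST: "S z = a * s z + b * t z" "T z = c * s z + d * t z" if z: "z \<in> B" for z
  proof -
    have "q z * S z = q z * (a * s z + b * t z)"
      using a[OF z] b[OF z] ds(1)[OF z] by algebra
    then show "S z = a * s z + b * t z" using q0[OF z] by simp
    have "q z * T z = q z * (c * s z + d * t z)"
      using c[OF z] d[OF z] ds(1)[OF z] by algebra
    then show "T z = c * s z + d * t z" using q0[OF z] by simp
  qed
  have det: "a * d - b * c = 1"
  proof -
    note z = B(3)
    have "q z0 * (q z0 * (a * d - b * c)) = q z0 * q z0"
      using a[OF z] b[OF z] c[OF z] d[OF z] ds(1)[OF z] dS(1)[OF z] by algebra
    then show ?thesis using q0[OF z] by simp
  qed
  define M :: "complex^3^3" where "M = vector [
     vector [(a^2 - c^2 - b^2 + d^2) / 2, - \<i> * (a^2 - c^2 + b^2 - d^2) / 2, a*b - c*d],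
     vector [\<i> * (a^2 + c^2 - b^2 - d^2) / 2, (a^2 + c^2 + b^2 + d^2) / 2, \<i> * (a*b + c*d)],
     vector [a*c - b*d, - \<i> * (a*c + b*d), a*d + b*c]]"
  have i: "\<i> * \<i> = -1" by simp
  show thesis
  proof (rule that[of M])
    have e: "(transpose M ** M) $ i $ j = M$1$i * M$1$j + M$2$i * M$2$j + M$3$i * M$3$j" for i j
      by (simp add: matrix_matrix_mult_def transpose_def sum_3)
    have "(transpose M ** M) $ i $ j = (if i = j then (a * d - b * c)\<^sup>2 else 0)" for i j
      unfolding e
      by (induct i rule: index_3_cases; induct j rule: index_3_cases; simp only: M_def vector_3;
          simp add: field_simps power2_eq_square)
    then show "transpose M ** M = mat 1" by (simp add: vec_eq_iff mat_def det)
    have "det M = (a * d - b * c)^3"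
      unfolding det_3 M_def vector_3 by (simp add: field_simps power2_eq_square power3_eq_cube)
    then show "det M = 1" by (simp add: det)
    show "G z = M *v F z" if z: "z \<in> B" for z
      unfolding S(4)[OF z] s(4)[OF z] ST[OF z] vec3_eq_iff matrix3_mult_nth
      unfolding M_def vector_3 spinor_vec_def
      by (simp add: field_simps power2_eq_square)
  qed
qed

section \<open>Counting the admissible numerators\<close>

lemma card_cubic_roots_le:
  fixes k a b c :: complex
  assumes "k \<noteq> 0"
  shows "finite {x. k * x^3 + a * x^2 + b * x + c = 0}" "card {x. k * x^3 + a * x^2 + b * x + c = 0} \<le> 3"
proof -
  let ?p = "[:c, b, a, k:]"
  have e: "{x. k * x^3 + a * x^2 + b * x + c = 0} = {x. poly ?p x = 0}"
    by (simp add: algebra_simps power2_eq_square power3_eq_cube)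
  have p: "?p \<noteq> 0" "degree ?p = 3" using assms by simp_all
  show "finite {x. k * x^3 + a * x^2 + b * x + c = 0}" unfolding e by (rule poly_roots_finite[OF p(1)])
  show "card {x. k * x^3 + a * x^2 + b * x + c = 0} \<le> 3"
    unfolding e using card_poly_roots_bound[OF p(1)] p(2) by simp
qed

text \<open>The first equation expresses $Y$ as a quadratic polynomial in $X$; substitution into the second one
  gives a quartic equation in $X$ with leading coefficient one.\<close>

lemma card_conic_pair_le:
  fixes \<alpha> \<beta> \<gamma> \<alpha>' \<beta>' \<gamma>' :: complex
  assumes "\<beta> \<noteq> 0"
  defines "S \<equiv> {(X, Y). X^2 + \<alpha> * X + \<beta> * Y + \<gamma> = 0 \<and> Y^2 + \<alpha>' * Y + \<beta>' * X + \<gamma>' = 0}"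
  shows "finite S" "card S \<le> 4"
proof -
  let ?p = "[:\<gamma>^2 - \<beta> * \<alpha>' * \<gamma> + \<beta>^2 * \<gamma>', 2 * \<alpha> * \<gamma> - \<beta> * \<alpha>' * \<alpha> + \<beta>^2 * \<beta>',
      \<alpha>^2 + 2 * \<gamma> - \<beta> * \<alpha>', 2 * \<alpha>, 1:]"
  have p: "?p \<noteq> 0" "degree ?p = 4" by simp_all
  have sub: "fst ` S \<subseteq> {x. poly ?p x = 0}"
  proof clarify
    fix X Y assume "(X, Y) \<in> S"
    then have 1: "X^2 + \<alpha> * X + \<beta> * Y + \<gamma> = 0" and 2: "Y^2 + \<alpha>' * Y + \<beta>' * X + \<gamma>' = 0"
      by (auto simp: S_def)
    have "poly ?p X = (X^2 + \<alpha> * X + \<gamma>)^2 - \<beta> * \<alpha>' * (X^2 + \<alpha> * X + \<gamma>) + \<beta>^2 * (\<beta>' * X + \<gamma>')"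
      by (simp add: algebra_simps power2_eq_square)
    also have "\<dots> = 0" using 1 2 by algebra
    finally show "poly ?p (fst (X, Y)) = 0" by simp
  qed
  have inj: "inj_on fst S"
  proof (rule inj_onI, clarify)
    fix X Y X' Y' assume "(X, Y) \<in> S" "(X', Y') \<in> S" "fst (X, Y) = fst (X', Y')"
    then have X: "X = X'" and 1: "X^2 + \<alpha> * X + \<beta> * Y + \<gamma> = 0" and 2: "X'^2 + \<alpha> * X' + \<beta> * Y' + \<gamma> = 0"
      by (auto simp: S_def)
    have "\<beta> * Y = \<beta> * Y'" using 1 2 unfolding X by algebra
    then show "X = X' \<and> Y = Y'" using X assms by simp
  qed
  have f: "finite {x. poly ?p x = 0}" by (rule poly_roots_finite[OF p(1)])
  show "finite S" using finite_imageD[OF finite_subset[OF sub f] inj] .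
  have "card S = card (fst ` S)" using card_image[OF inj] by simp
  also have "\<dots> \<le> card {x. poly ?p x = 0}" by (rule card_mono[OF f sub])
  also have "\<dots> \<le> 4" using card_poly_roots_bound[OF p(1)] p(2) by simp
  finally show "card S \<le> 4" .
qed

text \<open>The function $h = z^2(z-1)^2$ that clears the double poles at the two finite ends.\<close>

definition cusp_poly :: "complex poly" where "cusp_poly = [:0, -1, 1:]^2"

text \<open>The equation is $q y'' - q' y' + p y = 0$ for $q = P/h$ and $p = N/h^2$, multiplied by $h^2$.\<close>

definition log_free :: "complex poly \<Rightarrow> complex poly \<Rightarrow> complex \<Rightarrow> bool" where
  "log_free P N a \<longleftrightarrow> (\<exists>e>0. \<exists>s. s holomorphic_on ball a e \<and> s a \<noteq> 0 \<and>
     (\<forall>z\<in>ball a e. poly (cusp_poly * P) z * deriv (deriv s) z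
        - poly (cusp_poly * pderiv P - pderiv cusp_poly * P) z * deriv s z + poly N z * s z = 0))"

lemma derivI_ball:
  assumes "s holomorphic_on ball a e"
  shows "z \<in> ball a e \<Longrightarrow> (s has_field_derivative deriv s z) (at z)"
    "z \<in> ball a e \<Longrightarrow> (deriv s has_field_derivative deriv (deriv s) z) (at z)"
    "z \<in> ball a e \<Longrightarrow> (deriv (deriv s) has_field_derivative deriv (deriv (deriv s)) z) (at z)"
    "z \<in> ball a e \<Longrightarrow> (deriv (deriv (deriv s)) has_field_derivative deriv (deriv (deriv (deriv s))) z) (at z)"
  using assms by (auto intro!: holomorphic_derivI[OF _ open_ball] holomorphic_deriv)

text \<open>At a simple zero $a$ of $P$ the equation and its first derivative involve only $s(a)$ and $s'(a)$;
  eliminating the ratio of these two numbers leaves a quadratic condition on $N$.\<close>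

lemma log_free_simple:
  assumes L: "log_free P N a" and a: "poly P a = 0"
  shows "(poly N a)^2 + poly cusp_poly a *
     (poly (pderiv N) a * poly (pderiv P) a - poly N a * poly (pderiv (pderiv P)) a) = 0"
proof -
  define A B where "A = cusp_poly * P" and "B = cusp_poly * pderiv P - pderiv cusp_poly * P"
  obtain e s where e: "e > 0" and s: "s holomorphic_on ball a e" "s a \<noteq> 0" and
    ode: "\<And>z. z \<in> ball a e \<Longrightarrow> poly A z * deriv (deriv s) z - poly B z * deriv s z + poly N z * s z = 0"
    using L unfolding log_free_def A_def B_def by blast
  have a': "a \<in> ball a e" using e by simp
  note d = derivI_ball[OF s(1) a']
  have "((\<lambda>z. poly A z * deriv (deriv s) z - poly B z * deriv s z + poly N z * s z) has_field_derivative
     (poly (pderiv A) a * deriv (deriv s) a + poly A a * deriv (deriv (deriv s)) a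
      - (poly (pderiv B) a * deriv s a + poly B a * deriv (deriv s) a) + (poly (pderiv N) a * s a + poly N a * deriv s a))) (at a)"
    by (rule derivative_eq_intros d poly_DERIV refl)+ (simp add: algebra_simps)
  from deriv_zero_on_open[OF open_ball a' ode this]
  have 1: "poly (pderiv A) a * deriv (deriv s) a + poly A a * deriv (deriv (deriv s)) a
      - (poly (pderiv B) a * deriv s a + poly B a * deriv (deriv s) a) + (poly (pderiv N) a * s a + poly N a * deriv s a) = 0" .
  note 0 = ode[OF a']
  have A: "poly A a = 0" "poly (pderiv A) a = poly cusp_poly a * poly (pderiv P) a"
    using a by (simp_all add: A_def pderiv_mult)
  have B: "poly B a = poly cusp_poly a * poly (pderiv P) a" "poly (pderiv B) a = poly cusp_poly a * poly (pderiv (pderiv P)) a"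
    using a by (simp_all add: B_def pderiv_mult pderiv_diff)
  have "s a * ((poly N a)^2 + poly cusp_poly a *
     (poly (pderiv N) a * poly (pderiv P) a - poly N a * poly (pderiv (pderiv P)) a)) = 0"
    using 0 1 unfolding A B by algebra
  then show ?thesis using s(2) by simp
qed

text \<open>The variables are the values at the double zero of $h$, $h'$, $s$, $s'$, $s''$ and of $M$, $M'$, $M''$;
  the first two equations give $s'$ and $s''$ in terms of $s$.\<close>

lemma double_root_elimination:
  fixes c :: complex
  assumes 0: "2 * c * h * s1 = n * s0" and 1: "c * h * s2 = n1 * s0 + n * s1 - c * h1 * s1"
    and 2: "n2 * s0 + 2 * n1 * s1 + n * s2 = 0"
  shows "s0 * (n^3 - c * h1 * n^2 + 4 * h * c * n * n1 + 2 * h^2 * c^2 * n2) = 0"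
proof -
  have a: "2 * h^2 * c^2 * (n * s2) = 2 * (c * h) * n * (n1 * s0 + n * s1 - c * h1 * s1)"
    unfolding 1[symmetric] by (simp add: power2_eq_square)
  have "s0 * (n^3 - c * h1 * n^2 + 4 * h * c * n * n1 + 2 * h^2 * c^2 * n2)
    = 2 * h^2 * c^2 * (n2 * s0 + 2 * n1 * s1 + n * s2)
      + (n^2 - c * h1 * n + 2 * h * c * n1) * (n * s0 - 2 * c * h * s1)"
    unfolding distrib_left a by (simp add: algebra_simps power2_eq_square power3_eq_cube)
  then show ?thesis using 0 2 by simp
qed

text \<open>At a double zero the indicial exponents are $0$ and $3$, so the obstruction to a holomorphic solution
  appears in the third step of the recursion and is cubic in the free parameter.  After division by
  $z - a$, the third derivative of $s$ cancels from the second derivative of the equation.\<close>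

lemma log_free_double:
  assumes L: "log_free (smult c ([:-a, 1:]^2)) N a" and c: "c \<noteq> 0"
  shows "poly N a = 0"
    and "N = [:-a, 1:] * M \<Longrightarrow> (poly M a)^3 - c * poly (pderiv cusp_poly) a * (poly M a)^2
       + 4 * poly cusp_poly a * c * poly M a * poly (pderiv M) a
       + 2 * (poly cusp_poly a)^2 * c^2 * poly (pderiv (pderiv M)) a = 0"
proof -
  define P where "P = smult c ([:-a, 1:]^2)"
  define h where "h = cusp_poly"
  have P: "poly P z = c * (z - a)^2" "poly (pderiv P) z = 2 * c * (z - a)" for z
    by (simp_all add: P_def pderiv_smult pderiv_power pderiv_mult power2_eq_square pderiv_pCons algebra_simps)
  obtain e s where e: "e > 0" and s: "s holomorphic_on ball a e" "s a \<noteq> 0" and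
    ode: "\<And>z. z \<in> ball a e \<Longrightarrow> poly (h * P) z * deriv (deriv s) z
       - poly (h * pderiv P - pderiv h * P) z * deriv s z + poly N z * s z = 0"
    using L unfolding log_free_def P_def h_def by blast
  have a': "a \<in> ball a e" using e by simp
  show "poly N a = 0" using ode[OF a'] s(2) by (simp add: P)
  assume N: "N = [:-a, 1:] * M"
  define B where "B = 2 * h - pderiv h * [:-a, 1:]"
  define G where "G z = c * poly h z * (z - a) * deriv (deriv s) z - c * poly B z * deriv s z + poly M z * s z" for z
  note d = derivI_ball[OF s(1)]
  have G': "(G has_field_derivative
      c * (poly (pderiv h) z * (z - a) + poly h z) * deriv (deriv s) z + c * poly h z * (z - a) * deriv (deriv (deriv s)) z
      - c * poly (pderiv B) z * deriv s z - c * poly B z * deriv (deriv s) z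
      + poly (pderiv M) z * s z + poly M z * deriv s z) (at z)" (is "(_ has_field_derivative ?G' z) _")
    if z: "z \<in> ball a e" for z
    unfolding G_def by (rule derivative_eq_intros d[OF z] poly_DERIV refl)+ (simp add: algebra_simps)
  define G1 where "G1 z = ?G' z" for z
  have G'': "(G1 has_field_derivative
      c * (poly (pderiv (pderiv h)) a * 0 + 2 * poly (pderiv h) a) * deriv (deriv s) a
       + 2 * c * poly h a * deriv (deriv (deriv s)) a
      - c * poly (pderiv (pderiv B)) a * deriv s a - 2 * c * poly (pderiv B) a * deriv (deriv s) a
      - c * poly B a * deriv (deriv (deriv s)) a
      + poly (pderiv (pderiv M)) a * s a + 2 * poly (pderiv M) a * deriv s a + poly M a * deriv (deriv s) a) (at a)"
    unfolding G1_def by (rule derivative_eq_intros d[OF a'] poly_DERIV refl)+ (simp add: algebra_simps)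
  \<comment> \<open>The differential equation is $z - a$ times $G$, and the value of $G$ at $a$ is recovered by differentiation.\<close>
  have zG: "(z - a) * G z = 0" if z: "z \<in> ball a e" for z
    using ode[OF z] by (simp add: P G_def N B_def algebra_simps power2_eq_square)
  have G0: "G z = 0" if z: "z \<in> ball a e" for z
  proof (cases "z = a")
    case True
    have "((\<lambda>z. (z - a) * G z) has_field_derivative G a) (at a)"
      by (rule derivative_eq_intros G'[OF a'] refl)+ simp
    from deriv_zero_on_open[OF open_ball a' zG this] show ?thesis using True by simp
  qed (use zG[OF z] in simp)
  have G1: "G1 z = 0" if z: "z \<in> ball a e" for z
    using deriv_zero_on_open[OF open_ball z G0 G'[OF z]] by (simp add: G1_def)
  note 2 = deriv_zero_on_open[OF open_ball a' G1 G'']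
  note 1 = G1[OF a', unfolded G1_def] and 0 = G0[OF a', unfolded G_def]
  have B: "poly B a = 2 * poly h a" "poly (pderiv B) a = poly (pderiv h) a" "poly (pderiv (pderiv B)) a = 0"
    by (simp_all add: B_def pderiv_diff pderiv_add pderiv_minus pderiv_smult pderiv_mult pderiv_pCons)
  have "s a * ((poly M a)^3 - c * poly (pderiv h) a * (poly M a)^2 + 4 * poly h a * c * poly M a * poly (pderiv M) a
       + 2 * (poly h a)^2 * c^2 * poly (pderiv (pderiv M)) a) = 0"
  proof -
    have 0: "2 * c * poly h a * deriv s a = poly M a * s a" using 0 by (simp add: B algebra_simps)
    have 1: "c * poly h a * deriv (deriv s) a = poly (pderiv M) a * s a + poly M a * deriv s a - c * poly (pderiv h) a * deriv s a"
      using 1 by (simp add: B algebra_simps)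
    have 2: "poly (pderiv (pderiv M)) a * s a + 2 * poly (pderiv M) a * deriv s a + poly M a * deriv (deriv s) a = 0"
      using 2 by (simp add: B algebra_simps)
    show ?thesis by (rule double_root_elimination[OF 0 1 2])
  qed
  then show "(poly M a)^3 - c * poly (pderiv cusp_poly) a * (poly M a)^2
       + 4 * poly cusp_poly a * c * poly M a * poly (pderiv M) a
       + 2 * (poly cusp_poly a)^2 * c^2 * poly (pderiv (pderiv M)) a = 0"
    using s(2) by (simp add: h_def)
qed

lemma quadratic_factorization:
  fixes P :: "complex poly"
  assumes "degree P = 2"
  obtains c a b where "c \<noteq> 0" "P = smult c ([:-a, 1:] * [:-b, 1:])"
proof -
  have "coeff P 2 \<noteq> 0" using assms leading_coeff_0_iff[of P] by fastforce
  then obtain a where "(\<Sum>i\<le>2. coeff P i * a ^ i) = 0"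
    using fundamental_theorem_of_algebra[of "coeff P" 2] by fastforce
  then have a: "poly P a = 0" using assms by (simp add: poly_altdef)
  then obtain R where R: "P = [:-a, 1:] * R" by (metis dvdE poly_eq_0_iff_dvd)
  have "R \<noteq> 0" using R assms by auto
  then have "degree P = 1 + degree R" unfolding R by (subst degree_mult_eq) auto
  then have "degree R = 1" using assms by simp
  then have "R = [:coeff R 0, coeff R 1:]"
    by (intro poly_eqI) (auto simp: coeff_pCons coeff_eq_0 split: nat.split)
  moreover have "coeff R 1 \<noteq> 0" using \<open>degree R = 1\<close> \<open>R \<noteq> 0\<close> by (metis leading_coeff_0_iff)
  ultimately obtain u c where R': "R = [:u, c:]" "c \<noteq> 0" by blast
  have "P = smult c ([:-a, 1:] * [:-(-u/c), 1:])" using R R' by (simp add: algebra_simps)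
  with R'(2) show thesis by (rule that)
qed

definition admissible_numerators :: "complex poly \<Rightarrow> complex \<Rightarrow> complex \<Rightarrow> complex \<Rightarrow> complex poly set" where
  "admissible_numerators P n0 n1 l = {N. degree N \<le> 4 \<and> coeff N 4 = l \<and> poly N 0 = n0 \<and> poly N 1 = n1 \<and>
     (\<forall>a. poly P a = 0 \<longrightarrow> log_free P N a)}"

text \<open>Two numerators agree at $0$, at $1$ and in the coefficient of degree four, so two parameters remain.\<close>

lemma numerator_difference:
  assumes "N \<in> admissible_numerators P n0 n1 l" "N' \<in> admissible_numerators P n0 n1 l"
  obtains m k where "N = N' + [:0, -1, 1:] * [:m, k:]"
proof -
  define D where "D = N - N'"
  have D: "degree D \<le> 4" "coeff D 4 = 0" "poly D 0 = 0" "poly D 1 = 0"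
    using assms by (auto simp: D_def admissible_numerators_def degree_diff_le)
  have "degree D \<le> 3"
  proof (rule degree_le, safe)
    fix i :: nat assume "3 < i"
    then show "coeff D i = 0" using D(1,2) coeff_eq_0[of D i] by (cases "i = 4") auto
  qed
  obtain R where R: "D = [:0, 1:] * R" using D(3) by (metis dvdE poly_eq_0_iff_dvd neg_0_equal_iff_equal)
  have "poly R 1 = 0" using D(4) R by simp
  then obtain L where L: "R = [:-1, 1:] * L" by (metis dvdE poly_eq_0_iff_dvd)
  have e: "D = [:0, -1, 1:] * L" using R L by (simp add: algebra_simps)
  have "degree L \<le> 1"
  proof (cases "L = 0")
    case False
    then have "degree D = 2 + degree L" unfolding e by (subst degree_mult_eq) auto
    then show ?thesis using \<open>degree D \<le> 3\<close> by simp
  qed simp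
  then have "L = [:coeff L 0, coeff L 1:]"
    by (intro poly_eqI) (auto simp: coeff_pCons coeff_eq_0 split: nat.split)
  then show thesis using that[of "coeff L 0" "coeff L 1"] e by (simp add: D_def algebra_simps)
qed

text \<open>In the case of two simple zeros $a, b$ the values $N(a), N(b)$ are coordinates on the affine plane of
  numerators, and the slope $N'(a)$ is an affine function of them in which $N(b)$ really occurs.\<close>

lemma card_admissible_numerators_le:
  assumes P: "degree P = 2" "poly P 0 \<noteq> 0" "poly P 1 \<noteq> 0"
  shows "finite (admissible_numerators P n0 n1 l)" "card (admissible_numerators P n0 n1 l) \<le> 4"
proof -
  let ?A = "admissible_numerators P n0 n1 l"
  have "finite ?A \<and> card ?A \<le> 4"
  proof (cases "?A = {}")
    case False
    then obtain N0 where N0: "N0 \<in> ?A" by blast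
    obtain c a b where c: "c \<noteq> 0" and Pab: "P = smult c ([:-a, 1:] * [:-b, 1:])"
      by (rule quadratic_factorization[OF P(1)])
    have roots: "poly P a = 0" "poly P b = 0" by (simp_all add: Pab algebra_simps)
    define w where "w = [:0, -1, 1 :: complex:]"
    have w0: "poly w a \<noteq> 0" "poly w b \<noteq> 0" using roots P(2,3) by (auto simp: w_def algebra_simps)
    have h: "poly cusp_poly z = (poly w z)^2" for z by (simp add: cusp_poly_def w_def)
    show ?thesis
    proof (cases "a = b")
      case False
      have P': "poly (pderiv P) a = c * (a - b)" "poly (pderiv P) b = c * (b - a)"
        by (simp_all add: Pab pderiv_smult pderiv_mult pderiv_pCons algebra_simps)
      have aff: "\<exists>\<alpha> \<beta> \<gamma>. \<beta> \<noteq> 0 \<and> (\<forall>N\<in>?A. (poly N u)^2 + \<alpha> * poly N u + \<beta> * poly N v + \<gamma> = 0)"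
        if uv: "u \<noteq> v" "poly w u \<noteq> 0" "poly w v \<noteq> 0" "poly P u = 0" "poly (pderiv P) u \<noteq> 0" for u v
      proof -
        define hu P1 P2 k where "hu = poly cusp_poly u" and "P1 = poly (pderiv P) u"
          and "P2 = poly (pderiv (pderiv P)) u" and "k = poly w u / (poly w v * (v - u))"
        \<comment> \<open>Coefficients of the interpolation formula: $N - N_0$ is $w$ times a linear polynomial given by its values at $u$ and $v$.\<close>
        define j where "j = poly (pderiv w) u / poly w u - 1 / (v - u)"
        have slope: "poly (pderiv N) u = poly (pderiv N0) u + j * (poly N u - poly N0 u) + k * (poly N v - poly N0 v)"
          if N: "N \<in> ?A" for N
        proof -
          obtain m t where N': "N = N0 + w * [:m, t:]"
            using numerator_difference[OF N N0] unfolding w_def by blast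
          have "poly (pderiv N) u = poly (pderiv N0) u + poly (pderiv w) u * (m + u * t) + poly w u * t"
            by (simp add: N' pderiv_add pderiv_mult pderiv_smult pderiv_pCons algebra_simps)
          moreover have "poly N u - poly N0 u = poly w u * (m + u * t)" "poly N v - poly N0 v = poly w v * (m + v * t)"
            by (simp_all add: N' algebra_simps)
          moreover have "j * (poly w u * (m + u * t)) + k * (poly w v * (m + v * t))
              = poly (pderiv w) u * (m + u * t) + poly w u * t"
          proof -
            have "j * (poly w u * (m + u * t)) = poly (pderiv w) u * (m + u * t) - poly w u * (m + u * t) / (v - u)"
              using uv by (simp add: j_def field_simps)
            moreover have "k * (poly w v * (m + v * t)) = poly w u * (m + v * t) / (v - u)"
              using uv by (simp add: k_def)
            moreover have "poly w u * (m + v * t) / (v - u) - poly w u * (m + u * t) / (v - u) = poly w u * t"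
              using uv by (simp add: diff_divide_distrib[symmetric] algebra_simps) (simp add: field_simps)
            ultimately show ?thesis by (simp add: algebra_simps)
          qed
          ultimately show ?thesis by simp
        qed
        have "(poly N u)^2 + (hu * P1 * j - hu * P2) * poly N u + (hu * P1 * k) * poly N v
            + hu * P1 * (poly (pderiv N0) u - j * poly N0 u - k * poly N0 v) = 0" if N: "N \<in> ?A" for N
        proof -
          have "log_free P N u" using N uv(4) by (simp add: admissible_numerators_def)
          from log_free_simple[OF this uv(4)] show ?thesis
            unfolding slope[OF N] hu_def[symmetric] P1_def[symmetric] P2_def[symmetric] by algebra
        qed
        moreover have "hu * P1 * k \<noteq> 0"
          using uv by (simp add: hu_def P1_def k_def h)
        ultimately show ?thesis by blast
      qed
      obtain \<alpha> \<beta> \<gamma> where 1: "\<beta> \<noteq> 0" "\<And>N. N \<in> ?A \<Longrightarrow> (poly N a)^2 + \<alpha> * poly N a + \<beta> * poly N b + \<gamma> = 0"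
        using aff[of a b] w0 roots P' c False by auto
      obtain \<alpha>' \<beta>' \<gamma>' where 2: "\<And>N. N \<in> ?A \<Longrightarrow> (poly N b)^2 + \<alpha>' * poly N b + \<beta>' * poly N a + \<gamma>' = 0"
        using aff[of b a] w0 roots P' c False by auto
      let ?S = "{(X, Y). X^2 + \<alpha> * X + \<beta> * Y + \<gamma> = 0 \<and> Y^2 + \<alpha>' * Y + \<beta>' * X + \<gamma>' = 0}"
      let ?ev = "\<lambda>N. (poly N a, poly N b)"
      have sub: "?ev ` ?A \<subseteq> ?S" using 1(2) 2 by auto
      have inj: "inj_on ?ev ?A"
      proof (rule inj_onI)
        fix N N' assume N: "N \<in> ?A" "N' \<in> ?A" and eq: "?ev N = ?ev N'"
        obtain m t where N': "N = N' + w * [:m, t:]"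
          using numerator_difference[OF N] unfolding w_def by blast
        have "poly w a * (m + a * t) = 0" "poly w b * (m + b * t) = 0"
          using eq by (simp_all add: N' algebra_simps)
        then have "m + a * t = 0" "m + b * t = 0" using w0 by simp_all
        then have "(a - b) * t = 0" by algebra
        then have "t = 0" using False by simp
        then show "N = N'" using \<open>m + a * t = 0\<close> by (simp add: N')
      qed
      have fin: "finite ?S" "card ?S \<le> 4" by (rule card_conic_pair_le[OF 1(1)])+
      have "finite ?A" by (rule finite_imageD[OF finite_subset[OF sub fin(1)] inj])
      moreover have "card ?A \<le> card ?S" using card_mono[OF fin(1) sub] card_image[OF inj] by simp
      ultimately show ?thesis using fin(2) by simp
    next
      case True
      have Pa: "P = smult c ([:-a, 1:]^2)" using Pab True by (simp add: power2_eq_square)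
      have z: "poly N a = 0" if "N \<in> ?A" for N
        using that roots c log_free_double(1)[of c a N] by (simp add: admissible_numerators_def Pa)
      obtain M0 where M0: "N0 = [:-a, 1:] * M0" using z[OF N0] by (metis dvdE poly_eq_0_iff_dvd)
      define wa w1 x x1 x2 h0 h1 where "wa = poly w a" and "w1 = poly (pderiv w) a" and "x = poly M0 a"
        and "x1 = poly (pderiv M0) a" and "x2 = poly (pderiv (pderiv M0)) a"
        and "h0 = poly cusp_poly a" and "h1 = poly (pderiv cusp_poly) a"
      have w2: "poly (pderiv (pderiv w)) a = 2" by (simp add: w_def pderiv_pCons)
      define k3 k2 k1 k0 where "k3 = wa^3" and "k2 = 3 * x * wa^2 - c * h1 * wa^2 + 4 * h0 * c * wa * w1"
        and "k1 = 3 * x^2 * wa - 2 * c * h1 * x * wa + 4 * h0 * c * (x * w1 + x1 * wa) + 4 * h0^2 * c^2"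
        and "k0 = x^3 - c * h1 * x^2 + 4 * h0 * c * x * x1 + 2 * h0^2 * c^2 * x2"
      let ?R = "{t. k3 * t^3 + k2 * t^2 + k1 * t + k0 = 0}"
      have sub: "?A \<subseteq> (\<lambda>t. N0 + smult t (w * [:-a, 1:])) ` ?R"
      proof
        fix N assume N: "N \<in> ?A"
        obtain m t where N': "N = N0 + w * [:m, t:]"
          using numerator_difference[OF N N0] unfolding w_def by blast
        have "poly w a * (m + a * t) = 0" using z[OF N] z[OF N0] by (simp add: N' algebra_simps)
        then have "m + a * t = 0" using w0 by simp
        then have m: "m = - (a * t)" by algebra
        have N1: "N = N0 + smult t (w * [:-a, 1:])" 
        proof -
          have "[:m, t:] = smult t [:-a, 1:]" by (simp add: m mult.commute)
          then show ?thesis by (simp only: N' mult_smult_right)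
        qed
        have N2: "N = [:-a, 1:] * (M0 + smult t w)" 
          by (simp only: N1 M0 distrib_left mult_smult_right mult.commute[of w])
        have lf: "log_free (smult c ([:-a, 1:]^2)) N a" using N roots by (simp add: admissible_numerators_def Pa)
        have ev: "poly (M0 + smult t w) a = x + t * wa" "poly (pderiv (M0 + smult t w)) a = x1 + t * w1"
          "poly (pderiv (pderiv (M0 + smult t w))) a = x2 + t * 2"
          by (simp_all add: pderiv_add pderiv_smult w2 x_def x1_def x2_def wa_def w1_def)
        from log_free_double(2)[OF lf c N2]
        have "k3 * t^3 + k2 * t^2 + k1 * t + k0 = 0"
          unfolding ev h0_def[symmetric] h1_def[symmetric] k3_def k2_def k1_def k0_def
          by (simp add: algebra_simps power2_eq_square power3_eq_cube)
        then show "N \<in> (\<lambda>t. N0 + smult t (w * [:-a, 1:])) ` ?R" using N1 by blast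
      qed
      have R: "finite ?R" "card ?R \<le> 3"
        using card_cubic_roots_le[of k3 k2 k1 k0] w0 by (simp_all add: k3_def wa_def)
      have "finite ?A" by (rule finite_subset[OF sub finite_imageI[OF R(1)]])
      moreover have "card ?A \<le> card ?R" by (rule surj_card_le[OF R(1) sub])
      ultimately show ?thesis using R(2) by simp
    qed
  qed simp
  then show "finite ?A" "card ?A \<le> 4" by auto
qed

lemma neg_inverse_not_0_1:
  fixes w :: complex
  assumes "w \<noteq> 0" "norm w < 1"
  shows "- 1 / w \<notin> {0, 1}"
proof -
  have "norm (- 1 / w) = 1 / norm w" by (simp add: norm_divide)
  then have "- 1 / w \<noteq> 1"
    using assms by (metis div_by_1 divide_divide_eq_right less_irrefl mult_1 norm_one)
  then show ?thesis using assms(1) by simp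
qed

text \<open>Removable singularities at $0$ and $1$ and Liouville's theorem; as $n$ is even, the coordinate
  $-1/z$ at infinity yields the leading coefficient without a sign.\<close>

lemma polynomial_of_growth:
  assumes G: "G holomorphic_on - {0, 1}" and c: "(G \<longlongrightarrow> c0) (at 0)" "(G \<longlongrightarrow> c1) (at 1)"
    and l: "((\<lambda>w. w ^ n * G (- 1 / w)) \<longlongrightarrow> l) (at 0)" and "even n"
  obtains p where "degree p \<le> n" "coeff p n = l" "poly p 0 = c0" "poly p 1 = c1"
    "\<And>z. z \<notin> {0, 1} \<Longrightarrow> G z = poly p z"
proof -
  define f where "f z = (if z = 0 then c0 else if z = 1 then c1 else G z)" for z
  have f0: "(f \<longlongrightarrow> c0) (at 0)"
    by (rule Lim_transform_eventually[OF c(1)])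
      (auto simp: f_def eventually_at intro!: exI[of _ 1])
  have f1: "(f \<longlongrightarrow> c1) (at 1)"
    by (rule Lim_transform_eventually[OF c(2)])
      (auto simp: f_def eventually_at dist_norm intro!: exI[of _ 1])
  have "f holomorphic_on - {0, 1}"
    by (rule holomorphic_transform[OF G]) (auto simp: f_def)
  then have "f holomorphic_on UNIV - {0, 1}" by (simp only: Compl_eq_Diff_UNIV)
  then have hol: "f holomorphic_on UNIV"
  proof (rule no_isolated_singularity'[rotated])
    have "f 0 = c0" "f 1 = c1" by (simp_all add: f_def)
    then show "(f \<longlongrightarrow> f z) (at z within UNIV)" if "z \<in> {0, 1}" for z
      using that f0 f1 by blast
  qed auto
  have "\<forall>\<^sub>F w in at 0. norm (w ^ n * G (- 1 / w)) < norm l + 1"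
    using tendsto_norm[OF l] by (rule order_tendstoD) simp
  then obtain d where d: "d > 0" "\<And>w. w \<noteq> 0 \<Longrightarrow> norm w < d \<Longrightarrow> norm (w ^ n * G (- 1 / w)) < norm l + 1"
    unfolding eventually_at by (auto simp: dist_norm)
  have bd: "norm (f z) \<le> (norm l + 1) * norm z ^ n" if z: "max 2 (2 / d) \<le> norm z" for z
  proof -
    have z0: "z \<noteq> 0" "z \<noteq> 1" using z by auto
    have "1 / norm z < d" using z d(1) z0 by (auto simp: field_simps)
    then have "norm ((- 1 / z) ^ n * G z) < norm l + 1"
      using d(2)[of "- 1 / z"] z0 by (simp add: norm_divide)
    moreover have "norm ((- 1 / z) ^ n * G z) = norm (f z) / norm z ^ n"
      using z0 by (simp add: f_def norm_mult norm_power norm_divide power_divide)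
    ultimately show ?thesis using z0 by (simp add: pos_divide_less_eq less_imp_le)
  qed
  define p where "p = (\<Sum>k\<le>n. monom ((deriv ^^ k) f 0 / fact k) k)"
  have fp: "f z = poly p z" for z
    using Liouville_polynomial[where A = "max 2 (2 / d)", OF hol bd, of z] by (simp add: p_def poly_sum poly_monom)
  have deg: "degree p \<le> n" unfolding p_def
    by (rule degree_sum_le) (auto intro: order_trans[OF degree_monom_le])
  have "((\<lambda>w. w ^ n * poly p (- 1 / w)) \<longlongrightarrow> coeff p n) (at 0)"
  proof -
    have "((\<lambda>w. \<Sum>k\<le>n. coeff p k * (-1)^k * w ^ (n - k)) \<longlongrightarrow> (\<Sum>k\<le>n. coeff p k * (-1)^k * 0 ^ (n - k))) (at 0)"
      by (intro tendsto_intros)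
    moreover have "(\<Sum>k\<le>n. coeff p k * (-1)^k * 0 ^ (n - k)) = coeff p n"
    proof -
      have "(\<Sum>k\<le>n. coeff p k * (-1)^k * 0 ^ (n - k)) = (\<Sum>k\<le>n. if k = n then coeff p n else 0)"
        using \<open>even n\<close> by (intro sum.cong) auto
      then show ?thesis by simp
    qed
    moreover have "(\<Sum>k\<le>n. coeff p k * (-1)^k * w ^ (n - k)) = w ^ n * poly p (- 1 / w)" if "w \<noteq> 0" for w
    proof -
      have "w ^ n * poly p (- 1 / w) = (\<Sum>k\<le>n. w ^ n * (coeff p k * (- 1 / w) ^ k))"
      proof -
        have "poly p x = (\<Sum>k\<le>n. coeff p k * x ^ k)" for x
          unfolding poly_altdef by (rule sum.mono_neutral_left) (use deg in \<open>auto simp: coeff_eq_0\<close>)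
        then show ?thesis by (simp add: sum_distrib_left)
      qed
      also have "\<dots> = (\<Sum>k\<le>n. coeff p k * (-1)^k * w ^ (n - k))"
      proof (intro sum.cong refl)
        fix k assume k: "k \<in> {..n}"
        have "(- 1 / w) ^ k = (- 1) ^ k / w ^ k" by (rule power_divide)
        moreover have "w ^ n = w ^ (n - k) * w ^ k" using k by (simp flip: power_add)
        ultimately show "w ^ n * (coeff p k * (- 1 / w) ^ k) = coeff p k * (-1)^k * w ^ (n - k)"
          using that by simp
      qed
      finally show ?thesis by simp
    qed
    then have "\<forall>\<^sub>F w in at 0. (\<Sum>k\<le>n. coeff p k * (-1)^k * w ^ (n - k)) = w ^ n * poly p (- 1 / w)"
      by (auto simp: eventually_at intro!: exI[of _ 1])
    ultimately show ?thesis using Lim_transform_eventually by fastforce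
  qed
  moreover have "((\<lambda>w. w ^ n * poly p (- 1 / w)) \<longlongrightarrow> l) (at 0)"
  proof (rule Lim_transform_eventually[OF l])
    have "w ^ n * G (- 1 / w) = w ^ n * poly p (- 1 / w)" if w: "w \<noteq> 0" "norm w < 1" for w
    proof -
      have "- 1 / w \<noteq> 0" "- 1 / w \<noteq> 1" using neg_inverse_not_0_1[OF w] by blast+
      then show ?thesis using fp[of "- 1 / w"] by (simp only: f_def if_False)
    qed
    then show "\<forall>\<^sub>F w in at 0. w ^ n * G (- 1 / w) = w ^ n * poly p (- 1 / w)"
      unfolding eventually_at by (intro exI[of _ 1]) (simp add: dist_norm)
  qed
  ultimately have l': "coeff p n = l" by (rule LIM_unique)
  show thesis
  proof (rule that[OF deg l'])
    show "poly p 0 = c0" "poly p 1 = c1" by (simp_all flip: fp add: f_def)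
    show "G z = poly p z" if "z \<notin> {0, 1}" for z using that by (simp flip: fp add: f_def)
  qed
qed

section \<open>The null curve of a conformal minimal immersion\<close>

text \<open>The mean value theorem in the direction $a$ turns the second difference into a first difference of the
  derivative $P$ in the direction $b$.\<close>

lemma second_difference_quotient:
  fixes f :: "'a::real_normed_vector \<Rightarrow> real"
  assumes r: "r > 0"
    and f: "\<And>w. w \<in> ball z r \<Longrightarrow> ((\<lambda>s. f (w + s *\<^sub>R a)) has_real_derivative P w) (at 0)"
    and P: "(P has_derivative DP) (at z)"
  shows "((\<lambda>t. (f (z + t *\<^sub>R a + t *\<^sub>R b) - f (z + t *\<^sub>R a) - f (z + t *\<^sub>R b) + f z) / t\<^sup>2) \<longlongrightarrow> DP b) (at_right 0)"
proof (rule tendstoI)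
  fix e :: real assume e: "e > 0"
  define M where "M = 2 * norm a + norm b + 1"
  have M: "M > 0" by (simp add: M_def add_nonneg_pos)
  obtain d where d: "d > 0" "\<And>y. norm (y - z) < d \<Longrightarrow> norm (P y - P z - DP (y - z)) \<le> e / (2 * M) * norm (y - z)"
  proof -
    have "e / (2 * M) > 0" using e M by simp
    with P have "\<exists>d>0. \<forall>y. norm (y - z) < d \<longrightarrow> norm (P y - P z - DP (y - z)) \<le> e / (2 * M) * norm (y - z)"
      unfolding has_derivative_at_alt by blast
    then show thesis using that by blast
  qed
  have lin: "linear DP" using P by (simp add: has_derivative_linear)
  have main: "dist ((f (z + t *\<^sub>R a + t *\<^sub>R b) - f (z + t *\<^sub>R a) - f (z + t *\<^sub>R b) + f z) / t\<^sup>2) (DP b) < e"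
    if t: "t > 0" "t < min d r / M" for t
  proof -
    have tM: "t * M < d" "t * M < r" using t M by (simp_all add: field_simps)
    have small: "norm (s *\<^sub>R a + k *\<^sub>R b) < min d r" "norm (s *\<^sub>R a + k *\<^sub>R b) \<le> t * (norm a + norm b)"
      if "0 \<le> s" "s \<le> t" "k = 0 \<or> k = t" for s k
    proof -
      have "norm (s *\<^sub>R a + k *\<^sub>R b) \<le> s * norm a + k * norm b"
        using that t(1) by (intro order_trans[OF norm_triangle_ineq]) auto
      also have "\<dots> \<le> t * norm a + t * norm b"
        using that t(1) by (intro add_mono mult_right_mono) auto
      finally show 1: "norm (s *\<^sub>R a + k *\<^sub>R b) \<le> t * (norm a + norm b)" by (simp add: distrib_left)
      have "t * (norm a + norm b) \<le> t * M" using t(1) by (intro mult_left_mono) (auto simp: M_def)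
      then show "norm (s *\<^sub>R a + k *\<^sub>R b) < min d r" using 1 tM by linarith
    qed
    define g where "g s = f (z + s *\<^sub>R a + t *\<^sub>R b) - f (z + s *\<^sub>R a)" for s
    define g' where "g' s = P (z + s *\<^sub>R a + t *\<^sub>R b) - P (z + s *\<^sub>R a)" for s
    have shift: "((\<lambda>s. f (w + s *\<^sub>R a)) has_real_derivative P (w + s0 *\<^sub>R a)) (at s0)"
      if "w + s0 *\<^sub>R a \<in> ball z r" for w s0
    proof -
      have "((\<lambda>s. f (w + s0 *\<^sub>R a + s *\<^sub>R a)) has_real_derivative P (w + s0 *\<^sub>R a)) (at 0)"
        by (rule f[OF that])
      then have "((\<lambda>s. f (w + (s + s0) *\<^sub>R a)) has_real_derivative P (w + s0 *\<^sub>R a)) (at 0)"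
        by (simp add: scaleR_add_left add_ac)
      then show ?thesis using DERIV_shift[of "\<lambda>s. f (w + s *\<^sub>R a)" _ 0 s0] by simp
    qed
    have inb: "z + s *\<^sub>R a + t *\<^sub>R b \<in> ball z r" "z + s *\<^sub>R a \<in> ball z r" if "0 \<le> s" "s \<le> t" for s
    proof -
      have "norm (s *\<^sub>R a + t *\<^sub>R b) < r" "norm (s *\<^sub>R a + 0 *\<^sub>R b) < r"
        using small(1)[OF that, of t] small(1)[OF that, of 0] by auto
      moreover have "dist z (z + v) = norm v" for v by (simp add: dist_norm)
      ultimately show "z + s *\<^sub>R a + t *\<^sub>R b \<in> ball z r" "z + s *\<^sub>R a \<in> ball z r"
        by (simp_all only: mem_ball add.assoc) simp
    qed
    have dg: "(g has_real_derivative g' s) (at s)" if s: "0 \<le> s" "s \<le> t" for s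
    proof -
      have "((\<lambda>s. f (z + t *\<^sub>R b + s *\<^sub>R a)) has_real_derivative P (z + t *\<^sub>R b + s *\<^sub>R a)) (at s)"
        using inb(1)[OF s] by (intro shift) (simp add: add_ac)
      from DERIV_diff[OF this shift[OF inb(2)[OF s]]] show ?thesis
        by (simp add: g_def[abs_def] g'_def add_ac)
    qed
    obtain \<xi> where \<xi>: "0 < \<xi>" "\<xi> < t" "g t - g 0 = (t - 0) * g' \<xi>"
      using MVT2[OF t(1) dg] by blast
    have err: "\<bar>P (z + v) - P z - DP v\<bar> \<le> e / (2 * M) * norm v" if "norm v < d" for v
      using d(2)[of "z + v"] that by simp
    let ?v = "\<xi> *\<^sub>R a + t *\<^sub>R b" and ?w = "\<xi> *\<^sub>R a + 0 *\<^sub>R b"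
    have n: "norm ?v < d" "norm ?w < d" "norm ?v \<le> t * (norm a + norm b)" "norm ?w \<le> t * norm a"
      using small[of \<xi> t] small[of \<xi> 0] \<xi>(1,2) by (auto intro: mult_right_mono)
    have "DP ?v - DP ?w = t * DP b"
      using lin by (simp add: linear_add linear_scale)
    moreover have "g' \<xi> = P (z + ?v) - P (z + ?w)" by (simp add: g'_def add.assoc)
    ultimately have "g' \<xi> - t * DP b = (P (z + ?v) - P z - DP ?v) - (P (z + ?w) - P z - DP ?w)" by simp
    then have "\<bar>g' \<xi> - t * DP b\<bar> \<le> e / (2 * M) * norm ?v + e / (2 * M) * norm ?w"
      using err[OF n(1)] err[OF n(2)] by linarith
    also have "\<dots> = e / (2 * M) * (norm ?v + norm ?w)" by (simp add: distrib_left)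
    also have "\<dots> \<le> e / (2 * M) * (t * M)"
    proof (rule mult_left_mono)
      have "norm ?v + norm ?w \<le> t * (2 * norm a + norm b)" using n(3,4) by (simp add: algebra_simps)
      also have "\<dots> \<le> t * M" using t(1) by (simp add: M_def)
      finally show "norm ?v + norm ?w \<le> t * M" .
    qed (use e M in auto)
    also have "\<dots> = e / 2 * t" using M by simp
    finally have b1: "\<bar>g' \<xi> - t * DP b\<bar> \<le> e / 2 * t" .
    have "(f (z + t *\<^sub>R a + t *\<^sub>R b) - f (z + t *\<^sub>R a) - f (z + t *\<^sub>R b) + f z) / t\<^sup>2 - DP b = (g' \<xi> - t * DP b) / t"
      using \<xi>(3) t(1) by (simp add: g_def field_simps power2_eq_square)
    also have "\<bar>\<dots>\<bar> \<le> e / 2" using b1 t(1) by (simp add: abs_divide field_simps)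
    finally show ?thesis using e by (simp add: dist_real_def)
  qed
  have "min d r / M > 0" using d r M by simp
  then show "\<forall>\<^sub>F t in at_right 0. dist ((f (z + t *\<^sub>R a + t *\<^sub>R b) - f (z + t *\<^sub>R a) - f (z + t *\<^sub>R b) + f z) / t\<^sup>2) (DP b) < e"
    unfolding eventually_at_right_field using main by blast
qed

text \<open>The second difference quotient is symmetric in the two directions.\<close>

lemma mixed_second_derivatives_commute:
  fixes f :: "'a::real_normed_vector \<Rightarrow> real"
  assumes r: "r > 0"
    and f: "\<And>w. w \<in> ball z r \<Longrightarrow> (f has_derivative D w) (at w)"
    and P: "((\<lambda>w. D w a) has_derivative DP) (at z)" and R: "((\<lambda>w. D w b) has_derivative DR) (at z)"
  shows "DP b = DR a"
proof -
  have dir: "((\<lambda>s. f (w + s *\<^sub>R v)) has_real_derivative D w v) (at 0)" if w: "w \<in> ball z r" for w v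
  proof -
    have "((\<lambda>s. w + s *\<^sub>R v) has_derivative (\<lambda>s. s *\<^sub>R v)) (at 0)"
      by (auto intro!: derivative_eq_intros)
    moreover have "(f has_derivative D w) (at (w + 0 *\<^sub>R v))" using f[OF w] by simp
    ultimately have "((\<lambda>s. f (w + s *\<^sub>R v)) has_derivative (\<lambda>s. D w (s *\<^sub>R v))) (at 0)"
      by (rule has_derivative_compose)
    moreover have "D w (s *\<^sub>R v) = D w v * s" for s
      using f[OF w] by (simp add: has_derivative_linear linear_scale)
    ultimately show ?thesis by (simp add: has_field_derivative_def)
  qed
  have 1: "((\<lambda>t. (f (z + t *\<^sub>R a + t *\<^sub>R b) - f (z + t *\<^sub>R a) - f (z + t *\<^sub>R b) + f z) / t\<^sup>2) \<longlongrightarrow> DP b) (at_right 0)"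
    by (rule second_difference_quotient[OF r dir P])
  have 2: "((\<lambda>t. (f (z + t *\<^sub>R b + t *\<^sub>R a) - f (z + t *\<^sub>R b) - f (z + t *\<^sub>R a) + f z) / t\<^sup>2) \<longlongrightarrow> DR a) (at_right 0)"
    by (rule second_difference_quotient[OF r dir R])
  have e: "(f (z + t *\<^sub>R b + t *\<^sub>R a) - f (z + t *\<^sub>R b) - f (z + t *\<^sub>R a) + f z)
    = (f (z + t *\<^sub>R a + t *\<^sub>R b) - f (z + t *\<^sub>R a) - f (z + t *\<^sub>R b) + f z)" for t
    by (simp add: add_ac)
  show ?thesis
    by (rule tendsto_unique[OF trivial_limit_at_right_real 1]) (use 2 in \<open>simp only: e\<close>)
qed

definition dz_form :: "complex set \<Rightarrow> (complex \<Rightarrow> real^3) \<Rightarrow> complex \<Rightarrow> complex^3" where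
  "dz_form S x z = (\<chi> k. Complex (du S x z $ k) (- (dv S x z $ k)))"

lemma dz_form_null:
  assumes "conformal_immersion_at S x z"
  shows "cdot (dz_form S x z) (dz_form S x z) = 0" "dz_form S x z \<noteq> 0"
proof -
  have 1: "norm (du S x z) = norm (dv S x z)" "du S x z \<bullet> dv S x z = 0" "du S x z \<noteq> 0"
    using assms by (auto simp: conformal_immersion_at_def)
  have 2: "du S x z \<bullet> du S x z = dv S x z \<bullet> dv S x z" using 1(1) by (simp add: norm_eq_sqrt_inner)
  show "cdot (dz_form S x z) (dz_form S x z) = 0"
    using 1(2) 2 by (simp add: cdot_def dz_form_def complex_eq_iff inner_vec_def sum_3 algebra_simps)
  show "dz_form S x z \<noteq> 0" using 1(3) by (auto simp: dz_form_def vec_eq_iff complex_eq_iff)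
qed

lemma vanishes_if_orthogonal_to_frame:
  fixes P R :: "real^3"
  assumes "norm P = norm R" "P \<bullet> R = 0" "P \<noteq> 0"
    and "w \<bullet> P = 0" "w \<bullet> R = 0" "w \<bullet> cross3 P R = 0"
  shows "w = 0"
proof -
  have R: "R \<noteq> 0" using assms(1,3) by auto
  have "(norm (cross3 P R))\<^sup>2 = (norm P * norm R)\<^sup>2"
    using norm_cross_dot[of P R] assms(2) by simp
  then have n: "cross3 P R \<noteq> 0" using assms(3) R by auto
  have "cross3 (cross3 P R) w = (w \<bullet> P) *\<^sub>R R - (w \<bullet> R) *\<^sub>R P"
    by (simp add: cross3_simps forall_3)
  then have "cross3 (cross3 P R) w = 0" using assms by simp
  then have "(norm (cross3 P R) * norm w)\<^sup>2 = 0"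
    using norm_cross_dot[of "cross3 P R" w] assms(6) by (simp add: inner_commute)
  then show ?thesis using n by simp
qed

lemma partial_on_has_derivative:
  assumes "x differentiable_on S" "open H" "H \<subseteq> S" "z \<in> H"
  shows "(x has_derivative (\<lambda>h. Re h *\<^sub>R du S x z + Im h *\<^sub>R dv S x z)) (at z)"
proof -
  have at: "at z within S = at z"
    using assms(2-4) by (metis at_within_open at_within_open_subset)
  let ?D = "frechet_derivative x (at z within S)"
  have D: "(x has_derivative ?D) (at z within S)"
    using assms(1,3,4) by (auto simp: differentiable_on_def frechet_derivative_works)
  have "?D h = Re h *\<^sub>R du S x z + Im h *\<^sub>R dv S x z" for h
  proof -
    have "h = Re h *\<^sub>R 1 + Im h *\<^sub>R \<i>" by (simp add: complex_eq_iff)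
    then have "?D h = ?D (Re h *\<^sub>R 1 + Im h *\<^sub>R \<i>)" by (rule arg_cong)
    also have "\<dots> = Re h *\<^sub>R ?D 1 + Im h *\<^sub>R ?D \<i>"
      using has_derivative_linear[OF D] by (simp add: linear_add linear_scale)
    finally show ?thesis by (simp add: partial_on_def)
  qed
  then show ?thesis using D at by (metis (no_types, lifting) ext)
qed

text \<open>Differentiating the conformality relations shows that the Laplacian of $x$ is orthogonal to the tangent
  plane, and vanishing mean curvature removes the normal component.\<close>

lemma immersion_harmonic:
  assumes x: "conformal_minimal_immersion S x" and H: "open H" "H \<subseteq> S"
    and z: "z \<in> H"
  shows "dv S (du S x) z = du S (dv S x) z" "dv S (dv S x) z = - du S (du S x) z"
proof -
  have "smooth_on S x" using x by (simp add: conformal_minimal_immersion_def)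
  then have "Ck_on (Suc (Suc 0)) S x" unfolding smooth_on_def by blast
  then have d: "x differentiable_on S" "du S x differentiable_on S" "dv S x differentiable_on S" by auto
  define P R where "P = du S x" and "R = dv S x"
  define Pu Pv Ru Rv where "Pu = du S P z" and "Pv = dv S P z" and "Ru = du S R z" and "Rv = dv S R z"
  note dx = partial_on_has_derivative[OF d(1) H, folded P_def R_def]
  have dP: "(P has_derivative (\<lambda>h. Re h *\<^sub>R Pu + Im h *\<^sub>R Pv)) (at z)"
    and dR: "(R has_derivative (\<lambda>h. Re h *\<^sub>R Ru + Im h *\<^sub>R Rv)) (at z)"
    unfolding Pu_def Pv_def Ru_def Rv_def P_def R_def
    by (rule partial_on_has_derivative[OF d(2) H z] partial_on_has_derivative[OF d(3) H z])+
  obtain r where r: "r > 0" "ball z r \<subseteq> H" using H(1) z openE by blast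
  have mix: "Pv = Ru"
  proof -
    have "Pv $ k = Ru $ k" for k
    proof -
      have "(\<lambda>h. Re h * Pu $ k + Im h * Pv $ k) \<i> = (\<lambda>h. Re h * Ru $ k + Im h * Rv $ k) 1"
      proof (rule mixed_second_derivatives_commute[where f = "\<lambda>w. x w $ k" and z = z and a = 1 and b = \<i>
            and D = "\<lambda>w h. Re h * P w $ k + Im h * R w $ k", OF r(1)])
        show "((\<lambda>w. x w $ k) has_derivative (\<lambda>h. Re h * P w $ k + Im h * R w $ k)) (at w)" if "w \<in> ball z r" for w
          using bounded_linear.has_derivative[OF bounded_linear_vec_nth dx[of w], of k] that r(2) by auto
        show "((\<lambda>w. Re 1 * P w $ k + Im 1 * R w $ k) has_derivative (\<lambda>h. Re h * Pu $ k + Im h * Pv $ k)) (at z)"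
          using bounded_linear.has_derivative[OF bounded_linear_vec_nth dP, of k] by simp
        show "((\<lambda>w. Re \<i> * P w $ k + Im \<i> * R w $ k) has_derivative (\<lambda>h. Re h * Ru $ k + Im h * Rv $ k)) (at z)"
          using bounded_linear.has_derivative[OF bounded_linear_vec_nth dR, of k] by simp
      qed
      then show ?thesis by simp
    qed
    then show ?thesis by (simp add: vec_eq_iff)
  qed
  then show "dv S (du S x) z = du S (dv S x) z" by (simp add: Pv_def Ru_def P_def R_def)
  have conf: "P w \<bullet> P w - R w \<bullet> R w = 0" "P w \<bullet> R w = 0" if "w \<in> H" for w
    using x that H(2) by (auto simp: conformal_minimal_immersion_def conformal_immersion_at_def P_def R_def norm_eq)
  have zero: "D' = (\<lambda>h. 0)" if "(f has_derivative D') (at z)" "\<And>w. w \<in> H \<Longrightarrow> f w = 0" for f :: "complex \<Rightarrow> real" and D'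
  proof -
    have "((\<lambda>_. 0) has_derivative D') (at z)"
      using has_derivative_transform_within_open[OF that(1) H(1) z] that(2) by metis
    then show ?thesis by (metis has_derivative_const has_derivative_unique)
  qed
  have "(\<lambda>h. P z \<bullet> (Re h *\<^sub>R Pu + Im h *\<^sub>R Pv) + (Re h *\<^sub>R Pu + Im h *\<^sub>R Pv) \<bullet> P z
       - (R z \<bullet> (Re h *\<^sub>R Ru + Im h *\<^sub>R Rv) + (Re h *\<^sub>R Ru + Im h *\<^sub>R Rv) \<bullet> R z)) = (\<lambda>h. 0)"
    by (rule zero[OF has_derivative_diff[OF has_derivative_inner[OF dP dP] has_derivative_inner[OF dR dR]]])
      (rule conf)
  from fun_cong[OF this, of 1] fun_cong[OF this, of \<i>]
  have 1: "P z \<bullet> Pu = R z \<bullet> Ru" "P z \<bullet> Pv = R z \<bullet> Rv" by (simp_all add: inner_commute)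
  have "(\<lambda>h. P z \<bullet> (Re h *\<^sub>R Ru + Im h *\<^sub>R Rv) + (Re h *\<^sub>R Pu + Im h *\<^sub>R Pv) \<bullet> R z) = (\<lambda>h. 0)"
    by (rule zero[OF has_derivative_inner[OF dP dR]]) (rule conf)
  from fun_cong[OF this, of 1] fun_cong[OF this, of \<i>]
  have 2: "P z \<bullet> Ru = - (Pu \<bullet> R z)" "P z \<bullet> Rv = - (Pv \<bullet> R z)" by simp_all
  have c: "norm (P z) = norm (R z)" "P z \<bullet> R z = 0" "P z \<noteq> 0" "mean_curvature S x z = 0"
    using x z H(2) by (auto simp: conformal_minimal_immersion_def conformal_immersion_at_def P_def R_def)
  have E: "R z \<bullet> R z = P z \<bullet> P z" using c(1) by (simp add: norm_eq)
  have nE: "P z \<bullet> P z \<noteq> 0" using c(3) by simp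
  have n0: "cross3 (P z) (R z) \<noteq> 0"
  proof -
    have "(norm (cross3 (P z) (R z)))\<^sup>2 = (norm (P z) * norm (R z))\<^sup>2"
      using norm_cross_dot[of "P z" "R z"] c(2) by simp
    then show ?thesis using c(1,3) by auto
  qed
  have "(Pu + Rv) \<bullet> gauss_map S x z = 0"
    using c(4) E c(2) nE
    by (simp add: mean_curvature_def Let_def Pu_def Rv_def flip: P_def R_def)
      (simp add: inner_add_left flip: distrib_right)
  then have 3: "(Pu + Rv) \<bullet> cross3 (P z) (R z) = 0"
    using n0 by (simp add: gauss_map_def flip: P_def R_def)
  have "Pu + Rv = 0"
    by (rule vanishes_if_orthogonal_to_frame[OF c(1-3) _ _ 3])
      (use 1 2 mix in \<open>simp_all add: inner_add_left inner_add_right inner_commute\<close>)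
  then have "Rv = - Pu" by (simp add: add_eq_0_iff)
  then show "dv S (dv S x) z = - du S (du S x) z" by (simp add: Pu_def Rv_def P_def R_def)
qed

text \<open>The Cauchy-Riemann equations of $x_u - i x_v$ are the harmonicity of $x$ and the symmetry of its second
  derivatives.\<close>

lemma dz_form_null_curve:
  assumes x: "conformal_minimal_immersion S x" and H: "open H" "H \<subseteq> S"
  shows "null_curve H (dz_form S x)"
proof -
  have "smooth_on S x" using x by (simp add: conformal_minimal_immersion_def)
  then have "Ck_on (Suc (Suc 0)) S x" unfolding smooth_on_def by blast
  then have d: "du S x differentiable_on S" "dv S x differentiable_on S" by auto
  have "((\<lambda>w. dz_form S x w $ k) has_field_derivative Complex (du S (du S x) z $ k) (- (dv S (du S x) z $ k))) (at z)"
    if z: "z \<in> H" for z k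
  proof -
    note D = bounded_linear.has_derivative[OF bounded_linear_vec_nth partial_on_has_derivative[OF d(1) H z], of k]
      bounded_linear.has_derivative[OF bounded_linear_vec_nth partial_on_has_derivative[OF d(2) H z], of k]
    have "((\<lambda>w. of_real (du S x w $ k) - \<i> * of_real (dv S x w $ k)) has_derivative
      (\<lambda>h. of_real ((Re h *\<^sub>R du S (du S x) z + Im h *\<^sub>R dv S (du S x) z) $ k)
        - \<i> * of_real ((Re h *\<^sub>R du S (dv S x) z + Im h *\<^sub>R dv S (dv S x) z) $ k))) (at z)"
      by (intro has_derivative_diff has_derivative_mult_right has_derivative_of_real D)
    also have "(\<lambda>h. of_real ((Re h *\<^sub>R du S (du S x) z + Im h *\<^sub>R dv S (du S x) z) $ k)
        - \<i> * of_real ((Re h *\<^sub>R du S (dv S x) z + Im h *\<^sub>R dv S (dv S x) z) $ k))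
       = (*) (Complex (du S (du S x) z $ k) (- (dv S (du S x) z $ k)))"
      using immersion_harmonic[OF x H z] by (auto simp: fun_eq_iff complex_eq_iff algebra_simps)
    also have "(\<lambda>w. of_real (du S x w $ k) - \<i> * of_real (dv S x w $ k)) = (\<lambda>w. dz_form S x w $ k)"
      by (auto simp: fun_eq_iff dz_form_def complex_eq_iff)
    finally show ?thesis by (simp add: has_field_derivative_def)
  qed
  then have "vholo (dz_form S x) H"
    unfolding vholo_def using H(1) by (meson holomorphic_on_open)
  moreover have "conformal_immersion_at S x z" if "z \<in> H" for z
    using x H(2) that by (auto simp: conformal_minimal_immersion_def)
  ultimately show ?thesis using dz_form_null by (simp add: null_curve_def)
qed

lemma dz_form_continuous:
  assumes "conformal_minimal_immersion S x"
  shows "continuous_on S (\<lambda>z. dz_form S x z $ k)"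
proof -
  have "smooth_on S x" using assms by (simp add: conformal_minimal_immersion_def)
  then have "Ck_on (Suc 0) S x" unfolding smooth_on_def by blast
  then have "continuous_on S (\<lambda>z. of_real (du S x z $ k) - \<i> * of_real (dv S x z $ k))"
    by (auto intro!: continuous_intros)
  moreover have "(\<lambda>w. of_real (du S x w $ k) - \<i> * of_real (dv S x w $ k)) = (\<lambda>w. dz_form S x w $ k)"
      by (auto simp: fun_eq_iff dz_form_def complex_eq_iff)
  ultimately show ?thesis by (simp only:)
qed

section \<open>Reflection across the boundary lines\<close>

definition cvec :: "real^3 \<Rightarrow> complex^3" where "cvec u = (\<chi> k. of_real (u $ k))"
definition vcnj :: "complex^3 \<Rightarrow> complex^3" where "vcnj v = (\<chi> k. cnj (v $ k))"
text \<open>The rotation by $\pi$ about the axis $u$, extended complex linearly.\<close>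

definition half_turn :: "real^3 \<Rightarrow> complex^3 \<Rightarrow> complex^3" where
  "half_turn u v = (2 * cdot (cvec u) v) *s cvec u - v"
text \<open>On a boundary arc that lies on a line with direction $u$, the component of $\phi$ along $u$ is real and
  the orthogonal components are imaginary; a half-turn after complex conjugation respects this.\<close>

definition reflected :: "real^3 \<Rightarrow> (complex \<Rightarrow> complex^3) \<Rightarrow> complex \<Rightarrow> complex^3" where
  "reflected u F z = (if 0 \<le> Im z then F z else half_turn u (vcnj (F (cnj z))))"
text \<open>The complex plane without the real points outside the arc; it is the natural domain of the
  continuation across that arc.\<close>

definition slit_plane :: "real set \<Rightarrow> complex set" where
  "slit_plane I = {z. Im z = 0 \<longrightarrow> Re z \<in> I}"
definition upper_half :: "complex set" where "upper_half = {z. Im z > 0}"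

lemma cvec_nth [simp]: "cvec u $ k = of_real (u $ k)" by (simp add: cvec_def)
lemma vcnj_nth [simp]: "vcnj v $ k = cnj (v $ k)" by (simp add: vcnj_def)
lemma half_turn_nth: "half_turn u v $ k = 2 * (of_real (u$1) * v$1 + of_real (u$2) * v$2 + of_real (u$3) * v$3) * of_real (u $ k) - v $ k"
  by (simp add: half_turn_def cdot_def algebra_simps)

lemma vcnj_vcnj [simp]: "vcnj (vcnj v) = v" by (simp add: vec_eq_iff)

lemma vcnj_half_turn: "vcnj (half_turn u v) = half_turn u (vcnj v)"
  by (simp add: vec_eq_iff half_turn_nth)

lemma unit_vector_sum: "norm (u :: real^3) = 1 \<Longrightarrow>
    of_real (u$1) * of_real (u$1) + of_real (u$2) * of_real (u$2) + of_real (u$3) * of_real (u$3) = (1 :: complex)"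
proof -
  assume "norm u = 1"
  then have "u \<bullet> u = 1" by (simp add: norm_eq_1)
  then have "u$1 * u$1 + u$2 * u$2 + u$3 * u$3 = 1" by (simp add: inner_vec_def sum_3)
  then have "of_real (u$1 * u$1 + u$2 * u$2 + u$3 * u$3) = (1 :: complex)" by simp
  then show ?thesis by simp
qed

lemma half_turn_invol:
  assumes "norm u = 1"
  shows "half_turn u (half_turn u v) = v"
  unfolding vec3_eq_iff half_turn_nth using unit_vector_sum[OF assms] by (intro conjI; algebra)

lemma half_turn_cdot:
  assumes "norm u = 1"
  shows "cdot (half_turn u v) (half_turn u w) = cdot v w"
  unfolding cdot_def half_turn_nth using unit_vector_sum[OF assms] by algebra

lemma half_turn_ccross:
  assumes "norm u = 1"
  shows "ccross (half_turn u v) (half_turn u w) = half_turn u (ccross v w)"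
  unfolding vec3_eq_iff ccross_nth half_turn_nth using unit_vector_sum[OF assms] by (intro conjI; algebra)

lemma half_turn_linear:
  "half_turn u (c *s v) = c *s half_turn u v"
  "half_turn u (v + w) = half_turn u v + half_turn u w"
  "half_turn u (v - w) = half_turn u v - half_turn u w"
  by (simp_all add: vec_eq_iff half_turn_nth algebra_simps)

lemma vcnj_linear:
  "vcnj (c *s v) = cnj c *s vcnj v" "vcnj (v + w) = vcnj v + vcnj w" "vcnj (v - w) = vcnj v - vcnj w"
  "vcnj (ccross v w) = ccross (vcnj v) (vcnj w)"
  by (simp_all add: vec_eq_iff forall_3)

lemma jet_data_cnj:
  assumes "jet_data v0 v1 v2 q q' p"
  shows "jet_data (vcnj v0) (vcnj v1) (vcnj v2) (- cnj q) (- cnj q') (- cnj p)"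
proof -
  from assms have 1: "ccross v0 v1 = (2 * \<i> * q) *s v0"
    and 2: "ccross v1 v2 = (2 * \<i>) *s (q *s v2 - q' *s v1 + (4 * p) *s v0)"
    by (auto simp: jet_data_def)
  from 1 have "vcnj (ccross v0 v1) = vcnj ((2 * \<i> * q) *s v0)" by simp
  moreover from 2 have "vcnj (ccross v1 v2) = vcnj ((2 * \<i>) *s (q *s v2 - q' *s v1 + (4 * p) *s v0))" by simp
  ultimately show ?thesis
    unfolding jet_data_def vcnj_linear by (auto simp: vec_eq_iff algebra_simps)
qed

lemma jet_data_half_turn:
  assumes "jet_data v0 v1 v2 q q' p" "norm u = 1"
  shows "jet_data (half_turn u v0) (half_turn u v1) (half_turn u v2) q q' p"
  using assms(1) unfolding jet_data_def half_turn_ccross[OF assms(2)] by (simp only: half_turn_linear)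

lemma has_derivative_cnj_cnj:
  assumes "(f has_field_derivative D) (at (cnj z))"
  shows "((\<lambda>w. cnj (f (cnj w))) has_field_derivative cnj D) (at z)"
  using has_field_derivative_cnj_cnj[OF assms] by (simp add: o_def)

text \<open>The sign comes from the factor $i$ in the defining relations of $q$ and $p$.\<close>

lemma null_data_reflect:
  assumes O: "open \<Omega>" and sym: "\<And>z. z \<in> \<Omega> \<Longrightarrow> cnj z \<in> \<Omega>" and N: "null_data \<Omega> F q p" and u: "norm u = 1"
  shows "null_data \<Omega> (\<lambda>z. half_turn u (vcnj (F (cnj z)))) (\<lambda>z. - cnj (q (cnj z))) (\<lambda>z. - cnj (p (cnj z)))"
proof -
  have F: "vholo F \<Omega>" and q: "q holomorphic_on \<Omega>" and p: "p holomorphic_on \<Omega>"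
    using N by (auto simp: null_data_def null_curve_def)
  define G where "G z = half_turn u (vcnj (F (cnj z)))" for z
  define D where "D z = half_turn u (vcnj (vderiv F (cnj z)))" for z
  define E where "E z = half_turn u (vcnj (vderiv (vderiv F) (cnj z)))" for z
  note d = has_derivative_cnj_cnj[OF has_field_derivative_vderiv[OF F O sym]]
    has_derivative_cnj_cnj[OF has_field_derivative_vderiv[OF vholo_vderiv[OF F O] O sym]]
  have 1: "((\<lambda>w. G w $ k) has_field_derivative D w $ k) (at w)" if w: "w \<in> \<Omega>" for w k
    unfolding G_def D_def half_turn_nth vcnj_nth
    by (rule derivative_eq_intros d(1)[OF w] refl)+ (simp add: algebra_simps)
  have 2: "((\<lambda>w. D w $ k) has_field_derivative E w $ k) (at w)" if w: "w \<in> \<Omega>" for w k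
    unfolding D_def E_def half_turn_nth vcnj_nth
    by (rule derivative_eq_intros d(2)[OF w] refl)+ (simp add: algebra_simps)
  have q': "((\<lambda>z. - cnj (q (cnj z))) has_field_derivative - cnj (deriv q (cnj z))) (at z)" if "z \<in> \<Omega>" for z
    by (intro DERIV_minus has_derivative_cnj_cnj holomorphic_derivI[OF q O sym[OF that]])
  have p': "((\<lambda>z. - cnj (p (cnj z))) has_field_derivative - cnj (deriv p (cnj z))) (at z)" if "z \<in> \<Omega>" for z
    by (intro DERIV_minus has_derivative_cnj_cnj holomorphic_derivI[OF p O sym[OF that]])
  have "null_data \<Omega> G (\<lambda>z. - cnj (q (cnj z))) (\<lambda>z. - cnj (p (cnj z)))"
    unfolding null_data_def null_curve_def vholo_def
  proof (intro conjI ballI allI)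
    show "(\<lambda>z. G z $ k) holomorphic_on \<Omega>" for k using 1 O by (meson holomorphic_on_open)
    show "(\<lambda>z. - cnj (q (cnj z))) holomorphic_on \<Omega>" using q' O by (meson holomorphic_on_open)
    show "(\<lambda>z. - cnj (p (cnj z))) holomorphic_on \<Omega>" using p' O by (meson holomorphic_on_open)
  next
    fix z assume z: "z \<in> \<Omega>"
    have n: "F (cnj z) \<noteq> 0" "cdot (F (cnj z)) (F (cnj z)) = 0"
      and j: "jet_data (F (cnj z)) (vderiv F (cnj z)) (vderiv (vderiv F) (cnj z)) (q (cnj z)) (deriv q (cnj z)) (p (cnj z))"
      using N sym[OF z] by (auto simp: null_data_def null_curve_def)
    show "G z \<noteq> 0"
    proof
      assume "G z = 0"
      then have "half_turn u (G z) = 0" by (simp add: vec_eq_iff half_turn_nth)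
      then have "vcnj (F (cnj z)) = 0" by (simp add: G_def half_turn_invol[OF u])
      then show False using n(1) by (simp add: vec_eq_iff)
    qed
    have "cdot (vcnj (F (cnj z))) (vcnj (F (cnj z))) = cnj (cdot (F (cnj z)) (F (cnj z)))"
      by (simp add: cdot_def)
    then show "cdot (G z) (G z) = 0" by (simp add: G_def half_turn_cdot[OF u] n(2))
    have jets: "vderiv G z = D z" "vderiv (vderiv G) z = E z"
      by (rule jets_of_components[where F = G and D = D and E = E, OF O 1 2 z]; assumption)+
    show "jet_data (G z) (vderiv G z) (vderiv (vderiv G) z) (- cnj (q (cnj z))) (deriv (\<lambda>z. - cnj (q (cnj z))) z) (- cnj (p (cnj z)))"
      unfolding jets DERIV_imp_deriv[OF q'[OF z]] G_def D_def E_def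
      by (rule jet_data_half_turn[OF jet_data_cnj[OF j] u])
  qed
  then show ?thesis by (simp add: G_def[abs_def])
qed

lemma open_slit_plane: "open I \<Longrightarrow> open (slit_plane I)"
proof -
  assume I: "open I"
  have "slit_plane I = {z. Im z \<noteq> 0} \<union> Re -` I" by (auto simp: slit_plane_def)
  moreover have "open {z. Im z \<noteq> 0}" by (intro open_Collect_neq continuous_intros)
  moreover have "open (Re -` I)" using I by (intro open_vimage continuous_intros) auto
  ultimately show ?thesis by (simp only: open_Un)
qed

lemma connected_slit_plane:
  assumes "convex I" "c \<in> I"
  shows "connected (slit_plane I)"
proof (rule starlike_imp_connected, unfold starlike_def, intro bexI ballI)
  show "of_real c \<in> slit_plane I" using assms(2) by (simp add: slit_plane_def)
  fix z assume z: "z \<in> slit_plane I"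
  show "closed_segment (of_real c) z \<subseteq> slit_plane I"
  proof
    fix w assume "w \<in> closed_segment (of_real c) z"
    then obtain t where t: "0 \<le> t" "t \<le> 1" "w = (1 - t) *\<^sub>R of_real c + t *\<^sub>R z"
      by (auto simp: closed_segment_def)
    show "w \<in> slit_plane I"
    proof (cases "Im z = 0 \<or> t = 0")
      case True
      have "(1 - t) *\<^sub>R c + t *\<^sub>R Re z \<in> I" if "t \<noteq> 0"
        using assms z t(1,2) True that by (intro convexD) (auto simp: slit_plane_def)
      then show ?thesis using t(3) assms(2) True by (cases "t = 0") (auto simp: slit_plane_def)
    next
      case False
      then show ?thesis using t(3) by (auto simp: slit_plane_def)
    qed
  qed
qed

definition boundary_symmetric :: "real set \<Rightarrow> real^3 \<Rightarrow> (complex \<Rightarrow> complex^3) \<Rightarrow> bool" where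
  "boundary_symmetric I u F \<longleftrightarrow> (\<forall>t\<in>I. half_turn u (vcnj (F (of_real t))) = F (of_real t))"

lemma boundary_symmetricD:
  assumes "boundary_symmetric I u F" "z \<in> slit_plane I" "Im z = 0"
  shows "half_turn u (vcnj (F z)) = F z"
proof -
  have z: "of_real (Re z) = z" using assms(3) by (simp add: complex_eq_iff)
  have "Re z \<in> I" using assms(2,3) by (simp add: slit_plane_def)
  then have "half_turn u (vcnj (F (of_real (Re z)))) = F (of_real (Re z))"
    using assms(1) unfolding boundary_symmetric_def by blast
  then show ?thesis unfolding z .
qed

lemma reflected_cnj:
  assumes "boundary_symmetric I u F" "z \<in> slit_plane I" "norm u = 1"
  shows "reflected u F (cnj z) = half_turn u (vcnj (reflected u F z))"
proof -
  consider "Im z > 0" | "Im z = 0" | "Im z < 0" by linarith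
  then show ?thesis
  proof cases
    case 2
    then have "cnj z = z" by (simp add: complex_eq_iff)
    then show ?thesis using boundary_symmetricD[OF assms(1,2) 2] 2 by (simp add: reflected_def)
  next
    case 3
    then show ?thesis by (simp add: reflected_def vcnj_half_turn half_turn_invol[OF assms(3)])
  qed (simp add: reflected_def)
qed

text \<open>Schwarz reflection applies to the component along $u$ and to $i$ times the orthogonal components, since all
  of these are real on the arc.\<close>

lemma vholo_reflected:
  assumes I: "open I" and hol: "vholo F upper_half"
    and cont: "\<And>k. continuous_on (slit_plane I \<inter> {z. 0 \<le> Im z}) (\<lambda>z. F z $ k)"
    and sym: "boundary_symmetric I u F" and u: "norm u = 1"
  shows "vholo (reflected u F) (slit_plane I)"
  unfolding vholo_def
proof
  fix k
  let ?S = "slit_plane I"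
  define a where "a z = of_real (u$1) * F z $ 1 + of_real (u$2) * F z $ 2 + of_real (u$3) * F z $ 3" for z
  define b where "b z = \<i> * (F z $ k - a z * of_real (u $ k))" for z
  have S: "open ?S" "cnj ` ?S \<subseteq> ?S" using open_slit_plane[OF I] by (auto simp: slit_plane_def)
  have holF: "\<And>k. (\<lambda>z. F z $ k) holomorphic_on (?S \<inter> {z. 0 < Im z})"
    using hol by (auto simp: vholo_def upper_half_def intro: holomorphic_on_subset)
  have ha: "a holomorphic_on (?S \<inter> {z. 0 < Im z})" unfolding a_def
    by (intro holomorphic_intros holF)
  have hb: "b holomorphic_on (?S \<inter> {z. 0 < Im z})" unfolding b_def
    by (intro holomorphic_intros holF ha)
  have ca: "continuous_on (?S \<inter> {z. 0 \<le> Im z}) a" unfolding a_def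
    by (intro continuous_intros cont)
  have cb: "continuous_on (?S \<inter> {z. 0 \<le> Im z}) b" unfolding b_def
    by (intro continuous_intros cont ca)
  have real: "a z \<in> \<real> \<and> b z \<in> \<real>" if z: "z \<in> ?S" "z \<in> \<real>" for z
  proof -
    have "Im z = 0" using z(2) by (simp add: complex_is_Real_iff)
    from boundary_symmetricD[OF sym z(1) this]
    have e: "F z $ j = 2 * cnj (a z) * of_real (u $ j) - cnj (F z $ j)" for j
    proof -
      have "F z $ j = half_turn u (vcnj (F z)) $ j" using \<open>half_turn u (vcnj (F z)) = F z\<close> by simp
      then show ?thesis by (simp add: half_turn_nth a_def)
    qed
    have uu: "of_real (u$1) * of_real (u$1) + of_real (u$2) * of_real (u$2) + of_real (u$3) * of_real (u$3) = (1 :: complex)"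
      by (rule unit_vector_sum[OF u])
    have ca: "cnj (a z) = of_real (u$1) * cnj (F z $ 1) + of_real (u$2) * cnj (F z $ 2) + of_real (u$3) * cnj (F z $ 3)"
      by (simp add: a_def)
    have "a z = of_real (u$1) * (2 * cnj (a z) * of_real (u$1) - cnj (F z $ 1))
        + of_real (u$2) * (2 * cnj (a z) * of_real (u$2) - cnj (F z $ 2))
        + of_real (u$3) * (2 * cnj (a z) * of_real (u$3) - cnj (F z $ 3))"
      by (simp only: e[symmetric]) (simp only: a_def)
    also have "\<dots> = 2 * cnj (a z) * (of_real (u$1) * of_real (u$1) + of_real (u$2) * of_real (u$2)
        + of_real (u$3) * of_real (u$3)) - cnj (a z)"
      unfolding ca by (simp add: algebra_simps)
    finally have "a z = cnj (a z)" unfolding uu by simp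
    then have a: "a z \<in> \<real>" by (metis Reals_cnj_iff)
    have aa: "cnj (a z) = a z" using \<open>a z = cnj (a z)\<close> by simp
    have ck: "cnj (F z $ k) = 2 * a z * of_real (u $ k) - F z $ k" using e[of k] unfolding aa by algebra
    have "cnj (b z) = - \<i> * (cnj (F z $ k) - cnj (a z) * of_real (u $ k))" by (simp add: b_def)
    also have "\<dots> = b z" unfolding ck aa b_def by (simp add: algebra_simps)
    finally have "cnj (b z) = b z" .
    then show ?thesis using a by (metis Reals_cnj_iff)
  qed
  note A = Schwarz_reflection[OF S ha ca conjunct1[OF real]]
    and B = Schwarz_reflection[OF S hb cb conjunct2[OF real]]
  have "(\<lambda>z. (if 0 \<le> Im z then a z else cnj (a (cnj z))) * of_real (u $ k)
      - \<i> * (if 0 \<le> Im z then b z else cnj (b (cnj z)))) holomorphic_on ?S"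
    by (intro holomorphic_intros A B) auto
  moreover have "(if 0 \<le> Im z then a z else cnj (a (cnj z))) * of_real (u $ k)
      - \<i> * (if 0 \<le> Im z then b z else cnj (b (cnj z))) = reflected u F z $ k" for z
  proof (cases "0 \<le> Im z")
    case False
    have i: "\<i> * \<i> = -1" by simp
    have "\<i> * (\<i> * x) = - x" for x :: complex by simp
    then show ?thesis using False
      by (simp add: reflected_def half_turn_nth a_def b_def algebra_simps)
  qed (simp add: reflected_def a_def b_def algebra_simps)
  ultimately show "(\<lambda>z. reflected u F z $ k) holomorphic_on ?S" by simp
qed

lemma null_curve_reflected:
  assumes I: "open I" and hol: "vholo F upper_half"
    and cont: "\<And>k. continuous_on (slit_plane I \<inter> {z. 0 \<le> Im z}) (\<lambda>z. F z $ k)"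
    and sym: "boundary_symmetric I u F" and u: "norm u = 1"
    and null: "\<And>z. z \<in> slit_plane I \<Longrightarrow> 0 \<le> Im z \<Longrightarrow> F z \<noteq> 0 \<and> cdot (F z) (F z) = 0"
  shows "null_curve (slit_plane I) (reflected u F)"
  unfolding null_curve_def
proof (intro conjI ballI)
  show "vholo (reflected u F) (slit_plane I)" by (rule vholo_reflected[OF I hol cont sym u])
  fix z assume z: "z \<in> slit_plane I"
  have "reflected u F z \<noteq> 0 \<and> cdot (reflected u F z) (reflected u F z) = 0"
  proof (cases "0 \<le> Im z")
    case False
    have n: "F (cnj z) \<noteq> 0" "cdot (F (cnj z)) (F (cnj z)) = 0"
      using null[of "cnj z"] False z by (auto simp: slit_plane_def)
    have "cdot (vcnj (F (cnj z))) (vcnj (F (cnj z))) = cnj (cdot (F (cnj z)) (F (cnj z)))"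
      by (simp add: cdot_def)
    moreover have "half_turn u (vcnj (F (cnj z))) \<noteq> 0"
    proof
      assume "half_turn u (vcnj (F (cnj z))) = 0"
      then have "half_turn u (half_turn u (vcnj (F (cnj z)))) = 0" by (simp add: vec_eq_iff half_turn_nth)
      then have "vcnj (F (cnj z)) = 0" by (simp add: half_turn_invol[OF u])
      then show False using n(1) by (simp add: vec_eq_iff)
    qed
    ultimately show ?thesis using False n(2) by (simp add: reflected_def half_turn_cdot[OF u])
  qed (use null z in \<open>simp add: reflected_def\<close>)
  then show "reflected u F z \<noteq> 0" "cdot (reflected u F z) (reflected u F z) = 0" by auto
qed

text \<open>The reflected curve is symmetric, so uniqueness of $q$ and $p$ makes them symmetric as well.\<close>

lemma symmetric_null_data:
  assumes I: "open I" and N: "null_data (slit_plane I) (reflected u F) q p"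
    and sym: "boundary_symmetric I u F" and u: "norm u = 1" and z: "z \<in> slit_plane I"
  shows "q (cnj z) = - cnj (q z)" "p (cnj z) = - cnj (p z)"
proof -
  let ?S = "slit_plane I"
  have cS: "cnj w \<in> ?S" if "w \<in> ?S" for w using that by (simp add: slit_plane_def)
  have R: "null_data ?S (\<lambda>z. half_turn u (vcnj (reflected u F (cnj z)))) (\<lambda>z. - cnj (q (cnj z))) (\<lambda>z. - cnj (p (cnj z)))"
    by (rule null_data_reflect[OF open_slit_plane[OF I] cS N u])
  have e: "reflected u F w = half_turn u (vcnj (reflected u F (cnj w)))" if "w \<in> ?S" for w
    using reflected_cnj[OF sym cS[OF that] u] by simp
  have "q (cnj z) = - cnj (q (cnj (cnj z)))"
    by (rule null_data_unique(1)[OF N R open_slit_plane[OF I] order_refl order_refl])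
      (erule e, rule cS[OF z])
  then show "q (cnj z) = - cnj (q z)" by simp
  have "p (cnj z) = - cnj (p (cnj (cnj z)))"
    by (rule null_data_unique(2)[OF N R open_slit_plane[OF I] order_refl order_refl])
      (erule e, rule cS[OF z])
  then show "p (cnj z) = - cnj (p z)" by simp
qed

lemma open_upper_half: "open upper_half"
  unfolding upper_half_def by (rule open_halfspace_Im_gt)

lemma closed_upper_half_limit_point:
  assumes "0 \<le> Im z"
  shows "at z within upper_half \<noteq> bot"
proof -
  have "z islimpt upper_half"
    unfolding islimpt_approachable
  proof (intro allI impI)
    fix \<epsilon> :: real assume "\<epsilon> > 0"
    then show "\<exists>x'\<in>upper_half. x' \<noteq> z \<and> dist x' z < \<epsilon>"
      using assms by (intro bexI[of _ "z + \<i> * of_real (\<epsilon> / 2)"]) (auto simp: upper_half_def dist_norm norm_mult)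
  qed
  then show ?thesis by (simp add: trivial_limit_within)
qed

definition side :: "nat \<Rightarrow> real set" where
  "side j = (if j = 0 then {..<0} else if j = 1 then {0<..<1} else {1<..})"

lemma side_simps: "open (side j)" "convex (side j)" "side j \<noteq> {}" "0 \<notin> side j" "1 \<notin> side j"
proof -
  have "- 1 \<in> side 0" "1 / 2 \<in> side 1" by (auto simp: side_def)
  moreover have "2 \<in> {1::real<..}" by auto
  ultimately show "side j \<noteq> {}" by (auto simp: side_def split: if_splits)
qed (auto simp: side_def)

lemma in_some_slit_plane: "z \<notin> {0, 1} \<Longrightarrow> \<exists>j<3. z \<in> slit_plane (side j)"
proof -
  assume z: "z \<notin> {0, 1}"
  show ?thesis
  proof (cases "Im z = 0")
    case True
    then have "Re z \<noteq> 0" "Re z \<noteq> 1" using z by (auto simp: complex_eq_iff)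
    then consider "Re z < 0" | "0 < Re z" "Re z < 1" | "1 < Re z" by linarith
    then show ?thesis
    proof cases
      case 1 then show ?thesis by (intro exI[of _ 0]) (auto simp: slit_plane_def side_def)
    next
      case 2 then show ?thesis by (intro exI[of _ 1]) (auto simp: slit_plane_def side_def)
    next
      case 3 then show ?thesis by (intro exI[of _ 2]) (auto simp: slit_plane_def side_def)
    qed
  qed (auto simp: slit_plane_def intro!: exI[of _ 0])
qed

lemma slit_plane_side_subset: "slit_plane (side j) \<subseteq> - {0, 1}"
  using side_simps(4,5)[of j] by (auto simp: slit_plane_def)

text \<open>The three continuations coincide on the upper half-plane, and there $q$ and $p$ coincide.  On the lower
  half-plane the continuations differ, but their $q$ and $p$ are given by the same symmetry.\<close>

lemma glued_null_data:
  fixes u :: "nat \<Rightarrow> real^3"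
  assumes u: "\<And>j. norm (u j) = 1"
    and sym: "\<And>j. boundary_symmetric (side j) (u j) F"
    and null: "\<And>j. null_curve (slit_plane (side j)) (reflected (u j) F)"
  obtains q p where "q holomorphic_on - {0, 1}" "p holomorphic_on - {0, 1}"
    "\<And>z. z \<notin> {0, 1} \<Longrightarrow> q (cnj z) = - cnj (q z) \<and> p (cnj z) = - cnj (p z)"
    "\<And>j. j < 3 \<Longrightarrow> null_data (slit_plane (side j)) (reflected (u j) F) q p"
proof -
  have "\<exists>q p. null_data (slit_plane (side j)) (reflected (u j) F) q p" for j
    using null_data_exists[OF null open_slit_plane[OF side_simps(1)]] by metis
  then obtain qs ps where N: "\<And>j. null_data (slit_plane (side j)) (reflected (u j) F) (qs j) (ps j)"
    by metis
  have sub: "upper_half \<subseteq> slit_plane (side j)" for j by (auto simp: slit_plane_def upper_half_def)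
  have up: "qs j z = qs k z \<and> ps j z = ps k z" if z: "z \<in> upper_half" for j k z
  proof -
    have e: "reflected (u j) F w = reflected (u k) F w" if "w \<in> upper_half" for w
      using that by (simp add: reflected_def upper_half_def)
    show ?thesis
      using null_data_unique[OF N[of j] N[of k] open_upper_half sub sub e z] by blast
  qed
  have S: "qs j (cnj z) = - cnj (qs j z)" "ps j (cnj z) = - cnj (ps j z)" if "z \<in> slit_plane (side j)" for j z
    by (rule symmetric_null_data[OF side_simps(1) N sym u that])+
  have disj: "j = k" if "z \<in> slit_plane (side j)" "z \<in> slit_plane (side k)" "Im z = 0" "j < 3" "k < 3" for j k z
    using that by (auto simp: slit_plane_def side_def split: if_splits)
  have agree: "qs j z = qs k z \<and> ps j z = ps k z"
    if z: "z \<in> slit_plane (side j)" "z \<in> slit_plane (side k)" and jk: "j < 3" "k < 3" for j k z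
  proof -
    consider "Im z > 0" | "Im z = 0" | "Im z < 0" by linarith
    then show ?thesis
    proof cases
      case 1 then show ?thesis using up by (simp add: upper_half_def)
    next
      case 2 then show ?thesis using disj z jk by blast
    next
      case 3
      then have c: "cnj z \<in> upper_half" by (simp add: upper_half_def)
      then have m: "cnj z \<in> slit_plane (side j)" "cnj z \<in> slit_plane (side k)" using sub by auto
      show ?thesis using up[OF c, of j k] S[OF m(1)] S[OF m(2)] by simp
    qed
  qed
  define J where "J z = (SOME j. j < 3 \<and> z \<in> slit_plane (side j))" for z
  have J: "J z < 3 \<and> z \<in> slit_plane (side (J z))" if "z \<notin> {0, 1}" for z
    using someI_ex[of "\<lambda>j. j < 3 \<and> z \<in> slit_plane (side j)"] in_some_slit_plane[OF that] unfolding J_def by blast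
  define q p where "q z = qs (J z) z" and "p z = ps (J z) z" for z
  have qp: "qs j z = q z \<and> ps j z = p z" if "j < 3" "z \<in> slit_plane (side j)" for j z
    using agree[of z j "J z"] J[of z] that slit_plane_side_subset[of j] unfolding q_def p_def by auto
  have N': "null_data (slit_plane (side j)) (reflected (u j) F) q p" if "j < 3" for j
    by (rule null_data_cong[OF N open_slit_plane[OF side_simps(1)] order_refl]) (use qp that in auto)
  have cover: "- {0, 1} = (\<Union>j\<in>{..<3}. slit_plane (side j))"
    using in_some_slit_plane slit_plane_side_subset by (auto; blast)
  show thesis
  proof (rule that[OF _ _ _ N'])
    show "q holomorphic_on - {0, 1}" unfolding cover
      by (rule holomorphic_on_UN_open) (use N' open_slit_plane[OF side_simps(1)] in \<open>auto simp: null_data_def\<close>)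
    show "p holomorphic_on - {0, 1}" unfolding cover
      by (rule holomorphic_on_UN_open) (use N' open_slit_plane[OF side_simps(1)] in \<open>auto simp: null_data_def\<close>)
    fix z :: complex assume "z \<notin> {0, 1}"
    then obtain j where j: "j < 3" "z \<in> slit_plane (side j)" using in_some_slit_plane by blast
    show "q (cnj z) = - cnj (q z) \<and> p (cnj z) = - cnj (p z)"
      using symmetric_null_data[OF side_simps(1) N'[OF j(1)] sym u j(2)] by blast
  qed
qed

section \<open>The null curve is determined up to a rotation\<close>

text \<open>The determinant of $\phi, \phi', \phi''$ is $-8 i q^3$.\<close>

lemma null_curve_spans:
  assumes N: "null_data \<Omega> F q p" and O: "open \<Omega>" and z: "z \<in> \<Omega>" "q z \<noteq> 0"
    and L: "\<And>w. w \<in> \<Omega> \<Longrightarrow> cdot L (F w) = 0"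
  shows "L = 0"
proof -
  have NC: "null_curve \<Omega> F" and F: "vholo F \<Omega>" using N by (auto simp: null_data_def null_curve_def)
  define a b c where "a = F z" and "b = vderiv F z" and "c = vderiv (vderiv F) z"
  note d = has_field_derivative_vderiv[OF F O] has_field_derivative_vderiv[OF vholo_vderiv[OF F O] O]
  have L1: "cdot L (vderiv F w) = 0" if w: "w \<in> \<Omega>" for w
  proof -
    have "((\<lambda>w. L$1 * F w$1 + L$2 * F w$2 + L$3 * F w$3) has_field_derivative cdot L (vderiv F w)) (at w)"
      by (rule derivative_eq_intros d(1)[OF w] refl)+ (simp add: cdot_def)
    from deriv_zero_on_open[OF O w _ this] L show ?thesis by (auto simp: cdot_def)
  qed
  have L2: "cdot L c = 0"
  proof -
    have "((\<lambda>w. L$1 * vderiv F w$1 + L$2 * vderiv F w$2 + L$3 * vderiv F w$3) has_field_derivative cdot L c) (at z)"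
      by (rule derivative_eq_intros d(2)[OF z(1)] refl)+ (simp add: cdot_def c_def)
    from deriv_zero_on_open[OF O z(1) _ this] L1 show ?thesis by (auto simp: cdot_def)
  qed
  have j: "cdot a a = 0" "cdot a b = 0" "cdot b b + cdot a c = 0"
    using null_curve_jets[OF NC O z(1)] by (simp_all add: a_def b_def c_def)
  have jd: "jet_data a b c (q z) (deriv q z) (p z)" and a0: "a \<noteq> 0"
    using N z(1) by (auto simp: null_data_def null_curve_def a_def b_def c_def)
  then have ab: "ccross a b = (2*\<i>*q z) *s a" and bc: "ccross b c = (2 * \<i>) *s (q z *s c - deriv q z *s b + (4 * p z) *s a)"
    by (auto simp: jet_data_def)
  have bb: "cdot b b = 4 * (q z)\<^sup>2" by (rule jet_dot_q[OF j(2) ab a0])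
  have lin: "cdot a ((2 * \<i>) *s (x *s c - y *s b + t *s a)) = 2 * \<i> * (x * cdot a c - y * cdot a b + t * cdot a a)" for x y t
    by (simp add: cdot_def algebra_simps)
  have "cdot a (ccross b c) = 2 * \<i> * (q z * cdot a c)"
    unfolding bc lin j by simp
  also have "cdot a c = - (4 * (q z)\<^sup>2)" using j(3) bb by algebra
  finally have det: "cdot a (ccross b c) \<noteq> 0" using z(2) by simp
  have "cdot a (ccross b c) *s L = cdot L a *s ccross b c + cdot L b *s ccross c a + cdot L c *s ccross a b"
    by (simp add: vec3_eq_iff cdot_def algebra_simps)
  also have "\<dots> = 0" using L[OF z(1)] L1[OF z(1)] L2 by (simp add: a_def b_def)
  finally have "cdot a (ccross b c) *s L = 0" .
  then have "cdot a (ccross b c) * L $ k = 0" for k by (metis vector_smult_component zero_index)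
  then show ?thesis using det by (simp add: vec_eq_iff)
qed

definition half_turn_matrix :: "real^3 \<Rightarrow> real^3^3" where
  "half_turn_matrix u = (\<chi> i j. 2 * u $ i * u $ j - (if i = j then 1 else 0))"

text \<open>An antisymmetric matrix is the cross product with an axis vector $k$.  Conjugation by the half-turn turns
  the axis into its image, so the hypothesis says that the half-turn sends $k$ to $-k$.\<close>

lemma antisymmetric_anticommuting_axis:
  fixes K :: "real^3^3" and u :: "real^3"
  assumes K: "transpose K = - K" and u: "norm u = 1"
    and anti: "K ** half_turn_matrix u = - (half_turn_matrix u ** K)"
  shows "vector [K$3$2, K$1$3, K$2$1] \<bullet> u = 0"
proof -
  have kt: "K$i$j = - K$j$i" for i j
  proof -
    have "transpose K $ j $ i = (- K) $ j $ i" by (simp only: K)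
    then show ?thesis by (simp add: transpose_def)
  qed
  have d: "K$1$1 = 0" "K$2$2 = 0" "K$3$3 = 0" using kt[of 1 1] kt[of 2 2] kt[of 3 3] by simp_all
  have o: "K$1$2 = - K$2$1" "K$2$3 = - K$3$2" "K$3$1 = - K$1$3" by (rule kt)+
  have uu: "u$1 * u$1 + u$2 * u$2 + u$3 * u$3 = 1"
    using u by (simp add: norm_eq_1 inner_vec_def sum_3)
  define s where "s = K$3$2 * u$1 + K$1$3 * u$2 + K$2$1 * u$3"
  have e: "(K ** half_turn_matrix u) $ i $ j = - (half_turn_matrix u ** K) $ i $ j" for i j
    by (simp add: anti)
  have s1: "u$3 * s = 0"
    using e[of 2 1] uu unfolding s_def by (simp add: matrix_matrix_mult_def sum_3 half_turn_matrix_def d o) algebra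
  have s2: "u$1 * s = 0"
    using e[of 3 2] uu unfolding s_def by (simp add: matrix_matrix_mult_def sum_3 half_turn_matrix_def d o) algebra
  have s3: "u$2 * s = 0"
    using e[of 1 3] uu unfolding s_def by (simp add: matrix_matrix_mult_def sum_3 half_turn_matrix_def d o) algebra
  have "s = 0" using s1 s2 s3 uu by algebra
  then show ?thesis by (simp add: inner_vec_def sum_3 s_def)
qed

lemma independent_directions_orthogonal_zero:
  fixes k :: "real^3"
  assumes "det (vector [u1, u2, u3] :: real^3^3) \<noteq> 0" "k \<bullet> u1 = 0" "k \<bullet> u2 = 0" "k \<bullet> u3 = 0"
  shows "k = 0"
proof -
  let ?A = "vector [u1, u2, u3] :: real^3^3"
  have "?A *v k = 0"
    using assms(2-4) by (simp add: vec_eq_iff forall_3 matrix_vector_mul_component inner_commute)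
  moreover have "invertible ?A" using assms(1) by (simp add: invertible_det_nz)
  ultimately show ?thesis
    by (metis invertible_def matrix_vector_mul_assoc matrix_vector_mul_lid matrix_vector_mult_0_right)
qed

text \<open>For $M = U + iV$ orthogonal, $K = U^T V$ is antisymmetric and anticommutes with the half-turns about three
  independent axes, so its axis is orthogonal to all of them and $K = 0$.  Then $M M^T = 1$ gives
  $V = - V V^T V$, which forces $V = 0$.\<close>

lemma real_orthogonal_of_anticommuting:
  fixes U V :: "real^3^3" and u u' :: "nat \<Rightarrow> real^3"
  assumes re: "transpose U ** U - transpose V ** V = mat 1" and im: "transpose U ** V + transpose V ** U = 0"
    and re': "U ** transpose U - V ** transpose V = mat 1"
    and u: "\<And>j. j < 3 \<Longrightarrow> norm (u j) = 1"
    and det: "det (vector [u 0, u 1, u 2] :: real^3^3) \<noteq> 0"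
    and U: "\<And>j. j < 3 \<Longrightarrow> half_turn_matrix (u' j) ** U = U ** half_turn_matrix (u j)"
    and V: "\<And>j. j < 3 \<Longrightarrow> half_turn_matrix (u' j) ** V = - (V ** half_turn_matrix (u j))"
  shows "V = 0"
proof -
  define K where "K = transpose U ** V"
  have sT: "transpose (half_turn_matrix v) = half_turn_matrix v" for v
    by (simp add: transpose_def half_turn_matrix_def vec_eq_iff)
  have neg: "- (A ** B) = (- A) ** B" "A ** (- B) = - (A ** B)" for A B :: "real^3^3"
    by (simp_all add: matrix_matrix_mult_def vec_eq_iff sum_negf)
  have K: "transpose K = - K"
    using im by (simp add: K_def matrix_transpose_mul eq_neg_iff_add_eq_0 add.commute)
  have anti: "K ** half_turn_matrix (u j) = - (half_turn_matrix (u j) ** K)" if j: "j < 3" for j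
  proof -
    have "K ** half_turn_matrix (u j) = transpose U ** (V ** half_turn_matrix (u j))"
      by (simp add: K_def matrix_mul_assoc)
    also have "V ** half_turn_matrix (u j) = - (half_turn_matrix (u' j) ** V)" using V[OF j] by simp
    also have "transpose U ** - (half_turn_matrix (u' j) ** V) = - (transpose (half_turn_matrix (u' j) ** U) ** V)"
      by (simp add: matrix_transpose_mul sT neg(2) matrix_mul_assoc)
    also have "\<dots> = - (half_turn_matrix (u j) ** K)"
      by (simp add: U[OF j] matrix_transpose_mul sT K_def matrix_mul_assoc)
    finally show ?thesis .
  qed
  have "vector [K$3$2, K$1$3, K$2$1] \<bullet> u j = 0" if "j < 3" for j
    by (rule antisymmetric_anticommuting_axis[OF K u anti]) (use that in auto)
  then have "(vector [K$3$2, K$1$3, K$2$1] :: real^3) = 0"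
    using independent_directions_orthogonal_zero[OF det] by simp
  then have k0: "K$3$2 = 0" "K$1$3 = 0" "K$2$1 = 0" by (simp_all add: vec_eq_iff forall_3)
  have kt: "K$i$j = - K$j$i" for i j
  proof -
    have "transpose K $ j $ i = (- K) $ j $ i" by (simp only: K)
    then show ?thesis by (simp add: transpose_def)
  qed
  have "K$1$1 = 0" "K$2$2 = 0" "K$3$3 = 0" "K$2$3 = 0" "K$3$1 = 0" "K$1$2 = 0"
    using kt[of 1 1] kt[of 2 2] kt[of 3 3] kt[of 2 3] kt[of 3 1] kt[of 1 2] k0 by simp_all
  with k0 have K0: "transpose U ** V = 0" unfolding K_def by (simp add: vec_eq_iff forall_3)
  have VV: "V = - (V ** (transpose V ** V))"
  proof -
    have "(U ** transpose U - V ** transpose V) ** V = V" by (simp add: re')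
    moreover have "(U ** transpose U - V ** transpose V) ** V = U ** (transpose U ** V) - V ** (transpose V ** V)"
    proof -
      have "(A - B) ** C = A ** C - B ** C" for A B C :: "real^3^3"
        by (simp add: matrix_matrix_mult_def vec_eq_iff left_diff_distrib sum_subtractf)
      then show ?thesis by (simp add: matrix_mul_assoc)
    qed
    ultimately show ?thesis by (simp add: K0)
  qed
  have "V *v b = 0" for b
  proof -
    define y where "y = transpose V *v (V *v b)"
    have y: "(V *v b) v* V = y" unfolding y_def by (simp only: transpose_matrix_vector)
    have "V *v b = (- (V ** (transpose V ** V))) *v b" using VV by simp
    also have "\<dots> = - ((V ** (transpose V ** V)) *v b)"
      by (simp add: matrix_vector_mult_def vec_eq_iff sum_negf)
    also have "(V ** (transpose V ** V)) *v b = V *v y"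
      by (simp only: y_def matrix_vector_mul_assoc)
    finally have e: "V *v b = - (V *v y)" .
    have "(V *v b) \<bullet> (V *v y) = y \<bullet> y" using dot_lmul_matrix[of "V *v b" V y] y by simp
    then have "(V *v b) \<bullet> (V *v b) = - (y \<bullet> y)" using e by (metis inner_minus_right)
    then have "(V *v b) \<bullet> (V *v b) \<le> 0" by simp
    then show ?thesis by (metis inner_eq_zero_iff inner_ge_zero order_antisym)
  qed
  then show "V = 0" by (simp add: matrix_eq)
qed

lemma cdot_matrix_row: "cdot (M $ i) v = ((M :: complex^3^3) *v v) $ i"
  by (simp add: cdot_def matrix3_mult_nth)

lemma upper_half_subset: "upper_half \<subseteq> slit_plane I"
  by (auto simp: slit_plane_def upper_half_def)

lemma connected_upper_half: "connected upper_half" "convex upper_half"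
proof -
  show "convex upper_half" unfolding upper_half_def by (rule convex_halfspace_Im_gt)
  then show "connected upper_half" by (rule convex_connected)
qed

text \<open>If $\phi_1 = i \phi_2$ on an open set, then $\phi_3 = 0$ there, the Gauss map is constant and $q$
  vanishes.\<close>

lemma first_chart_nonvanishing:
  assumes N: "null_data \<Omega> F q p" and B: "open B" "B \<subseteq> \<Omega>" "z \<in> B" and q: "q z \<noteq> 0"
  shows "\<exists>w\<in>B. F w $ 1 - \<i> * F w $ 2 \<noteq> 0"
proof (rule ccontr)
  assume "\<not> ?thesis"
  then have z0: "F w $ 1 - \<i> * F w $ 2 = 0" if "w \<in> B" for w using that by blast
  have F: "vholo F B" using N B(2) by (auto simp: null_data_def null_curve_def intro: vholo_subset)
  have f3: "F w $ 3 = 0" if w: "w \<in> B" for w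
  proof -
    have c: "cdot (F w) (F w) = 0" using N B(2) w by (auto simp: null_data_def null_curve_def)
    have i: "\<i> * \<i> = -1" by simp
    have "(F w $ 3)\<^sup>2 = 0" using c z0[OF w] i unfolding cdot_def by algebra
    then show ?thesis by simp
  qed
  have d3: "vderiv F z $ 3 = 0"
    by (rule deriv_zero_on_open[OF B(1,3) f3 has_field_derivative_vderiv[OF F B(1,3)]])
  have "F z \<noteq> 0" and j: "ccross (F z) (vderiv F z) = (2 * \<i> * q z) *s F z"
    using N B(2,3) by (auto simp: null_data_def null_curve_def jet_data_def)
  have "ccross (F z) (vderiv F z) $ 2 = 2 * \<i> * q z * F z $ 2" using j by simp
  then have "F z $ 2 = 0" using f3[OF B(3)] d3 q unfolding ccross_nth by simp
  then have "F z = 0" using z0[OF B(3)] f3[OF B(3)] by (simp add: vec3_eq_iff)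
  with \<open>F z \<noteq> 0\<close> show False by simp
qed

lemma ball_with_nonzero_values:
  fixes f :: "complex \<Rightarrow> complex"
  assumes "f holomorphic_on B" "open B" "z \<in> B" "f z \<noteq> 0"
  obtains e where "e > 0" "ball z e \<subseteq> B" "\<And>w. w \<in> ball z e \<Longrightarrow> f w \<noteq> 0"
proof -
  have "open (B \<inter> f -` (- {0}))"
    by (rule continuous_open_preimage[OF holomorphic_on_imp_continuous_on[OF assms(1)] assms(2)])
      (simp add: open_Compl)
  moreover have "z \<in> B \<inter> f -` (- {0})" using assms by simp
  ultimately obtain e where "e > 0" "ball z e \<subseteq> B \<inter> f -` (- {0})" using openE by blast
  then show thesis by (intro that[of e]) auto
qed

lemma matrix_on_upper_half:
  assumes F: "null_data upper_half F q p" and G: "null_data upper_half G q p"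
    and z0: "z0 \<in> upper_half" "q z0 \<noteq> 0"
  obtains M :: "complex^3^3" where "transpose M ** M = mat 1" "det M = 1"
    "\<And>z. z \<in> upper_half \<Longrightarrow> G z = M *v F z"
proof -
  have vF: "vholo F upper_half" and vG: "vholo G upper_half" and q: "q holomorphic_on upper_half"
    using F G by (auto simp: null_data_def null_curve_def)
  note hF = vholo_nth[OF vF] and hG = vholo_nth[OF vG]
  obtain e0 where e0: "e0 > 0" "ball z0 e0 \<subseteq> upper_half" "\<And>w. w \<in> ball z0 e0 \<Longrightarrow> q w \<noteq> 0"
    using ball_with_nonzero_values[OF q open_upper_half z0] by blast
  \<comment> \<open>The ball is shrunk twice so that both curves admit a spinor on it.\<close>
  obtain z1 where z1: "z1 \<in> ball z0 e0" "F z1 $ 1 - \<i> * F z1 $ 2 \<noteq> 0"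
    using first_chart_nonvanishing[OF F open_ball e0(2), of z0] e0(1) z0(2) by auto
  have "(\<lambda>w. F w $ 1 - \<i> * F w $ 2) holomorphic_on ball z0 e0"
    by (intro holomorphic_intros holomorphic_on_subset[OF hF e0(2)])
  then obtain e1 where e1: "e1 > 0" "ball z1 e1 \<subseteq> ball z0 e0" "\<And>w. w \<in> ball z1 e1 \<Longrightarrow> F w $ 1 - \<i> * F w $ 2 \<noteq> 0"
    using ball_with_nonzero_values[where f = "\<lambda>w. F w $ 1 - \<i> * F w $ 2", OF _ open_ball z1(1)] z1(2) by blast
  have s1: "ball z1 e1 \<subseteq> upper_half" using e1(2) e0(2) by blast
  obtain z2 where z2: "z2 \<in> ball z1 e1" "G z2 $ 1 - \<i> * G z2 $ 2 \<noteq> 0"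
    using first_chart_nonvanishing[OF G open_ball s1, of z1] e1(1) e0(3)[OF z1(1)] by auto
  have "(\<lambda>w. G w $ 1 - \<i> * G w $ 2) holomorphic_on ball z1 e1"
    by (intro holomorphic_intros holomorphic_on_subset[OF hG s1])
  then obtain e2 where e2: "e2 > 0" "ball z2 e2 \<subseteq> ball z1 e1" "\<And>w. w \<in> ball z2 e2 \<Longrightarrow> G w $ 1 - \<i> * G w $ 2 \<noteq> 0"
    using ball_with_nonzero_values[where f = "\<lambda>w. G w $ 1 - \<i> * G w $ 2", OF _ open_ball z2(1)] z2(2) by blast
  have s2: "ball z2 e2 \<subseteq> upper_half" using e2(2) s1 by blast
  have nF: "null_data (ball z2 e2) F q p" by (rule null_data_cong[OF F open_ball s2]) simp_all
  have nG: "null_data (ball z2 e2) G q p" by (rule null_data_cong[OF G open_ball s2]) simp_all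
  obtain M :: "complex^3^3" where M: "transpose M ** M = mat 1" "det M = 1" "\<And>z. z \<in> ball z2 e2 \<Longrightarrow> G z = M *v F z"
  proof (rule matrix_of_same_null_data[OF convex_ball open_ball _ nF nG, of z2])
    show "z2 \<in> ball z2 e2" using e2(1) by simp
    fix w assume w: "w \<in> ball z2 e2"
    then have "w \<in> ball z1 e1" using e2(2) by blast
    moreover from this have "w \<in> ball z0 e0" using e1(2) by blast
    ultimately show "q w \<noteq> 0" "F w $ 1 - \<i> * F w $ 2 \<noteq> 0" "G w $ 1 - \<i> * G w $ 2 \<noteq> 0"
      using e0(3) e1(3) e2(3) w by blast+
  qed (rule that)
  have "G z = M *v F z" if z: "z \<in> upper_half" for z
  proof -
    have "G z $ k = (M *v F z) $ k" for k
    proof (rule analytic_continuation_open[where f = "\<lambda>z. G z $ k" and g = "\<lambda>z. (M *v F z) $ k",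
        OF open_ball open_upper_half _ connected_upper_half(1) s2])
      show "ball z2 e2 \<noteq> {}" using e2(1) by simp
      show "(\<lambda>z. G z $ k) holomorphic_on upper_half" by (rule hG)
      show "(\<lambda>z. (M *v F z) $ k) holomorphic_on upper_half"
        unfolding matrix3_mult_nth by (intro holomorphic_intros hF)
    qed (use M(3) z in auto)
    then show ?thesis by (simp add: vec_eq_iff)
  qed
  with M(1,2) show thesis by (rule that)
qed

text \<open>The relation $G = M F$ is continued through the arc and then read at a point of the lower half-plane.\<close>

lemma reflected_matrix:
  fixes M :: "complex^3^3"
  assumes I: "open I" "convex I" "c \<in> I"
    and F: "vholo (reflected u F) (slit_plane I)" and G: "vholo (reflected u' G) (slit_plane I)"
    and M: "\<And>z. z \<in> upper_half \<Longrightarrow> G z = M *v F z" and z: "z \<in> upper_half"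
  shows "half_turn u' (vcnj (M *v F z)) = M *v half_turn u (vcnj (F z))"
proof -
  have zS: "cnj z \<in> slit_plane I" and Im: "Im z > 0" using z by (auto simp: slit_plane_def upper_half_def)
  have "reflected u' G (cnj z) $ k = (M *v reflected u F (cnj z)) $ k" for k
  proof (rule analytic_continuation_open[where f = "\<lambda>z. reflected u' G z $ k" and g = "\<lambda>z. (M *v reflected u F z) $ k",
        OF open_upper_half open_slit_plane[OF I(1)] _ connected_slit_plane[OF I(2,3)] upper_half_subset])
    show "upper_half \<noteq> {}" using z by blast
    show "(\<lambda>z. reflected u' G z $ k) holomorphic_on slit_plane I" by (rule vholo_nth[OF G])
    show "(\<lambda>z. (M *v reflected u F z) $ k) holomorphic_on slit_plane I"
      unfolding matrix3_mult_nth by (intro holomorphic_intros vholo_nth[OF F])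
    show "reflected u' G w $ k = (M *v reflected u F w) $ k" if "w \<in> upper_half" for w
      using M[OF that] that by (simp add: reflected_def upper_half_def)
  qed (rule zS)
  then have "reflected u' G (cnj z) = M *v reflected u F (cnj z)" by (simp add: vec_eq_iff)
  then show ?thesis using Im M[OF z] by (simp add: reflected_def)
qed

definition cmat :: "real^3^3 \<Rightarrow> complex^3^3" where "cmat R = (\<chi> i j. of_real (R $ i $ j))"

lemma half_turn_as_matrix: "half_turn u v = cmat (half_turn_matrix u) *v v"
  by (simp add: vec3_eq_iff half_turn_nth matrix3_mult_nth cmat_def half_turn_matrix_def algebra_simps)

text \<open>Comparing $M$ with the reflections through each arc gives $T' M = \overline{M} T$ on the values of the null
  curve, hence everywhere because these values span.  Here $T$ and $T'$ are the half-turns about the two lines that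
  correspond to the arc.\<close>

lemma rotation_between_null_curves:
  fixes u u' :: "nat \<Rightarrow> real^3"
  assumes F: "null_data upper_half F q p" and G: "null_data upper_half G q p"
    and z0: "z0 \<in> upper_half" "q z0 \<noteq> 0"
    and rF: "\<And>j. j < 3 \<Longrightarrow> vholo (reflected (u j) F) (slit_plane (side j))"
    and rG: "\<And>j. j < 3 \<Longrightarrow> vholo (reflected (u' j) G) (slit_plane (side j))"
    and u: "\<And>j. j < 3 \<Longrightarrow> norm (u j) = 1"
    and det: "det (vector [u 0, u 1, u 2] :: real^3^3) \<noteq> 0"
  obtains R where "rotation_matrix R" "\<And>z. z \<in> upper_half \<Longrightarrow> G z = cmat R *v F z"
proof -
  obtain M :: "complex^3^3" where M: "transpose M ** M = mat 1" "det M = 1" "\<And>z. z \<in> upper_half \<Longrightarrow> G z = M *v F z"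
    by (rule matrix_on_upper_half[OF F G z0]) (rule that)
  define U V :: "real^3^3" where "U = (\<chi> i j. Re (M $ i $ j))" and "V = (\<chi> i j. Im (M $ i $ j))"
  have M': "M ** transpose M = mat 1" using M(1) by (simp add: matrix_left_right_inverse)
  have key: "cmat (half_turn_matrix (u' j)) ** M = map_matrix cnj M ** cmat (half_turn_matrix (u j))" if j: "j < 3" for j
  proof -
    let ?L = "cmat (half_turn_matrix (u' j)) ** M - map_matrix cnj M ** cmat (half_turn_matrix (u j))"
    obtain c where c': "c \<in> side j" using side_simps(3) by blast
    have "?L *v F z = 0" if z: "z \<in> upper_half" for z
    proof -
      have c: "vcnj (M *v w) = map_matrix cnj M *v vcnj w" for w
        by (simp add: vec_eq_iff matrix3_mult_nth)
      have "half_turn (u' j) (M *v F z) = vcnj (half_turn (u' j) (vcnj (M *v F z)))"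
        by (simp only: vcnj_half_turn vcnj_vcnj)
      also have "\<dots> = vcnj (M *v half_turn (u j) (vcnj (F z)))"
        by (simp only: reflected_matrix[OF side_simps(1,2) c' rF[OF j] rG[OF j] M(3) z])
      also have "\<dots> = map_matrix cnj M *v half_turn (u j) (F z)"
        by (simp only: c vcnj_half_turn vcnj_vcnj)
      finally have "half_turn (u' j) (M *v F z) = map_matrix cnj M *v half_turn (u j) (F z)" .
      then show ?thesis
        by (simp add: half_turn_as_matrix matrix_vector_mul_assoc matrix_vector_mult_diff_rdistrib)
    qed
    then have "cdot (?L $ i) (F z) = 0" if "z \<in> upper_half" for z i
      using that by (simp only: cdot_matrix_row zero_index)
    then have "?L $ i = 0" for i
      by (rule null_curve_spans[OF F open_upper_half z0])
    then have "?L = 0" by (simp add: vec_eq_iff)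
    then show ?thesis by simp
  qed
  have entries: "(A ** B) $ i $ j = A$i$1 * B$1$j + A$i$2 * B$2$j + A$i$3 * B$3$j" for A B :: "complex^3^3" and i j
    by (simp add: matrix_matrix_mult_def sum_3)
  have entriesR: "(A ** B) $ i $ j = A$i$1 * B$1$j + A$i$2 * B$2$j + A$i$3 * B$3$j" for A B :: "real^3^3" and i j
    by (simp add: matrix_matrix_mult_def sum_3)
  have U: "half_turn_matrix (u' j) ** U = U ** half_turn_matrix (u j)"
    and V: "half_turn_matrix (u' j) ** V = - (V ** half_turn_matrix (u j))" if j: "j < 3" for j
  proof -
    have e: "(cmat (half_turn_matrix (u' j)) ** M) $ i $ k = (map_matrix cnj M ** cmat (half_turn_matrix (u j))) $ i $ k" for i k
      using key[OF j] by simp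
    have "Re ((cmat (half_turn_matrix (u' j)) ** M) $ i $ k) = Re ((map_matrix cnj M ** cmat (half_turn_matrix (u j))) $ i $ k)" for i k
      by (simp only: e)
    then show "half_turn_matrix (u' j) ** U = U ** half_turn_matrix (u j)"
      by (simp add: vec_eq_iff entries entriesR U_def cmat_def map_matrix_def)
    have "Im ((cmat (half_turn_matrix (u' j)) ** M) $ i $ k) = Im ((map_matrix cnj M ** cmat (half_turn_matrix (u j))) $ i $ k)" for i k
      by (simp only: e)
    then show "half_turn_matrix (u' j) ** V = - (V ** half_turn_matrix (u j))"
      by (simp add: vec_eq_iff entries entriesR V_def cmat_def map_matrix_def)
  qed
  have m: "Re ((mat 1 :: complex^3^3) $ i $ j) = mat 1 $ i $ j" "Im ((mat 1 :: complex^3^3) $ i $ j) = 0" for i j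
    by (simp_all add: mat_def)
  note defs = entries entriesR U_def V_def transpose_def
  have "(transpose U ** U - transpose V ** V) $ i $ j = Re ((transpose M ** M) $ i $ j)"
    "(transpose U ** V + transpose V ** U) $ i $ j = Im ((transpose M ** M) $ i $ j)"
    "(U ** transpose U - V ** transpose V) $ i $ j = Re ((M ** transpose M) $ i $ j)" for i j
    by (simp_all add: defs algebra_simps)
  then have re: "transpose U ** U - transpose V ** V = mat 1"
    and im: "transpose U ** V + transpose V ** U = 0"
    and re': "U ** transpose U - V ** transpose V = mat 1"
    unfolding M(1) M' m by (simp_all add: vec_eq_iff)
  have V0: "V = 0" by (rule real_orthogonal_of_anticommuting[OF re im re' u det U V])
  have MU: "M = cmat U"
  proof -
    have "Im (M $ i $ j) = V $ i $ j" for i j by (simp add: V_def)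
    then show ?thesis by (simp add: V0 cmat_def U_def vec_eq_iff complex_eq_iff)
  qed
  have "transpose U ** U = mat 1"
  proof -
    have "transpose V ** V = 0" by (simp add: V0 matrix_matrix_mult_def vec_eq_iff)
    then show ?thesis using re by simp
  qed
  then have "orthogonal_matrix U" by (simp add: orthogonal_matrix)
  moreover have "det U = 1"
  proof -
    have "of_real (det U) = det (cmat U)" by (simp add: det_3 cmat_def)
    also have "\<dots> = 1" using M(2) MU by simp
    finally show ?thesis by simp
  qed
  ultimately have "rotation_matrix U" by (simp add: rotation_matrix_def)
  then show thesis using M(3) unfolding MU by (rule that)
qed

section \<open>Asymptotics at a helicoidal end\<close>

text \<open>The exceptional set $X$ will be the set of poles of the Gauss map.  Continuity gives the bound at its
  points and on the real axis, and the symmetry gives it in the lower half-plane.\<close>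

lemma symmetric_limit:
  fixes G :: "complex \<Rightarrow> complex"
  assumes r: "r > 0" and cont: "continuous_on (ball 0 r - {0}) G"
    and sym: "\<And>z. z \<in> ball 0 r - {0} \<Longrightarrow> G (cnj z) = cnj (G z)" and c: "cnj c = c"
    and lim: "(G \<longlongrightarrow> c) (at 0 within upper_half - X)"
    and X: "\<And>z. Im z > 0 \<Longrightarrow> norm z < r \<Longrightarrow> \<forall>\<^sub>F w in at z. w \<notin> X"
  shows "(G \<longlongrightarrow> c) (at 0)"
proof (rule tendstoI)
  fix e :: real assume e: "e > 0"
  have "\<forall>\<^sub>F z in at 0 within upper_half - X. dist (G z) c < e / 2"
    using tendstoD[OF lim, of "e / 2"] e by simp
  then obtain d where d: "d > 0" "\<And>z. z \<in> upper_half - X \<Longrightarrow> z \<noteq> 0 \<Longrightarrow> norm z < d \<Longrightarrow> dist (G z) c < e / 2"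
    unfolding eventually_at by auto
  have O: "open (ball 0 r - {0 :: complex})" by (rule open_delete[OF open_ball])
  have closed_up: "dist (G z) c \<le> e / 2" if z: "0 \<le> Im z" "z \<noteq> 0" "norm z < min d r" for z
  proof -
    have zS: "z \<in> ball 0 r - {0}" using z by simp
    have "isCont G z" using cont O zS continuous_on_eq_continuous_at by blast
    then have "(G \<longlongrightarrow> G z) (at z within upper_half)"
      by (rule tendsto_within_subset[OF isContD subset_UNIV])
    then have 1: "((\<lambda>w. dist (G w) c) \<longlongrightarrow> dist (G z) c) (at z within upper_half)"
      by (rule tendsto_dist[OF _ tendsto_const])
    have nb: "at z within upper_half \<noteq> bot" by (rule closed_upper_half_limit_point[OF z(1)])
    have "\<forall>\<^sub>F w in nhds z. w \<in> ball 0 (min d r) - {0}"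
      using z by (intro eventually_nhds_in_open) auto
    then have "\<forall>\<^sub>F w in at z within upper_half. w \<in> ball 0 (min d r) - {0}"
      by (simp add: eventually_at_filter eventually_mono)
    moreover have "\<forall>\<^sub>F w in at z within upper_half. w \<in> upper_half" by (simp add: eventually_at_filter)
    moreover have "\<forall>\<^sub>F w in at z within upper_half. w \<in> ball 0 (min d r) - {0} \<longrightarrow> w \<in> upper_half \<longrightarrow> dist (G w) c \<le> e / 2"
    proof (rule eventuallyI, intro impI)
      fix w assume w: "w \<in> ball 0 (min d r) - {0}" "w \<in> upper_half"
      show "dist (G w) c \<le> e / 2"
      proof (cases "w \<in> X")
        case False then show ?thesis using d(2)[of w] w by simp
      next
        case True
        have wS: "w \<in> ball 0 r - {0}" using w by simp
        have "isCont G w" using cont O wS continuous_on_eq_continuous_at by blast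
        then have 1: "((\<lambda>w. dist (G w) c) \<longlongrightarrow> dist (G w) c) (at w)"
          by (rule tendsto_dist[OF isContD tendsto_const])
        have "\<forall>\<^sub>F v in nhds w. v \<in> (ball 0 (min d r) - {0}) \<inter> upper_half"
          using w by (intro eventually_nhds_in_open open_Int open_upper_half) auto
        then have "\<forall>\<^sub>F v in at w. v \<in> (ball 0 (min d r) - {0}) \<inter> upper_half"
          by (simp add: eventually_at_filter eventually_mono)
        moreover have "\<forall>\<^sub>F v in at w. v \<notin> X" using X[of w] w by (simp add: upper_half_def)
        ultimately have "\<forall>\<^sub>F v in at w. dist (G v) c \<le> e / 2"
          by eventually_elim (use d(2) in \<open>auto intro: less_imp_le\<close>)
        then show ?thesis by (intro tendsto_upperbound[OF 1]) auto
      qed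
    qed
    ultimately have "\<forall>\<^sub>F w in at z within upper_half. dist (G w) c \<le> e / 2"
      by eventually_elim blast
    then show ?thesis by (intro tendsto_upperbound[OF 1 _ nb])
  qed
  have "dist (G z) c < e" if z: "z \<noteq> 0" "norm z < min d r" for z
  proof (cases "0 \<le> Im z")
    case True then show ?thesis using closed_up[of z] z e by simp
  next
    case False
    then have "dist (G (cnj z)) c \<le> e / 2" using closed_up[of "cnj z"] z by simp
    moreover have "dist (G (cnj z)) c = dist (G z) c"
    proof -
      have "G (cnj z) - c = cnj (G z - c)" using sym[of z] z c by simp
      then show ?thesis by (simp only: dist_norm complex_mod_cnj)
    qed
    ultimately show ?thesis using e by simp
  qed
  then show "\<forall>\<^sub>F z in at 0. dist (G z) c < e"
    unfolding eventually_at using d(1) r by (intro exI[of _ "min d r"]) (simp add: dist_norm)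
qed

text \<open>The function $z^2 q$ has a removable singularity, so $q = k/z^2$ may be differentiated.\<close>

lemma double_pole_derivative_limits:
  assumes r: "r > 0" and q: "q holomorphic_on ball 0 r - {0}" and lim: "((\<lambda>z. z\<^sup>2 * q z) \<longlongrightarrow> c) (at 0)"
  shows "((\<lambda>z. z^3 * deriv q z) \<longlongrightarrow> - 2 * c) (at 0)" "((\<lambda>z. z^4 * deriv (deriv q) z) \<longlongrightarrow> 6 * c) (at 0)"
proof -
  define k where "k z = (if z = 0 then c else z\<^sup>2 * q z)" for z
  have k0: "k 0 = c" by (simp add: k_def)
  have kc: "(k \<longlongrightarrow> c) (at 0)"
    by (rule Lim_transform_eventually[OF lim]) (auto simp: k_def eventually_at_filter)
  have kh: "k holomorphic_on ball 0 r - {0}"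
    by (rule holomorphic_transform[of "\<lambda>z. z\<^sup>2 * q z"]) (auto intro!: holomorphic_intros q simp: k_def)
  have k: "k holomorphic_on ball 0 r"
  proof (rule no_isolated_singularity'[OF _ kh])
    show "(k \<longlongrightarrow> k z) (at z within ball 0 r)" if "z \<in> {0}" for z
      using tendsto_within_subset[OF kc subset_UNIV] that by (simp add: k0)
  qed auto
  note k' = holomorphic_deriv[OF k open_ball] and k'' = holomorphic_deriv[OF holomorphic_deriv[OF k open_ball] open_ball]
  note d = holomorphic_derivI[OF k open_ball] holomorphic_derivI[OF k' open_ball]
  have O: "open (ball 0 r - {0 :: complex})" by (rule open_delete[OF open_ball])
  have q1: "deriv q z = deriv k z / z\<^sup>2 - 2 * k z / z^3" if z: "z \<in> ball 0 r - {0}" for z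
  proof -
    have zb: "z \<in> ball 0 r" "z \<noteq> 0" using z by auto
    have "((\<lambda>z. k z / z\<^sup>2) has_field_derivative deriv k z / z\<^sup>2 - 2 * k z / z^3) (at z)"
      by (rule derivative_eq_intros d(1)[OF zb(1)] refl)+ (use zb(2) in \<open>simp_all add: field_simps power2_eq_square power3_eq_cube\<close>)
    moreover have "\<forall>\<^sub>F w in nhds z. w \<in> ball 0 r - {0}" by (rule eventually_nhds_in_open[OF O z])
    then have "\<forall>\<^sub>F w in nhds z. q w = k w / w\<^sup>2" by eventually_elim (simp add: k_def)
    then have "deriv q z = deriv (\<lambda>z. k z / z\<^sup>2) z" by (rule deriv_cong_ev[OF _ refl])
    ultimately show ?thesis by (simp add: DERIV_imp_deriv)
  qed
  have q2: "deriv (deriv q) z = deriv (deriv k) z / z\<^sup>2 - 4 * deriv k z / z^3 + 6 * k z / z^4" if z: "z \<in> ball 0 r - {0}" for z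
  proof -
    have zb: "z \<in> ball 0 r" "z \<noteq> 0" using z by auto
    have "((\<lambda>z. deriv k z / z\<^sup>2 - 2 * k z / z^3) has_field_derivative
        deriv (deriv k) z / z\<^sup>2 - 4 * deriv k z / z^3 + 6 * k z / z^4) (at z)"
    proof -
      have p: "((\<lambda>z. z\<^sup>2) has_field_derivative 2 * z) (at z)" "((\<lambda>z. z^3) has_field_derivative 3 * z\<^sup>2) (at z)"
        by (auto intro!: derivative_eq_intros)
      have z0: "z\<^sup>2 \<noteq> 0" "z^3 \<noteq> 0" using zb(2) by auto
      note D = DERIV_diff[OF DERIV_divide[OF d(2)[OF zb(1)] p(1) z0(1)]
          DERIV_divide[OF DERIV_cmult[OF d(1)[OF zb(1)], of 2] p(2) z0(2)]]
      show ?thesis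
        by (rule DERIV_cong[OF D]) (use zb(2) in \<open>simp add: field_simps power2_eq_square power3_eq_cube power4_eq_xxxx\<close>)
    qed
    moreover have "\<forall>\<^sub>F w in nhds z. w \<in> ball 0 r - {0}" by (rule eventually_nhds_in_open[OF O z])
    then have "\<forall>\<^sub>F w in nhds z. deriv q w = deriv k w / w\<^sup>2 - 2 * k w / w^3" by eventually_elim (rule q1)
    then have "deriv (deriv q) z = deriv (\<lambda>z. deriv k z / z\<^sup>2 - 2 * k z / z^3) z" by (rule deriv_cong_ev[OF _ refl])
    ultimately show ?thesis by (simp add: DERIV_imp_deriv)
  qed
  have cont: "isCont f 0" if "f holomorphic_on ball 0 r" for f :: "complex \<Rightarrow> complex"
    using that r by (meson centre_in_ball continuous_on_eq_continuous_at holomorphic_on_imp_continuous_on open_ball)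
  note t = isContD[OF cont[OF k]] isContD[OF cont[OF k']] isContD[OF cont[OF k'']]
  have ev: "\<forall>\<^sub>F z in at 0. z \<in> ball 0 r - {0}"
    using r eventually_at_ball'[of r 0 UNIV] by (auto elim: eventually_mono)
  have "((\<lambda>z. z * deriv k z - 2 * k z) \<longlongrightarrow> 0 * deriv k 0 - 2 * k 0) (at 0)"
    by (intro tendsto_intros t)
  moreover have "\<forall>\<^sub>F z in at 0. z * deriv k z - 2 * k z = z^3 * deriv q z"
    using ev by eventually_elim (simp add: q1 field_simps power2_eq_square power3_eq_cube)
  ultimately show "((\<lambda>z. z^3 * deriv q z) \<longlongrightarrow> - 2 * c) (at 0)"
    using Lim_transform_eventually k0 by fastforce
  have "((\<lambda>z. z * z * deriv (deriv k) z - 4 * z * deriv k z + 6 * k z) \<longlongrightarrow> 0 * 0 * deriv (deriv k) 0 - 4 * 0 * deriv k 0 + 6 * k 0) (at 0)"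
    by (intro tendsto_intros t)
  moreover have "\<forall>\<^sub>F z in at 0. z * z * deriv (deriv k) z - 4 * z * deriv k z + 6 * k z = z^4 * deriv (deriv q) z"
    using ev by eventually_elim (simp add: q2 field_simps power2_eq_square power3_eq_cube power4_eq_xxxx)
  ultimately show "((\<lambda>z. z^4 * deriv (deriv q) z) \<longlongrightarrow> 6 * c) (at 0)"
    using Lim_transform_eventually k0 by fastforce
qed

text \<open>The integral along segments is a primitive, and two complex linear forms with the same real part agree.\<close>

lemma weierstrass_primitive:
  fixes x :: "complex \<Rightarrow> real"
  assumes a: "a holomorphic_on ball z0 e"
    and x: "\<And>w. w \<in> ball z0 e \<Longrightarrow> x w = x z0 + Re (contour_integral (linepath z0 w) a)"
    and w: "w \<in> ball z0 e" and D: "(x has_derivative (\<lambda>h. Re (F * h))) (at w)"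
  shows "F = a w"
proof -
  obtain A where A: "\<And>v. v \<in> ball z0 e \<Longrightarrow> (A has_field_derivative a v) (at v within ball z0 e)"
    by (rule holomorphic_convex_primitive'[OF convex_ball open_ball a]) (rule that)
  have A': "(A has_field_derivative a v) (at v)" if "v \<in> ball z0 e" for v
    using A[OF that] by (simp only: at_within_open[OF that open_ball])
  have xe: "x v = x z0 + Re (A v - A z0)" if v: "v \<in> ball z0 e" for v
  proof -
    have "0 \<le> dist z0 v" by simp
    also have "dist z0 v < e" using v by simp
    finally have z0: "z0 \<in> ball z0 e" by simp
    have "path_image (linepath z0 v) \<subseteq> ball z0 e"
      using closed_segment_subset[OF z0 v convex_ball] by simp
    then have "(a has_contour_integral (A v - A z0)) (linepath z0 v)"
      using contour_integral_primitive[OF A, of "linepath z0 v"] by simp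
    then show ?thesis using x[OF v] by (simp add: contour_integral_unique)
  qed
  have "((\<lambda>v. Re (A v)) has_derivative (\<lambda>h. Re (a w * h))) (at w)"
    by (rule bounded_linear.has_derivative[OF bounded_linear_Re A'[OF w, unfolded has_field_derivative_def]])
  from has_derivative_add[OF this has_derivative_const[of "x z0 - Re (A z0)"]]
  have "((\<lambda>v. Re (A v) + (x z0 - Re (A z0))) has_derivative (\<lambda>h. Re (a w * h))) (at w)" by simp
  then have "(x has_derivative (\<lambda>h. Re (a w * h))) (at w)"
  proof (rule has_derivative_transform_within_open[OF _ open_ball w])
    show "Re (A v) + (x z0 - Re (A z0)) = x v" if "v \<in> ball z0 e" for v
      unfolding xe[OF that] by simp
  qed
  then have e: "(\<lambda>h. Re (F * h)) = (\<lambda>h. Re (a w * h))" by (rule has_derivative_unique[OF D])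
  show "F = a w" using fun_cong[OF e, of 1] fun_cong[OF e, of \<i>] by (simp add: complex_eq_iff)
qed

lemma weierstrass_chart:
  assumes W: "weierstrass_data \<Omega> x g f" and O: "open \<Omega>" and z0: "z0 \<in> \<Omega>" "\<not> is_pole g z0"
    and D: "\<And>z k. z \<in> \<Omega> \<Longrightarrow> ((\<lambda>z. x z $ k) has_derivative (\<lambda>h. Re (F z $ k * h))) (at z)"
  obtains e where "e > 0" "ball z0 e \<subseteq> \<Omega>" "g holomorphic_on ball z0 e" "f holomorphic_on ball z0 e"
    "\<And>z. z \<in> ball z0 e \<Longrightarrow> F z = vector [(1 - (g z)\<^sup>2) * f z, \<i> * (1 + (g z)\<^sup>2) * f z, 2 * g z * f z]"
proof -
  have "g analytic_on {z0}"
    using W z0 nicely_meromorphic_on_imp_analytic_at by (auto simp: weierstrass_data_def)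
  then obtain e1 where e1: "e1 > 0" "g holomorphic_on ball z0 e1" by (auto simp: analytic_on_def)
  obtain e2 where e2: "e2 > 0" "ball z0 e2 \<subseteq> \<Omega>" using O z0(1) openE by blast
  define e where "e = min e1 e2"
  have e: "e > 0" "ball z0 e \<subseteq> ball z0 e1" "ball z0 e \<subseteq> \<Omega>" using e1 e2 by (auto simp: e_def)
  have g: "g holomorphic_on ball z0 e" using e1(2) e(2) holomorphic_on_subset by blast
  have f: "f holomorphic_on ball z0 e" using W e(3) holomorphic_on_subset by (auto simp: weierstrass_data_def)
  have nopole: "\<not> is_pole g w" if "w \<in> ball z0 e" for w
    using not_is_pole_holomorphic[OF open_ball that g] .
  have path: "x w = x z0 + vector [Re (contour_integral (linepath z0 w) (\<lambda>z. (1 - (g z)\<^sup>2) * f z)),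
         Re (contour_integral (linepath z0 w) (\<lambda>z. \<i> * (1 + (g z)\<^sup>2) * f z)),
         Re (contour_integral (linepath z0 w) (\<lambda>z. 2 * g z * f z))]" if w: "w \<in> ball z0 e" for w
  proof -
    have "z0 \<in> ball z0 e" using e(1) by simp
    then have "path_image (linepath z0 w) \<subseteq> ball z0 e"
      using closed_segment_subset[OF _ w convex_ball] by simp
    then have "path_image (linepath z0 w) \<subseteq> \<Omega> - {z. is_pole g z}" using nopole e(3) by blast
    moreover have "\<And>p. valid_path p \<and> path_image p \<subseteq> \<Omega> - {z. is_pole g z} \<Longrightarrow>
        x (pathfinish p) = x (pathstart p) +
          vector [Re (contour_integral p (\<lambda>z. (1 - (g z)\<^sup>2) * f z)),
                  Re (contour_integral p (\<lambda>z. \<i> * (1 + (g z)\<^sup>2) * f z)),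
                  Re (contour_integral p (\<lambda>z. 2 * g z * f z))]"
      using W unfolding weierstrass_data_def by blast
    from this[of "linepath z0 w"] calculation show ?thesis by simp
  qed
  have comps: "x w $ 1 = x z0 $ 1 + Re (contour_integral (linepath z0 w) (\<lambda>z. (1 - (g z)\<^sup>2) * f z))"
    "x w $ 2 = x z0 $ 2 + Re (contour_integral (linepath z0 w) (\<lambda>z. \<i> * (1 + (g z)\<^sup>2) * f z))"
    "x w $ 3 = x z0 $ 3 + Re (contour_integral (linepath z0 w) (\<lambda>z. 2 * g z * f z))" if w: "w \<in> ball z0 e" for w
    unfolding path[OF w] by simp_all
  have hol: "(\<lambda>z. (1 - (g z)\<^sup>2) * f z) holomorphic_on ball z0 e"
    "(\<lambda>z. \<i> * (1 + (g z)\<^sup>2) * f z) holomorphic_on ball z0 e" "(\<lambda>z. 2 * g z * f z) holomorphic_on ball z0 e"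
    by (intro holomorphic_intros g f)+
  show thesis
  proof (rule that[OF e(1,3) g f])
    fix z assume z: "z \<in> ball z0 e"
    have zO: "z \<in> \<Omega>" using z e(3) by blast
    have "F z $ 1 = (1 - (g z)\<^sup>2) * f z"
      by (rule weierstrass_primitive[where x = "\<lambda>z. x z $ 1", OF hol(1) _ z D[OF zO]]) (rule comps)
    moreover have "F z $ 2 = \<i> * (1 + (g z)\<^sup>2) * f z"
      by (rule weierstrass_primitive[where x = "\<lambda>z. x z $ 2", OF hol(2) _ z D[OF zO]]) (rule comps)
    moreover have "F z $ 3 = 2 * g z * f z"
      by (rule weierstrass_primitive[where x = "\<lambda>z. x z $ 3", OF hol(3) _ z D[OF zO]]) (rule comps)
    ultimately show "F z = vector [(1 - (g z)\<^sup>2) * f z, \<i> * (1 + (g z)\<^sup>2) * f z, 2 * g z * f z]"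
      by (simp add: vec3_eq_iff)
  qed
qed

text \<open>The second identity is the relation of $p$ to the Schwarzian in a form without denominators.\<close>

lemma hopf_and_schwarzian_in_chart:
  assumes N: "null_data \<Omega> F q p" and O: "open \<Omega>" and z: "z \<in> \<Omega>"
    and g: "g holomorphic_on \<Omega>" and f: "f holomorphic_on \<Omega>"
    and F: "\<And>z. z \<in> \<Omega> \<Longrightarrow> F z = vector [(1 - (g z)\<^sup>2) * f z, \<i> * (1 + (g z)\<^sup>2) * f z, 2 * g z * f z]"
  shows "hopf_coeff g f z = q z"
    and "q z \<noteq> 0 \<Longrightarrow> 2 * p z * q z = schwarzian g z * (q z)\<^sup>2 - deriv (deriv q) z * q z + (3 / 2) * (deriv q z)\<^sup>2"
proof -
  note g' = holomorphic_deriv[OF g O] and f' = holomorphic_deriv[OF f O]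
  note g'' = holomorphic_deriv[OF g' O]
  note d = holomorphic_derivI[OF g O] holomorphic_derivI[OF f O]
    holomorphic_derivI[OF g' O] holomorphic_derivI[OF f' O] holomorphic_derivI[OF g'' O]
  have cd: "f w \<noteq> 0" "q w = f w * deriv g w"
      "4 * p w * f w = 2 * f w * (deriv (deriv g) w * deriv f w - deriv g w * deriv (deriv f) w) + 3 * deriv g w * (deriv f w)\<^sup>2"
    if "w \<in> \<Omega>" for w
    by (rule chart_data[OF O g f F N that]; assumption)+
  have "(\<lambda>z. f z * deriv g z) holomorphic_on \<Omega>" by (intro holomorphic_intros f g')
  then have "(\<lambda>z. f z * deriv g z) analytic_on {z}" using O z analytic_at by blast
  then show "hopf_coeff g f z = q z" using cd(2)[OF z] by (simp add: hopf_coeff_def)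
  assume qz: "q z \<noteq> 0"
  then have g1: "deriv g z \<noteq> 0" using cd(2)[OF z] by auto
  obtain e where e: "e > 0" "ball z e \<subseteq> \<Omega>" "\<And>w. w \<in> ball z e \<Longrightarrow> deriv g w \<noteq> 0"
    using ball_with_nonzero_values[OF g' O z g1] by blast
  have zb: "z \<in> ball z e" using e(1) by simp
  define h where "h = (\<lambda>z. deriv (deriv g) z / deriv g z)"
  have hh: "h holomorphic_on ball z e" unfolding h_def
    using e by (intro holomorphic_intros holomorphic_on_subset[OF g''] holomorphic_on_subset[OF g']) auto
  have "(\<lambda>z. deriv h z - (1 / 2) * (h z)\<^sup>2) holomorphic_on ball z e"
    by (intro holomorphic_intros hh holomorphic_deriv open_ball)
  then have "(\<lambda>z. deriv h z - (1 / 2) * (h z)\<^sup>2) analytic_on {z}" using zb analytic_at by blast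
  then have S: "schwarzian g z = deriv h z - (1 / 2) * (h z)\<^sup>2"
    unfolding schwarzian_def Let_def h_def[symmetric] by (rule remove_sings_at_analytic)
  define g2 g3 where "g2 = deriv (deriv g) z" and "g3 = deriv (deriv (deriv g)) z"
  have "(h has_field_derivative (g3 * deriv g z - g2 * g2) / (deriv g z * deriv g z)) (at z)"
    unfolding h_def g2_def g3_def by (rule DERIV_divide[OF d(5)[OF z] d(3)[OF z] g1])
  then have S': "schwarzian g z * (deriv g z)\<^sup>2 = g3 * deriv g z - (3 / 2) * g2\<^sup>2"
    using g1 unfolding S h_def g2_def g3_def
    by (simp add: DERIV_imp_deriv field_simps power2_eq_square)
  have dq: "(q has_field_derivative deriv f w * deriv g w + f w * deriv (deriv g) w) (at w)" if w: "w \<in> \<Omega>" for w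
  proof -
    have "((\<lambda>w. f w * deriv g w) has_field_derivative deriv f w * deriv g w + f w * deriv (deriv g) w) (at w)"
      by (rule derivative_eq_intros d(2)[OF w] d(3)[OF w] refl)+ (simp add: algebra_simps)
    then show ?thesis
      by (rule has_field_derivative_transform_within_open[OF _ O w]) (simp add: cd(2))
  qed
  have q1: "deriv q w = deriv f w * deriv g w + f w * deriv (deriv g) w" if "w \<in> \<Omega>" for w
    using dq[OF that] by (rule DERIV_imp_deriv)
  have "((\<lambda>w. deriv f w * deriv g w + f w * deriv (deriv g) w) has_field_derivative
      deriv (deriv f) z * deriv g z + 2 * deriv f z * g2 + f z * g3) (at z)"
    unfolding g2_def g3_def
    by (rule derivative_eq_intros d(2)[OF z] d(3)[OF z] d(4)[OF z] d(5)[OF z] refl)+ (simp add: algebra_simps)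
  then have "(deriv q has_field_derivative deriv (deriv f) z * deriv g z + 2 * deriv f z * g2 + f z * g3) (at z)"
    by (rule has_field_derivative_transform_within_open[OF _ O z]) (simp add: q1)
  then have q2: "deriv (deriv q) z = deriv (deriv f) z * deriv g z + 2 * deriv f z * g2 + f z * g3"
    by (rule DERIV_imp_deriv)
  note q1z = q1[OF z, folded g2_def] and q0z = cd(2)[OF z] and pz = cd(3)[OF z, folded g2_def]
  have A: "2 * p z * (f z * deriv g z) = (1 / 2) * deriv g z * (2 * f z * (g2 * deriv f z - deriv g z * deriv (deriv f) z) + 3 * deriv g z * (deriv f z)\<^sup>2)"
    unfolding pz[symmetric] by simp
  have B: "schwarzian g z * (f z * deriv g z)\<^sup>2 = (f z)\<^sup>2 * (g3 * deriv g z - (3 / 2) * g2\<^sup>2)"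
    unfolding S'[symmetric] by (simp add: power_mult_distrib)
  show "2 * p z * q z = schwarzian g z * (q z)\<^sup>2 - deriv (deriv q) z * q z + (3 / 2) * (deriv q z)\<^sup>2"
    unfolding q0z A B q1z q2 by (simp add: field_simps power2_eq_square)
qed

lemma asymptotic_to_double_pole:
  assumes "H \<sim>[F] (\<lambda>z. c / z\<^sup>2)" "c \<noteq> 0" "\<forall>\<^sub>F z in F. z \<noteq> 0"
  shows "((\<lambda>z. z\<^sup>2 * H z) \<longlongrightarrow> (c :: complex)) F"
proof -
  have "((\<lambda>z. c * (if H z = 0 \<and> c / z\<^sup>2 = 0 then 1 else H z / (c / z\<^sup>2))) \<longlongrightarrow> c * 1) F"
    by (intro tendsto_intros asymp_equivD[OF assms(1)])
  moreover have "\<forall>\<^sub>F z in F. c * (if H z = 0 \<and> c / z\<^sup>2 = 0 then 1 else H z / (c / z\<^sup>2)) = z\<^sup>2 * H z"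
    using assms(3) by eventually_elim (use assms(2) in simp)
  ultimately show ?thesis using Lim_transform_eventually by fastforce
qed

text \<open>The asymptotics hold along the upper half-plane away from the poles of the Gauss map.  They are first
  extended for $q$; then $q$ has an exact double pole, so the terms with derivatives of $q$ have known limits
  and the asymptotics of the Schwarzian yield those of $p$.\<close>

lemma helicoidal_end_asymptotics:
  assumes E: "has_helicoidal_end x D D' A \<alpha>"
    and N: "null_data upper_half F q p"
    and D: "\<And>z k. z \<in> upper_half \<Longrightarrow> ((\<lambda>z. x z $ k) has_derivative (\<lambda>h. Re (F z $ k * h))) (at z)"
    and r: "r > 0" and q: "q holomorphic_on ball 0 r - {0}" and p: "p holomorphic_on ball 0 r - {0}"
    and sym: "\<And>z. z \<in> ball 0 r - {0} \<Longrightarrow> q (cnj z) = - cnj (q z) \<and> p (cnj z) = - cnj (p z)"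
  defines "c \<equiv> \<i> * of_real (A * \<alpha> / (2 * pi))"
  shows "((\<lambda>z. z\<^sup>2 * q z) \<longlongrightarrow> c) (at 0)" "((\<lambda>z. z^4 * p z) \<longlongrightarrow> c * of_real ((1 - \<alpha>\<^sup>2) / 4)) (at 0)"
proof -
  obtain U g f where A: "A \<noteq> 0" "\<alpha> \<notin> \<int>" and U: "open U" "0 \<in> U"
    and W: "weierstrass_data {z \<in> U. Im z > 0} x g f"
    and h: "hopf_coeff g f \<sim>[at 0 within {z. Im z > 0}] (\<lambda>z. \<i> * of_real (A * \<alpha> / (2 * pi)) / z\<^sup>2)"
    and s: "schwarzian g \<sim>[at 0 within {z. Im z > 0}] (\<lambda>z. of_real ((1 - \<alpha>\<^sup>2) / 2) / z\<^sup>2)"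
    using E unfolding has_helicoidal_end_def helicoidal_end_bounded_on_def by blast
  have \<alpha>0: "\<alpha> \<noteq> 0" "\<alpha>\<^sup>2 \<noteq> 1"
  proof -
    have "0 \<in> \<int>" "1 \<in> \<int>" "- 1 \<in> (\<int> :: real set)" by auto
    then show "\<alpha> \<noteq> 0" "\<alpha>\<^sup>2 \<noteq> 1" using A(2) by (auto simp: power2_eq_1_iff)
  qed
  have c0: "c \<noteq> 0" using A(1) \<alpha>0 by (simp add: c_def)
  define S where "S = complex_of_real ((1 - \<alpha>\<^sup>2) / 2)"
  have S0: "S \<noteq> 0" unfolding S_def of_real_eq_0_iff using \<alpha>0(2) by simp
  define \<Omega> where "\<Omega> = {z \<in> U. Im z > 0}"
  have \<Omega>: "open \<Omega>" "\<Omega> \<subseteq> upper_half"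
  proof -
    have "\<Omega> = U \<inter> upper_half" by (auto simp: \<Omega>_def upper_half_def)
    then show "open \<Omega>" "\<Omega> \<subseteq> upper_half" using U(1) open_upper_half by auto
  qed
  obtain \<rho> where \<rho>: "\<rho> > 0" "ball 0 \<rho> \<subseteq> U" using U openE by blast
  define r' where "r' = min r \<rho>"
  have r': "r' > 0" "r' \<le> r" "ball 0 r' \<subseteq> U" using r \<rho> by (auto simp: r'_def)
  define X where "X = {z. is_pole g z}"
  have X: "\<forall>\<^sub>F w in at z. w \<notin> X" if "Im z > 0" "norm z < r'" for z
  proof -
    have "z \<in> \<Omega>" using that r'(3) by (auto simp: \<Omega>_def)
    then have "g meromorphic_on {z}"
      using W by (auto simp: weierstrass_data_def nicely_meromorphic_on_def \<Omega>_def intro: meromorphic_on_subset)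
    then show ?thesis
      unfolding X_def using eventually_not_pole[OF meromorphic_on_isolated_singularity] by simp
  qed
  have chart: "hopf_coeff g f z = q z \<and>
      (q z \<noteq> 0 \<longrightarrow> 2 * p z * q z = schwarzian g z * (q z)\<^sup>2 - deriv (deriv q) z * q z + (3 / 2) * (deriv q z)\<^sup>2)"
    if z: "z \<in> \<Omega>" "z \<notin> X" for z
  proof -
    have np: "\<not> is_pole g z" using z(2) by (simp add: X_def)
    have D': "((\<lambda>z. x z $ k) has_derivative (\<lambda>h. Re (F z $ k * h))) (at z)" if "z \<in> \<Omega>" for z k
      using D that \<Omega>(2) by blast
    obtain e where e: "e > 0" "ball z e \<subseteq> \<Omega>" "g holomorphic_on ball z e" "f holomorphic_on ball z e"
      and Fe: "\<And>w. w \<in> ball z e \<Longrightarrow> F w = vector [(1 - (g w)\<^sup>2) * f w, \<i> * (1 + (g w)\<^sup>2) * f w, 2 * g w * f w]"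
      by (rule weierstrass_chart[OF W[folded \<Omega>_def] \<Omega>(1) z(1) np D']) blast+
    have N': "null_data (ball z e) F q p"
      by (rule null_data_cong[OF N open_ball]) (use e(2) \<Omega>(2) in auto)
    have ze: "z \<in> ball z e" using e(1) by simp
    show ?thesis
      using hopf_and_schwarzian_in_chart[OF N' open_ball ze e(3,4) Fe] by blast
  qed
  have nz: "\<forall>\<^sub>F z in at 0 within {z. Im z > 0}. z \<noteq> 0" by (simp add: eventually_at_filter)
  note lh = asymptotic_to_double_pole[OF h[folded c_def] c0 nz] and ls = asymptotic_to_double_pole[OF s[folded S_def] S0 nz]
  have sub: "upper_half - X \<subseteq> {z. Im z > 0}" by (auto simp: upper_half_def)
  note lh' = tendsto_within_subset[OF lh sub] and ls' = tendsto_within_subset[OF ls sub]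
  have ev: "\<forall>\<^sub>F z in at 0 within upper_half - X. z \<in> \<Omega> \<and> z \<notin> X \<and> z \<noteq> 0"
  proof -
    have "\<forall>\<^sub>F z in nhds 0. z \<in> U" using U by (simp add: eventually_nhds_in_open)
    then show ?thesis unfolding eventually_at_filter by eventually_elim (auto simp: \<Omega>_def upper_half_def)
  qed
  have lq0: "((\<lambda>z. z\<^sup>2 * q z) \<longlongrightarrow> c) (at 0 within upper_half - X)"
    by (rule Lim_transform_eventually[OF lh']) (use ev in \<open>eventually_elim, use chart in auto\<close>)
  have subr: "ball 0 r' - {0} \<subseteq> ball 0 r - {0 :: complex}" using r'(2) by auto
  have ii: "\<i> * (y / \<i>) = y" for y by simp
  have lq: "((\<lambda>z. z\<^sup>2 * q z / \<i>) \<longlongrightarrow> c / \<i>) (at 0)"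
  proof (rule symmetric_limit[OF r'(1)])
    show "continuous_on (ball 0 r' - {0}) (\<lambda>z. z\<^sup>2 * q z / \<i>)"
      by (intro continuous_intros holomorphic_on_imp_continuous_on holomorphic_on_subset[OF q subr]) auto
    show "(cnj z)\<^sup>2 * q (cnj z) / \<i> = cnj (z\<^sup>2 * q z / \<i>)" if "z \<in> ball 0 r' - {0}" for z
      using sym[of z] that subr by auto
    show "cnj (c / \<i>) = c / \<i>" by (simp add: c_def)
    show "((\<lambda>z. z\<^sup>2 * q z / \<i>) \<longlongrightarrow> c / \<i>) (at 0 within upper_half - X)" by (intro tendsto_intros lq0) simp
  qed (rule X)
  show lq1: "((\<lambda>z. z\<^sup>2 * q z) \<longlongrightarrow> c) (at 0)"
    using tendsto_mult_left[OF lq, of \<i>] by (simp only: ii)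
  note dl = double_pole_derivative_limits[OF r q lq1]
  note dl' = tendsto_within_subset[OF dl(1) subset_UNIV, of "upper_half - X"] tendsto_within_subset[OF dl(2) subset_UNIV, of "upper_half - X"]
  have L: "((\<lambda>z. ((z\<^sup>2 * schwarzian g z) * (z\<^sup>2 * q z)\<^sup>2 - (z^4 * deriv (deriv q) z) * (z\<^sup>2 * q z)
       + (3 / 2) * (z^3 * deriv q z)\<^sup>2) / (2 * (z\<^sup>2 * q z))) \<longlongrightarrow>
     (S * c\<^sup>2 - (6 * c) * c + (3 / 2) * (- 2 * c)\<^sup>2) / (2 * c)) (at 0 within upper_half - X)"
    by (intro tendsto_intros ls' lq0 dl') (use c0 in simp)
  have V: "(S * c\<^sup>2 - (6 * c) * c + (3 / 2) * (- 2 * c)\<^sup>2) / (2 * c) = c * of_real ((1 - \<alpha>\<^sup>2) / 4)"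
    using c0 by (simp add: S_def field_simps power2_eq_square)
  have E: "\<forall>\<^sub>F z in at 0 within upper_half - X.
      ((z\<^sup>2 * schwarzian g z) * (z\<^sup>2 * q z)\<^sup>2 - (z^4 * deriv (deriv q) z) * (z\<^sup>2 * q z)
       + (3 / 2) * (z^3 * deriv q z)\<^sup>2) / (2 * (z\<^sup>2 * q z)) = z^4 * p z"
    using ev tendsto_imp_eventually_ne[OF lq0 c0]
  proof eventually_elim
    case (elim z)
    then have z: "z \<in> \<Omega>" "z \<notin> X" "z \<noteq> 0" "q z \<noteq> 0" by auto
    have "(z\<^sup>2 * schwarzian g z) * (z\<^sup>2 * q z)\<^sup>2 - (z^4 * deriv (deriv q) z) * (z\<^sup>2 * q z) + (3 / 2) * (z^3 * deriv q z)\<^sup>2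
       = z^6 * (schwarzian g z * (q z)\<^sup>2 - deriv (deriv q) z * q z + (3 / 2) * (deriv q z)\<^sup>2)"
      by (simp add: algebra_simps eval_nat_numeral)
    also have "\<dots> = z^6 * (2 * p z * q z)" using chart[OF z(1,2)] z(4) by simp
    also have "\<dots> = (z^4 * p z) * (2 * (z\<^sup>2 * q z))" by (simp add: eval_nat_numeral)
    finally show ?case using z by simp
  qed
  have lp0: "((\<lambda>z. z^4 * p z) \<longlongrightarrow> c * of_real ((1 - \<alpha>\<^sup>2) / 4)) (at 0 within upper_half - X)"
    by (rule Lim_transform_eventually[OF L[unfolded V] E])
  have lp: "((\<lambda>z. z^4 * p z / \<i>) \<longlongrightarrow> c * of_real ((1 - \<alpha>\<^sup>2) / 4) / \<i>) (at 0)"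
  proof (rule symmetric_limit[OF r'(1)])
    show "continuous_on (ball 0 r' - {0}) (\<lambda>z. z^4 * p z / \<i>)"
      by (intro continuous_intros holomorphic_on_imp_continuous_on holomorphic_on_subset[OF p subr]) auto
    show "(cnj z)^4 * p (cnj z) / \<i> = cnj (z^4 * p z / \<i>)" if "z \<in> ball 0 r' - {0}" for z
      using sym[of z] that subr by auto
    show "cnj (c * of_real ((1 - \<alpha>\<^sup>2) / 4) / \<i>) = c * of_real ((1 - \<alpha>\<^sup>2) / 4) / \<i>" by (simp add: c_def)
    show "((\<lambda>z. z^4 * p z / \<i>) \<longlongrightarrow> c * of_real ((1 - \<alpha>\<^sup>2) / 4) / \<i>) (at 0 within upper_half - X)"
      by (intro tendsto_intros lp0) simp
  qed (rule X)
  show "((\<lambda>z. z^4 * p z) \<longlongrightarrow> c * of_real ((1 - \<alpha>\<^sup>2) / 4)) (at 0)"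
    using tendsto_mult_left[OF lp, of \<i>] by (simp only: ii)
qed

section \<open>Boundary arcs and changes of coordinate\<close>

text \<open>Along the arc $x_u$ is parallel to the line, and conformality makes $x_v$ orthogonal to it.\<close>

lemma boundary_symmetric_dz_form:
  assumes x: "conformal_minimal_immersion Sigma01 x" and I: "open I" "0 \<notin> I" "1 \<notin> I"
    and D: "\<And>t. t \<in> I \<Longrightarrow> x (of_real t) \<in> points D" and u: "norm (dir D) = 1"
  shows "boundary_symmetric I (dir D) (dz_form Sigma01 x)"
  unfolding boundary_symmetric_def
proof
  fix t assume t: "t \<in> I"
  define u where "u = dir D"
  define z where "z = complex_of_real t"
  have IS: "complex_of_real ` I \<subseteq> Sigma01" using I(2,3) by (auto simp: Sigma01_def)
  then have zS: "z \<in> Sigma01" using t by (auto simp: z_def)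
  have uu: "u \<bullet> u = 1" using u by (simp add: u_def norm_eq_1)
  have "Ck_on (Suc 0) Sigma01 x" using x unfolding conformal_minimal_immersion_def smooth_on_def by blast
  then have "(x has_derivative frechet_derivative x (at z within Sigma01)) (at z within Sigma01)"
    using zS by (simp add: differentiable_on_def frechet_derivative_works)
  then have "(x has_derivative frechet_derivative x (at z within Sigma01)) (at (of_real t) within complex_of_real ` I)"
    using has_derivative_subset[OF _ IS] unfolding z_def by blast
  then have "((\<lambda>s. x (of_real s)) has_derivative (\<lambda>h. frechet_derivative x (at z within Sigma01) (of_real h))) (at t within I)"
    by (rule has_derivative_in_compose[rotated]) (auto intro!: derivative_eq_intros)
  then have y: "((\<lambda>s. x (of_real s)) has_derivative (\<lambda>h. frechet_derivative x (at z within Sigma01) (of_real h))) (at t)"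
    using at_within_open[OF t I(1)] by simp
  define P R where "P = du Sigma01 x z" and "R = dv Sigma01 x z"
  have Pk: "P $ k = (P \<bullet> u) * u $ k" for k
  proof -
    have d0: "((\<lambda>s. x (of_real s) $ k - (x (of_real s) \<bullet> u) * u $ k) has_derivative
       (\<lambda>h. frechet_derivative x (at z within Sigma01) (of_real h) $ k
          - (frechet_derivative x (at z within Sigma01) (of_real h) \<bullet> u) * u $ k)) (at t)"
      by (intro has_derivative_diff has_derivative_mult_left bounded_linear.has_derivative[OF bounded_linear_vec_nth y]
          bounded_linear.has_derivative[OF bounded_linear_inner_left y])
    have ck: "x (of_real s) $ k - (x (of_real s) \<bullet> u) * u $ k = base D $ k - (base D \<bullet> u) * u $ k" if s: "s \<in> I" for s
    proof -
      obtain \<tau> where "x (of_real s) = base D + \<tau> *\<^sub>R u" using D[OF s] by (auto simp: points_def u_def)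
      then show ?thesis using uu by (simp add: inner_add_left algebra_simps)
    qed
    have "((\<lambda>s. base D $ k - (base D \<bullet> u) * u $ k) has_derivative
       (\<lambda>h. frechet_derivative x (at z within Sigma01) (of_real h) $ k
          - (frechet_derivative x (at z within Sigma01) (of_real h) \<bullet> u) * u $ k)) (at t)"
      by (rule has_derivative_transform_within_open[OF d0 I(1) t]) (rule ck)
    from has_derivative_unique[OF this has_derivative_const]
    have "frechet_derivative x (at z within Sigma01) (of_real 1) $ k
          - (frechet_derivative x (at z within Sigma01) (of_real 1) \<bullet> u) * u $ k = 0" by (rule fun_cong)
    then show ?thesis by (simp add: P_def partial_on_def)
  qed
  have c: "P \<bullet> R = 0" "P \<noteq> 0"
    using x zS by (auto simp: conformal_minimal_immersion_def conformal_immersion_at_def P_def R_def)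
  have Pu: "P = (P \<bullet> u) *\<^sub>R u" using Pk by (simp add: vec_eq_iff)
  then have "P \<bullet> u \<noteq> 0" using c(2) by (metis scaleR_zero_left)
  moreover have "(P \<bullet> u) * (u \<bullet> R) = 0" using c(1) Pu by (metis inner_scaleR_left)
  ultimately have Ru: "u \<bullet> R = 0" by simp
  then have R0: "u$1 * R$1 + u$2 * R$2 + u$3 * R$3 = 0" by (simp add: inner_vec_def sum_3)
  have P0: "u$1 * P$1 + u$2 * P$2 + u$3 * P$3 = P \<bullet> u" by (simp add: inner_vec_def sum_3 mult.commute)
  have "half_turn u (vcnj (dz_form Sigma01 x z)) $ k = dz_form Sigma01 x z $ k" for k
  proof -
    have "of_real (u$1) * vcnj (dz_form Sigma01 x z) $ 1 + of_real (u$2) * vcnj (dz_form Sigma01 x z) $ 2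
        + of_real (u$3) * vcnj (dz_form Sigma01 x z) $ 3 = of_real (P \<bullet> u)"
      using R0 P0 by (simp add: dz_form_def complex_eq_iff flip: P_def R_def)
    then show ?thesis
      unfolding half_turn_nth using Pk[of k] by (simp add: dz_form_def complex_eq_iff flip: P_def R_def)
  qed
  then show "half_turn (dir D) (vcnj (dz_form Sigma01 x (of_real t))) = dz_form Sigma01 x (of_real t)"
    by (simp add: vec_eq_iff u_def z_def)
qed

lemma upper_half_Sigma01: "upper_half \<subseteq> Sigma01"
  by (auto simp: upper_half_def Sigma01_def)

lemma reflected_null_curve_dz_form:
  assumes x: "conformal_minimal_immersion Sigma01 x"
    and sym: "boundary_symmetric (side j) u (dz_form Sigma01 x)" and u: "norm u = 1"
  shows "null_curve (slit_plane (side j)) (reflected u (dz_form Sigma01 x))"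
proof (rule null_curve_reflected[OF side_simps(1) _ _ sym u])
  have sub: "slit_plane (side j) \<inter> {z. 0 \<le> Im z} \<subseteq> Sigma01"
    using slit_plane_side_subset[of j] by (auto simp: Sigma01_def)
  show "vholo (dz_form Sigma01 x) upper_half"
    using dz_form_null_curve[OF x open_upper_half upper_half_Sigma01] by (simp add: null_curve_def)
  show "continuous_on (slit_plane (side j) \<inter> {z. 0 \<le> Im z}) (\<lambda>z. dz_form Sigma01 x z $ k)" for k
    by (rule continuous_on_subset[OF dz_form_continuous[OF x] sub])
  show "dz_form Sigma01 x z \<noteq> 0 \<and> cdot (dz_form Sigma01 x z) (dz_form Sigma01 x z) = 0"
    if "z \<in> slit_plane (side j)" "0 \<le> Im z" for z
  proof -
    have "conformal_immersion_at Sigma01 x z" using x sub that by (auto simp: conformal_minimal_immersion_def)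
    then show ?thesis using dz_form_null by blast
  qed
qed

lemma dz_form_derivative:
  assumes x: "conformal_minimal_immersion Sigma01 x" and z: "z \<in> upper_half"
  shows "((\<lambda>z. x z $ k) has_derivative (\<lambda>h. Re (dz_form Sigma01 x z $ k * h))) (at z)"
proof -
  have "Ck_on (Suc 0) Sigma01 x" using x unfolding conformal_minimal_immersion_def smooth_on_def by blast
  then have "x differentiable_on Sigma01" by simp
  from partial_on_has_derivative[OF this open_upper_half upper_half_Sigma01 z]
  have "((\<lambda>z. x z $ k) has_derivative (\<lambda>h. (Re h *\<^sub>R du Sigma01 x z + Im h *\<^sub>R dv Sigma01 x z) $ k)) (at z)"
    by (rule bounded_linear.has_derivative[OF bounded_linear_vec_nth])
  moreover have "(\<lambda>h. (Re h *\<^sub>R du Sigma01 x z + Im h *\<^sub>R dv Sigma01 x z) $ k) = (\<lambda>h. Re (dz_form Sigma01 x z $ k * h))"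
    by (auto simp: dz_form_def fun_eq_iff algebra_simps)
  ultimately show ?thesis by simp
qed

lemma null_data_translate:
  assumes N: "null_data upper_half F q p"
  shows "null_data upper_half (\<lambda>w. F (1 + w)) (\<lambda>w. q (1 + w)) (\<lambda>w. p (1 + w))"
proof -
  have F: "vholo F upper_half" and q: "q holomorphic_on upper_half" and p: "p holomorphic_on upper_half"
    using N by (auto simp: null_data_def null_curve_def)
  note O = open_upper_half
  have up: "1 + w \<in> upper_half" if "w \<in> upper_half" for w using that by (simp add: upper_half_def)
  have sh: "((\<lambda>w. f (1 + w)) has_field_derivative D) (at w)" if "(f has_field_derivative D) (at (1 + w))"
    for f :: "complex \<Rightarrow> complex" and D w
    using DERIV_shift[of f D w 1] that by (simp add: add.commute)
  note d = sh[OF has_field_derivative_vderiv[OF F O up]] sh[OF has_field_derivative_vderiv[OF vholo_vderiv[OF F O] O up]]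
  have hol: "(\<lambda>w. f (1 + w)) holomorphic_on upper_half" if "f holomorphic_on upper_half" for f
    using sh[OF holomorphic_derivI[OF that O up]] O by (meson holomorphic_on_open)
  show ?thesis
    unfolding null_data_def null_curve_def vholo_def
  proof (intro conjI ballI allI hol q p vholo_nth[OF F])
    fix z assume z: "z \<in> upper_half"
    show "F (1 + z) \<noteq> 0" "cdot (F (1 + z)) (F (1 + z)) = 0"
      using N up[OF z] by (auto simp: null_data_def null_curve_def)
    have jets: "vderiv (\<lambda>w. F (1 + w)) z = vderiv F (1 + z)"
      "vderiv (vderiv (\<lambda>w. F (1 + w))) z = vderiv (vderiv F) (1 + z)"
      by (rule jets_of_components[where D = "\<lambda>w. vderiv F (1 + w)" and E = "\<lambda>w. vderiv (vderiv F) (1 + w)", OF O d z]; assumption)+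
    have "deriv (\<lambda>w. q (1 + w)) z = deriv q (1 + z)"
      by (rule DERIV_imp_deriv[OF sh[OF holomorphic_derivI[OF q O up[OF z]]]])
    then show "jet_data (F (1 + z)) (vderiv (\<lambda>w. F (1 + w)) z) (vderiv (vderiv (\<lambda>w. F (1 + w))) z) (q (1 + z))
        (deriv (\<lambda>w. q (1 + w)) z) (p (1 + z))"
      unfolding jets using N up[OF z] by (simp add: null_data_def)
  qed
qed

text \<open>The transformation under $z = -1/w$, with $t = 1/w$.  The quadratic differential $q$ acquires the factor
  $t^4$; the lower terms in $p$ come from the derivatives of the weight $t^2$.\<close>

lemma jet_data_invert:
  assumes J: "jet_data a b c q q' p" and ac: "ccross a c = (2*\<i>) *s (q' *s a + q *s b)" and t: "t = 1 / w" "w \<noteq> (0::complex)"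
  shows "jet_data (t^2 *s a) (t^4 *s b - (2 * t^3) *s a) (t^6 *s c - (6 * t^5) *s b + (6 * t^4) *s a)
    (t^4 * q) (t^6 * q' - 4 * t^5 * q) (t^8 * p - t^7 * q' + 2 * t^6 * q)"
proof -
  have ab: "ccross a b = (2*\<i>*q) *s a" and bc: "ccross b c = (2*\<i>) *s (q *s c - q' *s b + (4 * p) *s a)"
    using J by (auto simp: jet_data_def)
  have 1: "ccross (t^2 *s a) (t^4 *s b - (2 * t^3) *s a) = t^6 *s ccross a b"
    by (simp add: vec3_eq_iff algebra_simps eval_nat_numeral)
  have 2: "ccross (t^4 *s b - (2 * t^3) *s a) (t^6 *s c - (6 * t^5) *s b + (6 * t^4) *s a)
     = t^10 *s ccross b c - (2 * t^9) *s ccross a c + (6 * t^8) *s ccross a b"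
    by (simp add: vec3_eq_iff algebra_simps eval_nat_numeral)
  show ?thesis
    unfolding jet_data_def 1 2 ab ac bc
    by (simp add: vec3_eq_iff algebra_simps eval_nat_numeral)
qed

lemma upper_half_inversion: "w \<in> upper_half \<Longrightarrow> - 1 / w \<in> upper_half" "w \<in> upper_half \<Longrightarrow> w \<noteq> 0"
proof -
  assume w: "w \<in> upper_half"
  then show "w \<noteq> 0" by (auto simp: upper_half_def)
  have "(Re w)\<^sup>2 + (Im w)\<^sup>2 > 0" using w by (simp add: upper_half_def sum_power2_gt_zero_iff)
  then show "- 1 / w \<in> upper_half" using w by (simp add: upper_half_def Im_divide)
qed

lemma null_data_invert:
  assumes N: "null_data upper_half F q p"
  shows "null_data upper_half (\<lambda>w. (1 / w)^2 *s F (- 1 / w)) (\<lambda>w. (1 / w)^4 * q (- 1 / w))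
    (\<lambda>w. (1 / w)^8 * p (- 1 / w) - (1 / w)^7 * deriv q (- 1 / w) + 2 * (1 / w)^6 * q (- 1 / w))"
proof -
  have F: "vholo F upper_half" and q: "q holomorphic_on upper_half" and p: "p holomorphic_on upper_half"
    using N by (auto simp: null_data_def null_curve_def)
  note O = open_upper_half
  note up = upper_half_inversion
  have inv: "((\<lambda>w. - 1 / w) has_field_derivative (1 / w)^2) (at w)" "((\<lambda>w. 1 / w) has_field_derivative - ((1 / w)^2)) (at w)"
    if "w \<noteq> 0" for w :: complex
    using that by (auto intro!: derivative_eq_intros simp: power2_eq_square field_simps)
  have ch: "((\<lambda>w. f (- 1 / w)) has_field_derivative D * (1 / w)^2) (at w)"
    if "(f has_field_derivative D) (at (- 1 / w))" "w \<noteq> 0" for f :: "complex \<Rightarrow> complex" and D w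
    using DERIV_chain2[OF that(1) inv(1)[OF that(2)]] .
  note dF = ch[OF has_field_derivative_vderiv[OF F O up(1)] up(2)]
    ch[OF has_field_derivative_vderiv[OF vholo_vderiv[OF F O] O up(1)] up(2)]
  note dq = ch[OF holomorphic_derivI[OF q O up(1)] up(2)]
  define G where "G w = (1 / w)^2 *s F (- 1 / w)" for w
  define D where "D w = (1 / w)^4 *s vderiv F (- 1 / w) - (2 * (1 / w)^3) *s F (- 1 / w)" for w
  define E where "E w = (1 / w)^6 *s vderiv (vderiv F) (- 1 / w) - (6 * (1 / w)^5) *s vderiv F (- 1 / w)
     + (6 * (1 / w)^4) *s F (- 1 / w)" for w
  define Q where "Q w = (1 / w)^4 * q (- 1 / w)" for w
  have 1: "((\<lambda>w. G w $ k) has_field_derivative D w $ k) (at w)" if w: "w \<in> upper_half" for w k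
    unfolding G_def D_def vector_smult_component vector_minus_component
    by (rule derivative_eq_intros dF[OF w w] inv(2)[OF up(2)[OF w]] refl)+
      (simp add: algebra_simps eval_nat_numeral)
  have 2: "((\<lambda>w. D w $ k) has_field_derivative E w $ k) (at w)" if w: "w \<in> upper_half" for w k
    unfolding D_def E_def vector_smult_component vector_minus_component vector_add_component
    by (rule derivative_eq_intros dF[OF w w] inv(2)[OF up(2)[OF w]] refl)+
      (simp add: algebra_simps eval_nat_numeral)
  have Q': "(Q has_field_derivative (1 / w)^6 * deriv q (- 1 / w) - 4 * (1 / w)^5 * q (- 1 / w)) (at w)" if w: "w \<in> upper_half" for w
    unfolding Q_def
    by (rule derivative_eq_intros dq[OF w w] inv(2)[OF up(2)[OF w]] refl)+
      (simp add: algebra_simps eval_nat_numeral)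
  have hol: "(\<lambda>w. f (- 1 / w)) holomorphic_on upper_half" if "f holomorphic_on upper_half" for f
    using ch[OF holomorphic_derivI[OF that O up(1)] up(2)] O by (meson holomorphic_on_open)
  have "null_data upper_half G Q
    (\<lambda>w. (1 / w)^8 * p (- 1 / w) - (1 / w)^7 * deriv q (- 1 / w) + 2 * (1 / w)^6 * q (- 1 / w))"
    unfolding null_data_def null_curve_def vholo_def
  proof (intro conjI ballI allI)
    show "(\<lambda>w. G w $ k) holomorphic_on upper_half" for k using 1 O by (meson holomorphic_on_open)
    show "Q holomorphic_on upper_half" using Q' O by (meson holomorphic_on_open)
    show "(\<lambda>w. (1 / w)^8 * p (- 1 / w) - (1 / w)^7 * deriv q (- 1 / w) + 2 * (1 / w)^6 * q (- 1 / w)) holomorphic_on upper_half"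
      by (intro holomorphic_intros hol p q holomorphic_deriv O) (use up(2) in auto)
    fix w assume w: "w \<in> upper_half"
    note w0 = up(2)[OF w] and w1 = up(1)[OF w]
    have n: "F (- 1 / w) \<noteq> 0" "cdot (F (- 1 / w)) (F (- 1 / w)) = 0"
      and j: "jet_data (F (- 1 / w)) (vderiv F (- 1 / w)) (vderiv (vderiv F) (- 1 / w)) (q (- 1 / w)) (deriv q (- 1 / w)) (p (- 1 / w))"
      using N w1 by (auto simp: null_data_def null_curve_def)
    show "G w \<noteq> 0" using n(1) w0 by (auto simp: G_def vec_eq_iff)
    show "cdot (G w) (G w) = 0"
    proof -
      have "cdot (G w) (G w) = (1 / w)^4 * cdot (F (- 1 / w)) (F (- 1 / w))"
        by (simp add: cdot_def G_def algebra_simps eval_nat_numeral)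
      then show ?thesis using n(2) by simp
    qed
    have jets: "vderiv G w = D w" "vderiv (vderiv G) w = E w"
      by (rule jets_of_components[where F = G and D = D and E = E, OF O 1 2 w]; assumption)+
    have ac: "ccross (F (- 1 / w)) (vderiv (vderiv F) (- 1 / w))
        = (2*\<i>) *s (deriv q (- 1 / w) *s F (- 1 / w) + q (- 1 / w) *s vderiv F (- 1 / w))"
      by (rule differentiated_cross_relation[OF F O q _ w1]) (use N in \<open>auto simp: null_data_def jet_data_def\<close>)
    show "jet_data (G w) (vderiv G w) (vderiv (vderiv G) w) (Q w) (deriv Q w)
       ((1 / w)^8 * p (- 1 / w) - (1 / w)^7 * deriv q (- 1 / w) + 2 * (1 / w)^6 * q (- 1 / w))"
      unfolding jets DERIV_imp_deriv[OF Q'[OF w]] G_def D_def E_def Q_def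
      using jet_data_invert[OF j ac refl w0] by (simp add: mult.assoc)
  qed
  then show ?thesis by (simp add: G_def[abs_def] Q_def[abs_def])
qed

section \<open>The numerator of an immersion and the final count\<close>

text \<open>The factor $i/(2\pi)$ in the normalization of the Hopf differential.\<close>

definition unit_coeff :: complex where "unit_coeff = \<i> * of_real (1 / (2 * pi))"

text \<open>The quadratic polynomial with values $a$ at $0$ and $c$ at $1$ and leading coefficient $b$.\<close>

definition hopf_numerator :: "real \<Rightarrow> real \<Rightarrow> real \<Rightarrow> complex poly" where
  "hopf_numerator a b c = [:of_real a, of_real (c - a - b), of_real b:]"

definition prescribed_numerators :: "real \<times> real \<Rightarrow> real \<times> real \<Rightarrow> real \<times> real \<Rightarrow> complex poly set" where
  "prescribed_numerators p0 pinf p1 = (case (p0, pinf, p1) of ((A, \<alpha>), (B, \<beta>), (C, \<gamma>)) \<Rightarrow>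
     admissible_numerators (hopf_numerator (A * \<alpha>) (B * \<beta>) (C * \<gamma>))
       (of_real (A * \<alpha> * (1 - \<alpha>\<^sup>2) / 4)) (of_real (C * \<gamma> * (1 - \<gamma>\<^sup>2) / 4)) (of_real (B * \<beta> * (1 - \<beta>\<^sup>2) / 4)))"

lemma poly_cusp_poly: "poly cusp_poly z = z\<^sup>2 * (z - 1)\<^sup>2"
  by (simp add: cusp_poly_def algebra_simps power2_eq_square)

lemma poly_cusp_poly_eq_0_iff: "poly cusp_poly z = 0 \<longleftrightarrow> z \<in> {0, 1}"
  by (auto simp: poly_cusp_poly)

text \<open>The equation for the spinor component is multiplied by $h^2$.\<close>

lemma log_free_of_null_data:
  assumes N: "null_data \<Omega> F q p" and O: "open \<Omega>" and a: "a \<in> \<Omega>" and \<Omega>: "\<Omega> \<subseteq> - {0, 1}" and k: "k \<noteq> 0"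
    and q: "\<And>z. z \<in> \<Omega> \<Longrightarrow> q z = k * poly P z / poly cusp_poly z"
    and p: "\<And>z. z \<in> \<Omega> \<Longrightarrow> p z = k * poly R z / (poly cusp_poly z)\<^sup>2"
  shows "log_free P R a"
proof -
  obtain e s where e: "e > 0" "ball a e \<subseteq> \<Omega>" "s holomorphic_on ball a e" "s a \<noteq> 0"
    and ode: "\<And>z. z \<in> ball a e \<Longrightarrow> q z * deriv (deriv s) z - deriv q z * deriv s z + p z * s z = 0"
    using solution_near_point[OF N O a] by blast
  have "poly (cusp_poly * P) z * deriv (deriv s) z
        - poly (cusp_poly * pderiv P - pderiv cusp_poly * P) z * deriv s z + poly R z * s z = 0"
    if z: "z \<in> ball a e" for z
  proof -
    define h h' where "h = poly cusp_poly z" and "h' = poly (pderiv cusp_poly) z"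
    have zO: "z \<in> \<Omega>" using z e(2) by blast
    have h0: "h \<noteq> 0" using zO \<Omega> by (auto simp: h_def poly_cusp_poly_eq_0_iff)
    have "((\<lambda>z. k * poly P z / poly cusp_poly z) has_field_derivative
        (k * poly (pderiv P) z * h - k * poly P z * h') / (h * h)) (at z)"
      unfolding h_def h'_def
      by (rule DERIV_divide[OF DERIV_cmult[OF poly_DERIV] poly_DERIV]) (use h0 in \<open>simp add: h_def\<close>)
    then have "(q has_field_derivative (k * poly (pderiv P) z * h - k * poly P z * h') / (h * h)) (at z)"
      by (rule has_field_derivative_transform_within_open[OF _ O zO]) (simp add: q)
    then have dq: "deriv q z = (k * poly (pderiv P) z * h - k * poly P z * h') / (h * h)" by (rule DERIV_imp_deriv)
    have "0 = (q z * deriv (deriv s) z - deriv q z * deriv s z + p z * s z) * (h * h)"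
      using ode[OF z] by simp
    also have "\<dots> = k * (h * poly P z * deriv (deriv s) z - (poly (pderiv P) z * h - poly P z * h') * deriv s z + poly R z * s z)"
      using h0 unfolding q[OF zO] p[OF zO] dq h_def[symmetric] by (simp add: field_simps power2_eq_square)
    finally have "h * poly P z * deriv (deriv s) z - (poly (pderiv P) z * h - poly P z * h') * deriv s z + poly R z * s z = 0"
      using k by simp
    then show ?thesis by (simp add: h_def h'_def algebra_simps)
  qed
  then show ?thesis unfolding log_free_def using e by blast
qed

lemma quadratic_poly_eq:
  fixes P :: "complex poly"
  assumes "degree P \<le> 2" "coeff P 2 = of_real b" "poly P 0 = of_real a" "poly P 1 = of_real c"
  shows "P = hopf_numerator a b c"
proof -
  have P: "P = [:coeff P 0, coeff P 1, coeff P 2:]"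
  proof (rule poly_eqI)
    fix n show "coeff P n = coeff [:coeff P 0, coeff P 1, coeff P 2:] n"
      using assms(1) coeff_eq_0[of P n] by (auto simp: coeff_pCons eval_nat_numeral split: nat.split)
  qed
  have "coeff P 0 = of_real a" using assms(3) by (simp add: poly_0_coeff_0)
  moreover have "coeff P 0 + coeff P 1 + coeff P 2 = of_real c"
    using assms(4) by (subst (asm) P) (simp add: algebra_simps)
  ultimately show ?thesis using assms(2) P unfolding hopf_numerator_def
    by (metis add_diff_cancel_left' diff_diff_add of_real_diff add.commute)
qed

text \<open>The limits at the three ends are read in the coordinates $z$, $z - 1$ and $-1/z$.  At infinity the two
  corrections in the transformation of $p$ have cancelling limits, so that the leading coefficient of $N$
  obeys the same rule as its values at $0$ and $1$.\<close>

lemma bounded_immersion_numerator: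
  fixes u :: "nat \<Rightarrow> real^3"
  assumes x: "conformal_minimal_immersion Sigma01 x"
    and b: "bounded_with_helicoidal_ends x E1 E2 E3 (A, \<alpha>) (B, \<beta>) (C, \<gamma>)"
    and u: "u = (\<lambda>j. if j = 0 then dir E1 else if j = 1 then dir E2 else dir E3)"
    and unit: "\<And>j. norm (u j) = 1"
  defines "F \<equiv> dz_form Sigma01 x" and "P \<equiv> hopf_numerator (A * \<alpha>) (B * \<beta>) (C * \<gamma>)"
  obtains N where "N \<in> prescribed_numerators (A, \<alpha>) (B, \<beta>) (C, \<gamma>)"
    "null_data upper_half F (\<lambda>z. unit_coeff * poly P z / poly cusp_poly z) (\<lambda>z. unit_coeff * poly N z / (poly cusp_poly z)\<^sup>2)"
    "\<And>j. vholo (reflected (u j) F) (slit_plane (side j))"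
proof -
  let ?k = unit_coeff
  have k0: "?k \<noteq> 0" by (simp add: unit_coeff_def)
  have on_line: "x (of_real t) \<in> points (if j = 0 then E1 else if j = 1 then E2 else E3)" if "t \<in> side j" for t j
    using b that unfolding bounded_with_helicoidal_ends_def side_def by (auto split: if_splits)
  have sym: "boundary_symmetric (side j) (u j) F" for j
  proof -
    have "u j = dir (if j = 0 then E1 else if j = 1 then E2 else E3)" by (simp add: u)
    then show ?thesis
      using boundary_symmetric_dz_form[OF x side_simps(1,4,5) on_line] unit[of j] by (simp add: F_def)
  qed
  have null: "null_curve (slit_plane (side j)) (reflected (u j) F)" for j
    unfolding F_def by (rule reflected_null_curve_dz_form[OF x sym[unfolded F_def] unit])
  obtain q p where q: "q holomorphic_on - {0, 1}" and p: "p holomorphic_on - {0, 1}"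
    and qps: "\<And>z. z \<notin> {0, 1} \<Longrightarrow> q (cnj z) = - cnj (q z) \<and> p (cnj z) = - cnj (p z)"
    and nd: "\<And>j. j < 3 \<Longrightarrow> null_data (slit_plane (side j)) (reflected (u j) F) q p"
    by (rule glued_null_data[OF unit sym null]) (rule that)
  have N: "null_data upper_half F q p"
    by (rule null_data_cong[OF nd[of 0] open_upper_half upper_half_subset]) (auto simp: reflected_def upper_half_def)
  have D: "((\<lambda>z. x z $ k) has_derivative (\<lambda>h. Re (F z $ k * h))) (at z)" if "z \<in> upper_half" for z k
    unfolding F_def by (rule dz_form_derivative[OF x that])
  have kr: "\<i> * of_real (a * b / (2 * pi)) = ?k * of_real (a * b)" for a b by (simp add: unit_coeff_def)
  have ball: "ball 0 1 - {0} \<subseteq> - {0, 1 :: complex}" by auto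
  have E0: "has_helicoidal_end x E1 E2 A \<alpha>"
    using b by (simp add: bounded_with_helicoidal_ends_def has_helicoidal_end_at_def)
  have s0: "q (cnj z) = - cnj (q z) \<and> p (cnj z) = - cnj (p z)" if "z \<in> ball 0 1 - {0}" for z
    using qps[of z] ball that by blast
  note L0 = helicoidal_end_asymptotics[OF E0 N D zero_less_one holomorphic_on_subset[OF q ball]
      holomorphic_on_subset[OF p ball] s0, unfolded kr]
  have L0q: "((\<lambda>z. z\<^sup>2 * q z) \<longlongrightarrow> ?k * of_real (A * \<alpha>)) (at 0)"
    and L0p: "((\<lambda>z. z^4 * p z) \<longlongrightarrow> ?k * of_real (A * \<alpha>) * of_real ((1 - \<alpha>\<^sup>2) / 4)) (at 0)"
    by (rule L0; assumption)+
  have E1: "has_helicoidal_end (\<lambda>w. x (1 + w)) E2 E3 C \<gamma>"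
    using b by (simp add: bounded_with_helicoidal_ends_def has_helicoidal_end_at_def)
  have D1: "((\<lambda>w. x (1 + w) $ k) has_derivative (\<lambda>h. Re (F (1 + w) $ k * h))) (at w)" if "w \<in> upper_half" for w k
  proof -
    have "1 + w \<in> upper_half" using that by (simp add: upper_half_def)
    from D[OF this] have "((\<lambda>z. x z $ k) has_derivative (\<lambda>h. Re (F (1 + w) $ k * h))) (at (1 + w))" .
    moreover have "((\<lambda>w. 1 + w) has_derivative (\<lambda>h. h)) (at w)" by (auto intro!: derivative_eq_intros)
    ultimately show ?thesis by (rule has_derivative_compose[rotated])
  qed
  have img: "(\<lambda>w. 1 + w) ` (ball 0 1 - {0}) \<subseteq> - {0, 1 :: complex}"
    by (auto simp: add_eq_0_iff)
  have h1: "(\<lambda>w. f (1 + w)) holomorphic_on ball 0 1 - {0}" if "f holomorphic_on - {0, 1}" for f :: "complex \<Rightarrow> complex"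
  proof -
    have "(f \<circ> (\<lambda>w. 1 + w)) holomorphic_on ball 0 1 - {0}"
      by (rule holomorphic_on_compose_gen[OF _ that img]) (intro holomorphic_intros)
    then show ?thesis by (simp add: o_def)
  qed
  have s1: "q (1 + cnj z) = - cnj (q (1 + z)) \<and> p (1 + cnj z) = - cnj (p (1 + z))" if "z \<in> ball 0 1 - {0}" for z
  proof -
    have "1 + z \<notin> {0, 1}" using that by (auto simp: add_eq_0_iff)
    from qps[OF this] show ?thesis by simp
  qed
  note L1 = helicoidal_end_asymptotics[OF E1 null_data_translate[OF N] D1 zero_less_one h1[OF q] h1[OF p] s1, unfolded kr]
  have L1q: "((\<lambda>w. w\<^sup>2 * q (1 + w)) \<longlongrightarrow> ?k * of_real (C * \<gamma>)) (at 0)"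
    and L1p: "((\<lambda>w. w^4 * p (1 + w)) \<longlongrightarrow> ?k * of_real (C * \<gamma>) * of_real ((1 - \<gamma>\<^sup>2) / 4)) (at 0)"
    by (rule L1; assumption)+
  define q' where "q' w = (1 / w)^4 * q (- 1 / w)" for w
  define p' where "p' w = (1 / w)^8 * p (- 1 / w) - (1 / w)^7 * deriv q (- 1 / w) + 2 * (1 / w)^6 * q (- 1 / w)" for w
  have Ei: "has_helicoidal_end (\<lambda>w. x (- 1 / w)) E3 E1 B \<beta>"
    using b by (simp add: bounded_with_helicoidal_ends_def has_helicoidal_end_at_infinity_def)
  have Di: "((\<lambda>w. x (- 1 / w) $ k) has_derivative (\<lambda>h. Re (((1 / w)^2 *s F (- 1 / w)) $ k * h))) (at w)" if w: "w \<in> upper_half" for w k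
  proof -
    have "((\<lambda>w. - 1 / w) has_field_derivative (1 / w)^2) (at w)"
      using upper_half_inversion(2)[OF w] by (auto intro!: derivative_eq_intros simp: power2_eq_square field_simps)
    then have "((\<lambda>w. - 1 / w) has_derivative (\<lambda>h. (1 / w)^2 * h)) (at w)" by (simp add: has_field_derivative_def)
    from has_derivative_compose[OF this D[OF upper_half_inversion(1)[OF w]]]
    have "((\<lambda>w. x (- 1 / w) $ k) has_derivative (\<lambda>h. Re (F (- 1 / w) $ k * ((1 / w)^2 * h)))) (at w)" .
    then show ?thesis by (simp only: vector_smult_component mult_ac)
  qed
  \<comment> \<open>The punctured unit disc around the third end avoids the other two, which lie at $w = \infty$ and $w = -1$.\<close>
  have inv01: "- 1 / w \<notin> {0, 1}" if "w \<in> ball 0 1 - {0}" for w :: complex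
  proof -
    have w: "w \<noteq> 0" "norm w < 1" using that by auto
    then show ?thesis by (rule neg_inverse_not_0_1)
  qed
  have O01: "open (- {0, 1 :: complex})" by (intro open_Compl finite_imp_closed) simp
  have ho: "(\<lambda>w. f (- 1 / w)) holomorphic_on ball 0 1 - {0}" if "f holomorphic_on - {0, 1}" for f :: "complex \<Rightarrow> complex"
  proof -
    have "(f \<circ> (\<lambda>w. - 1 / w)) holomorphic_on ball 0 1 - {0}"
      by (rule holomorphic_on_compose_gen[OF _ that]) (use inv01 in \<open>auto intro!: holomorphic_intros\<close>)
    then show ?thesis by (simp add: o_def)
  qed
  have hq': "q' holomorphic_on ball 0 1 - {0}" unfolding q'_def
    by (intro holomorphic_intros ho q) auto
  have hp': "p' holomorphic_on ball 0 1 - {0}" unfolding p'_def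
    by (intro holomorphic_intros ho q p holomorphic_deriv[OF q O01]) auto
  have dqs: "deriv q (cnj z) = - cnj (deriv q z)" if z: "z \<notin> {0, 1}" for z
  proof -
    have z': "cnj z \<in> - {0, 1}" "z \<in> - {0, 1}" using z by (auto simp: complex_eq_iff)
    have "((\<lambda>w. - cnj (q (cnj w))) has_field_derivative - cnj (deriv q z)) (at (cnj z))"
      using has_derivative_cnj_cnj[of q "deriv q z" "cnj z"] holomorphic_derivI[OF q O01 z'(2)]
      by (intro DERIV_minus) simp
    then have "(q has_field_derivative - cnj (deriv q z)) (at (cnj z))"
      by (rule has_field_derivative_transform_within_open[OF _ O01 z'(1)])
        (metis (no_types, lifting) ComplD complex_cnj_cnj complex_cnj_minus minus_minus qps)
    then show ?thesis by (rule DERIV_imp_deriv)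
  qed
  have si: "q' (cnj z) = - cnj (q' z) \<and> p' (cnj z) = - cnj (p' z)" if z: "z \<in> ball 0 1 - {0}" for z
  proof -
    have "- 1 / cnj z = cnj (- 1 / z)" by simp
    then show ?thesis using qps[OF inv01[OF z]] dqs[OF inv01[OF z]] by (simp add: q'_def p'_def)
  qed
  note Li = helicoidal_end_asymptotics[OF Ei null_data_invert[OF N, folded q'_def p'_def] Di zero_less_one hq' hp' si, unfolded kr]
  have Liq: "((\<lambda>w. w\<^sup>2 * q' w) \<longlongrightarrow> ?k * of_real (B * \<beta>)) (at 0)"
    and Lip: "((\<lambda>w. w^4 * p' w) \<longlongrightarrow> ?k * of_real (B * \<beta>) * of_real ((1 - \<beta>\<^sup>2) / 4)) (at 0)"
    by (rule Li; assumption)+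
  note Lid = double_pole_derivative_limits(1)[OF zero_less_one hq' Liq]
  define G where "G z = q z * poly cusp_poly z / ?k" for z
  have hG: "G holomorphic_on - {0, 1}" unfolding G_def by (intro holomorphic_intros q k0)
  have G0: "(G \<longlongrightarrow> of_real (A * \<alpha>)) (at 0)"
  proof -
    have "((\<lambda>z. z\<^sup>2 * q z * (z - 1)\<^sup>2 / ?k) \<longlongrightarrow> ?k * of_real (A * \<alpha>) * (0 - 1)\<^sup>2 / ?k) (at 0)"
      by (intro tendsto_intros L0q k0)
    then show ?thesis using k0 by (simp add: G_def[abs_def] poly_cusp_poly mult_ac)
  qed
  have G1: "(G \<longlongrightarrow> of_real (C * \<gamma>)) (at 1)"
  proof (rule LIM_offset_zero_cancel)
    have "((\<lambda>w. w\<^sup>2 * q (1 + w) * (1 + w)\<^sup>2 / ?k) \<longlongrightarrow> ?k * of_real (C * \<gamma>) * (1 + 0)\<^sup>2 / ?k) (at 0)"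
      by (intro tendsto_intros L1q k0)
    then show "((\<lambda>w. G (1 + w)) \<longlongrightarrow> of_real (C * \<gamma>)) (at 0)" using k0 by (simp add: G_def poly_cusp_poly mult_ac)
  qed
  have cusp_inv: "poly cusp_poly (- 1 / w) = (1 / w)^4 * (1 + w)\<^sup>2" if "w \<noteq> 0" for w
    using that by (simp add: poly_cusp_poly field_simps eval_nat_numeral)
  have nz: "\<forall>\<^sub>F w in at 0. w \<noteq> (0 :: complex)" by (simp add: eventually_at_filter)
  have Gi: "((\<lambda>w. w\<^sup>2 * G (- 1 / w)) \<longlongrightarrow> of_real (B * \<beta>)) (at 0)"
  proof -
    have "((\<lambda>w. w\<^sup>2 * q' w * (1 + w)\<^sup>2 / ?k) \<longlongrightarrow> ?k * of_real (B * \<beta>) * (1 + 0)\<^sup>2 / ?k) (at 0)"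
      by (intro tendsto_intros Liq k0)
    then have "((\<lambda>w. w\<^sup>2 * q' w * (1 + w)\<^sup>2 / ?k) \<longlongrightarrow> of_real (B * \<beta>)) (at 0)" using k0 by simp
    moreover have "w\<^sup>2 * q' w * (1 + w)\<^sup>2 / ?k = w\<^sup>2 * G (- 1 / w)" if "w \<noteq> 0" for w
      unfolding G_def q'_def cusp_inv[OF that] by (simp only: mult_ac times_divide_eq_right)
    then have "\<forall>\<^sub>F w in at 0. w\<^sup>2 * q' w * (1 + w)\<^sup>2 / ?k = w\<^sup>2 * G (- 1 / w)"
      by (rule eventually_mono[OF nz])
    ultimately show ?thesis by (rule Lim_transform_eventually)
  qed
  obtain P' where P': "degree P' \<le> 2" "coeff P' 2 = of_real (B * \<beta>)" "poly P' 0 = of_real (A * \<alpha>)"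
      "poly P' 1 = of_real (C * \<gamma>)" "\<And>z. z \<notin> {0, 1} \<Longrightarrow> G z = poly P' z"
    by (rule polynomial_of_growth[OF hG G0 G1 Gi]) (simp, rule that)
  have PP: "P' = P" unfolding P_def by (rule quadratic_poly_eq[OF P'(1-4)])
  have qP: "q z = ?k * poly P z / poly cusp_poly z" if "z \<notin> {0, 1}" for z
    using P'(5)[OF that] that k0 by (simp add: PP G_def field_simps poly_cusp_poly_eq_0_iff)
  define H where "H z = p z * (poly cusp_poly z)\<^sup>2 / ?k" for z
  have hH: "H holomorphic_on - {0, 1}" unfolding H_def by (intro holomorphic_intros p k0)
  have H0: "(H \<longlongrightarrow> of_real (A * \<alpha> * (1 - \<alpha>\<^sup>2) / 4)) (at 0)"
  proof -
    have "((\<lambda>z. z^4 * p z * (z - 1)^4 / ?k) \<longlongrightarrow> ?k * of_real (A * \<alpha>) * of_real ((1 - \<alpha>\<^sup>2) / 4) * (0 - 1)^4 / ?k) (at 0)"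
      by (intro tendsto_intros L0p k0)
    moreover have "(poly cusp_poly z)\<^sup>2 = z^4 * (z - 1)^4" for z by (simp add: poly_cusp_poly power_mult_distrib)
    ultimately show ?thesis using k0 by (simp add: H_def[abs_def] mult_ac)
  qed
  have H1: "(H \<longlongrightarrow> of_real (C * \<gamma> * (1 - \<gamma>\<^sup>2) / 4)) (at 1)"
  proof (rule LIM_offset_zero_cancel)
    have "((\<lambda>w. w^4 * p (1 + w) * (1 + w)^4 / ?k) \<longlongrightarrow> ?k * of_real (C * \<gamma>) * of_real ((1 - \<gamma>\<^sup>2) / 4) * (1 + 0)^4 / ?k) (at 0)"
      by (intro tendsto_intros L1p k0)
    moreover have "(poly cusp_poly (1 + w))\<^sup>2 = w^4 * (1 + w)^4" for w by (simp add: poly_cusp_poly power_mult_distrib)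
    ultimately show "((\<lambda>w. H (1 + w)) \<longlongrightarrow> of_real (C * \<gamma> * (1 - \<gamma>\<^sup>2) / 4)) (at 0)"
      using k0 by (simp add: H_def mult_ac)
  qed
  have Hi: "((\<lambda>w. w^4 * H (- 1 / w)) \<longlongrightarrow> of_real (B * \<beta> * (1 - \<beta>\<^sup>2) / 4)) (at 0)"
  proof -
    let ?c = "?k * of_real (B * \<beta>)"
    have L: "((\<lambda>w. (w^4 * p' w + w^3 * deriv q' w + 2 * (w\<^sup>2 * q' w)) * (1 + w)^4 / ?k) \<longlongrightarrow>
        (?c * of_real ((1 - \<beta>\<^sup>2) / 4) + (- 2 * ?c) + 2 * ?c) * (1 + 0)^4 / ?k) (at 0)"
      by (intro tendsto_intros Lip Lid Liq k0)
    have V: "(?c * of_real ((1 - \<beta>\<^sup>2) / 4) + (- 2 * ?c) + 2 * ?c) * (1 + 0)^4 / ?k = of_real (B * \<beta> * (1 - \<beta>\<^sup>2) / 4)"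
      using k0 by simp
    have E: "\<forall>\<^sub>F w in at 0. (w^4 * p' w + w^3 * deriv q' w + 2 * (w\<^sup>2 * q' w)) * (1 + w)^4 / ?k = w^4 * H (- 1 / w)"
    proof -
      have "\<forall>\<^sub>F w in at 0. w \<in> ball 0 1 - {0 :: complex}"
        using eventually_at_ball'[of 1 "0::complex" UNIV] by (auto elim: eventually_mono)
      then show ?thesis
      proof eventually_elim
        case (elim w)
        then have w0: "w \<noteq> 0" by simp
        have "((\<lambda>w. - 1 / w) has_field_derivative (1 / w)^2) (at w)"
          using w0 by (auto intro!: derivative_eq_intros simp: power2_eq_square field_simps)
        from DERIV_chain2[OF holomorphic_derivI[OF q O01] this] inv01[OF elim]
        have dq: "((\<lambda>w. q (- 1 / w)) has_field_derivative deriv q (- 1 / w) * (1 / w)^2) (at w)" by simp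
        have di: "((\<lambda>w. 1 / w) has_field_derivative - ((1 / w)^2)) (at w)"
          using w0 by (auto intro!: derivative_eq_intros simp: power2_eq_square field_simps)
        have "(q' has_field_derivative (1 / w)^6 * deriv q (- 1 / w) - 4 * (1 / w)^5 * q (- 1 / w)) (at w)"
          unfolding q'_def by (rule derivative_eq_intros dq di refl)+ (simp add: algebra_simps eval_nat_numeral)
        then have dq': "deriv q' w = (1 / w)^6 * deriv q (- 1 / w) - 4 * (1 / w)^5 * q (- 1 / w)" by (rule DERIV_imp_deriv)
        have "w^4 * p' w + w^3 * deriv q' w + 2 * (w\<^sup>2 * q' w) = (1 / w)^4 * p (- 1 / w)"
          unfolding dq' p'_def q'_def using w0 by (simp add: field_simps eval_nat_numeral)
        moreover have "w^4 * H (- 1 / w) = (1 / w)^4 * p (- 1 / w) * (1 + w)^4 / ?k"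
        proof -
          have regroup: "w^4 * (a * (t^4 * b\<^sup>2)\<^sup>2 / k) = (w * t)^4 * (t^4 * a * b^4 / k)" for a b t k :: complex
            by (simp add: eval_nat_numeral mult_ac)
          have "w * (1 / w) = 1" using w0 by simp
          then show ?thesis unfolding H_def cusp_inv[OF w0] regroup by (simp only: power_one mult_1)
        qed
        ultimately show ?case by simp
      qed
    qed
    show ?thesis by (rule Lim_transform_eventually[OF L[unfolded V] E])
  qed
  obtain R where R: "degree R \<le> 4" "coeff R 4 = of_real (B * \<beta> * (1 - \<beta>\<^sup>2) / 4)" "poly R 0 = of_real (A * \<alpha> * (1 - \<alpha>\<^sup>2) / 4)"
      "poly R 1 = of_real (C * \<gamma> * (1 - \<gamma>\<^sup>2) / 4)" "\<And>z. z \<notin> {0, 1} \<Longrightarrow> H z = poly R z"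
    by (rule polynomial_of_growth[OF hH H0 H1 Hi]) (simp, rule that)
  have pR: "p z = ?k * poly R z / (poly cusp_poly z)\<^sup>2" if "z \<notin> {0, 1}" for z
    using R(5)[OF that] that k0 by (simp add: H_def field_simps poly_cusp_poly_eq_0_iff)
  have nz01: "A * \<alpha> \<noteq> 0" "C * \<gamma> \<noteq> 0"
    using b by (auto simp: bounded_with_helicoidal_ends_def has_helicoidal_end_at_def has_helicoidal_end_def)
  have lf: "log_free P R a" if a: "poly P a = 0" for a
  proof -
    have "a \<notin> {0, 1}" using a nz01 by (auto simp: P_def hopf_numerator_def)
    then obtain j where j: "j < 3" "a \<in> slit_plane (side j)" using in_some_slit_plane by blast
    show ?thesis
      by (rule log_free_of_null_data[OF nd[OF j(1)] open_slit_plane[OF side_simps(1)] j(2) slit_plane_side_subset k0])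
        (use qP pR slit_plane_side_subset[of j] in auto)
  qed
  show thesis
  proof (rule that)
    show "R \<in> prescribed_numerators (A, \<alpha>) (B, \<beta>) (C, \<gamma>)"
      using R(1-4) lf by (simp add: prescribed_numerators_def admissible_numerators_def P_def)
    show "null_data upper_half F (\<lambda>z. ?k * poly P z / poly cusp_poly z) (\<lambda>z. ?k * poly R z / (poly cusp_poly z)\<^sup>2)"
      by (rule null_data_cong[OF N open_upper_half order_refl refl qP pR]) (auto simp: upper_half_def)
    show "vholo (reflected (u j) F) (slit_plane (side j))" for j using null by (simp add: null_curve_def)
  qed
qed

text \<open>The difference of $y$ and the rotated $x$ has vanishing differential on the upper half-plane, and continuity
  carries the constant to the boundary.\<close>

lemma congruent_of_rotated_dz_forms:
  assumes x: "conformal_minimal_immersion Sigma01 x" and y: "conformal_minimal_immersion Sigma01 y"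
    and R: "rotation_matrix R" and e: "\<And>z. z \<in> upper_half \<Longrightarrow> dz_form Sigma01 y z = cmat R *v dz_form Sigma01 x z"
  shows "(x, y) \<in> congruent_immersions"
proof -
  define d where "d z = y z - R *v x z" for z
  have dif: "x differentiable_on Sigma01" "y differentiable_on Sigma01"
  proof -
    have "Ck_on (Suc 0) Sigma01 x" "Ck_on (Suc 0) Sigma01 y"
      using x y unfolding conformal_minimal_immersion_def smooth_on_def by blast+
    then show "x differentiable_on Sigma01" "y differentiable_on Sigma01" by auto
  qed
  have "(d has_derivative (\<lambda>h. 0)) (at z within upper_half)" if z: "z \<in> upper_half" for z
  proof -
    have comp: "Complex (du Sigma01 y z $ k) (- dv Sigma01 y z $ k)
        = (\<Sum>j\<in>UNIV. of_real (R $ k $ j) * Complex (du Sigma01 x z $ j) (- dv Sigma01 x z $ j))" for k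
    proof -
      have "dz_form Sigma01 y z $ k = (cmat R *v dz_form Sigma01 x z) $ k" using e[OF z] by simp
      then show ?thesis by (simp add: dz_form_def cmat_def matrix_vector_mult_def)
    qed
    have uv: "du Sigma01 y z = R *v du Sigma01 x z" "dv Sigma01 y z = R *v dv Sigma01 x z"
      using arg_cong[OF comp, of Re] arg_cong[OF comp, of Im]
      by (simp_all add: vec_eq_iff matrix_vector_mult_def sum_negf)
    note D = partial_on_has_derivative[OF dif(1) open_upper_half upper_half_Sigma01 z]
      partial_on_has_derivative[OF dif(2) open_upper_half upper_half_Sigma01 z]
    have "(d has_derivative (\<lambda>h. (Re h *\<^sub>R du Sigma01 y z + Im h *\<^sub>R dv Sigma01 y z)
         - R *v (Re h *\<^sub>R du Sigma01 x z + Im h *\<^sub>R dv Sigma01 x z))) (at z)"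
      unfolding d_def
      by (intro has_derivative_diff D bounded_linear.has_derivative[OF matrix_vector_mul_bounded_linear])
    moreover have "(Re h *\<^sub>R du Sigma01 y z + Im h *\<^sub>R dv Sigma01 y z)
         - R *v (Re h *\<^sub>R du Sigma01 x z + Im h *\<^sub>R dv Sigma01 x z) = 0" for h
      by (simp add: uv matrix_vector_right_distrib matrix_vector_mult_scaleR)
    ultimately show ?thesis by (simp add: has_derivative_at_withinI)
  qed
  then obtain c where c: "\<forall>z\<in>upper_half. d z = c"
    using has_derivative_zero_constant[OF connected_upper_half(2)] by blast
  have "d z = c" if z: "z \<in> Sigma01" for z
  proof -
    have "continuous_on Sigma01 d"
      unfolding d_def
      by (intro continuous_intros differentiable_imp_continuous_on dif bounded_linear.continuous_on[OF matrix_vector_mul_bounded_linear])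
    then have "(d \<longlongrightarrow> d z) (at z within Sigma01)" using z by (simp add: continuous_on_def)
    then have 1: "(d \<longlongrightarrow> d z) (at z within upper_half)"
      by (rule tendsto_within_subset[OF _ upper_half_Sigma01])
    have 2: "(d \<longlongrightarrow> c) (at z within upper_half)"
      by (rule Lim_transform_eventually[OF tendsto_const]) (use c in \<open>auto simp: eventually_at_filter\<close>)
    have "at z within upper_half \<noteq> bot"
      by (rule closed_upper_half_limit_point) (use z in \<open>simp add: Sigma01_def\<close>)
    then show ?thesis using tendsto_unique[OF _ 1 2] by blast
  qed
  then have "\<forall>z\<in>Sigma01. y z = R *v x z + c" by (auto simp: d_def algebra_simps)
  moreover have "direct_isometry (\<lambda>p. R *v p + c)" using R by (auto simp: direct_isometry_def)
  ultimately show ?thesis by (auto simp: congruent_immersions_def)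
qed

lemma hopf_numerator_facts:
  assumes "a \<noteq> 0" "b \<noteq> 0" "c \<noteq> 0"
  shows "degree (hopf_numerator a b c) = 2" "poly (hopf_numerator a b c) 0 \<noteq> 0" "poly (hopf_numerator a b c) 1 \<noteq> 0"
  using assms by (simp_all add: hopf_numerator_def)

text \<open>Choosing one element for every value of the invariant reaches all classes.\<close>

lemma card_quotient_le_invariants:
  assumes r: "equiv UNIV r" and fin: "finite I" "card I \<le> n"
    and ex: "\<And>x. x \<in> S \<Longrightarrow> \<exists>i\<in>I. Q x i"
    and det: "\<And>x y i. x \<in> S \<Longrightarrow> y \<in> S \<Longrightarrow> i \<in> I \<Longrightarrow> Q x i \<Longrightarrow> Q y i \<Longrightarrow> (x, y) \<in> r"
  shows "finite (S // r) \<and> card (S // r) \<le> n"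
proof -
  define f where "f i = r `` {SOME x. x \<in> S \<and> Q x i}" for i
  have sub: "S // r \<subseteq> f ` I"
  proof
    fix K assume "K \<in> S // r"
    then obtain x where x: "x \<in> S" "K = r `` {x}" by (auto simp: quotient_def)
    obtain i where i: "i \<in> I" "Q x i" using ex[OF x(1)] by blast
    have "(SOME x. x \<in> S \<and> Q x i) \<in> S \<and> Q (SOME x. x \<in> S \<and> Q x i) i"
      by (rule someI[of "\<lambda>x. x \<in> S \<and> Q x i" x]) (use x i in blast)
    then have "(x, SOME x. x \<in> S \<and> Q x i) \<in> r" using det[OF x(1) _ i(1,2)] by blast
    then have "K = f i" using x(2) equiv_class_eq[OF r] by (simp add: f_def)
    then show "K \<in> f ` I" using i(1) by blast
  qed
  have "card (S // r) \<le> card I"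
    using card_mono[OF finite_imageI[OF fin(1)] sub] card_image_le[OF fin(1), of f] by linarith
  then show ?thesis using finite_subset[OF sub finite_imageI[OF fin(1)]] fin(2) by simp
qed

theorem theorem21:
  fixes D1 D2 D3 :: oriented_line
    and \<alpha>\<^sub>0 \<beta>\<^sub>0 \<gamma>\<^sub>0 A B C \<epsilon>\<^sub>0 \<alpha> \<beta> \<gamma> :: real
  assumes "generic_position D1 D2 D3"
    and "line_invariants D1 D2 D3 = (\<alpha>\<^sub>0, \<beta>\<^sub>0, \<gamma>\<^sub>0, A, B, C, \<epsilon>\<^sub>0)"
    and "\<exists>k::int. \<alpha> = \<alpha>\<^sub>0 + 2 * of_int k"
    and "\<exists>k::int. \<beta> = \<beta>\<^sub>0 + 2 * of_int k"
    and "\<exists>k::int. \<gamma> = \<gamma>\<^sub>0 + 2 * of_int k"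
  shows "finite (admissible_immersions D1 D2 D3 (A, \<alpha>) (B, \<beta>) (C, \<gamma>) // congruent_immersions)
    \<and> card (admissible_immersions D1 D2 D3 (A, \<alpha>) (B, \<beta>) (C, \<gamma>) // congruent_immersions) \<le> 4"
proof (cases "admissible_immersions D1 D2 D3 (A, \<alpha>) (B, \<beta>) (C, \<gamma>) = {}")
  case True
  then show ?thesis by simp
next
  case False
  let ?S = "admissible_immersions D1 D2 D3 (A, \<alpha>) (B, \<beta>) (C, \<gamma>)"
  let ?I = "prescribed_numerators (A, \<alpha>) (B, \<beta>) (C, \<gamma>)"
  define P where "P = hopf_numerator (A * \<alpha>) (B * \<beta>) (C * \<gamma>)"
  define Q where "Q x N \<longleftrightarrow> (\<exists>u :: nat \<Rightarrow> real^3. (\<forall>j. norm (u j) = 1) \<and> det (vector [u 0, u 1, u 2] :: real^3^3) \<noteq> 0 \<and>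
      (\<forall>j. vholo (reflected (u j) (dz_form Sigma01 x)) (slit_plane (side j))) \<and>
      null_data upper_half (dz_form Sigma01 x) (\<lambda>z. unit_coeff * poly P z / poly cusp_poly z)
        (\<lambda>z. unit_coeff * poly N z / (poly cusp_poly z)\<^sup>2))" for x N
  have lines: "\<exists>E1 E2 E3. generic_position E1 E2 E3 \<and> bounded_with_helicoidal_ends x E1 E2 E3 (A, \<alpha>) (B, \<beta>) (C, \<gamma>)"
    and imm: "conformal_minimal_immersion Sigma01 x" if "x \<in> ?S" for x
    using that assms(1) unfolding admissible_immersions_def dual_configuration_def by blast+
  have "A * \<alpha> \<noteq> 0" "B * \<beta> \<noteq> 0" "C * \<gamma> \<noteq> 0"
  proof -
    obtain x E1 E2 E3 where "bounded_with_helicoidal_ends x E1 E2 E3 (A, \<alpha>) (B, \<beta>) (C, \<gamma>)"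
      using False lines by blast
    then show "A * \<alpha> \<noteq> 0" "B * \<beta> \<noteq> 0" "C * \<gamma> \<noteq> 0"
      by (auto simp: bounded_with_helicoidal_ends_def has_helicoidal_end_at_def has_helicoidal_end_at_infinity_def
          has_helicoidal_end_def)
  qed
  note P = hopf_numerator_facts[OF this, folded P_def]
  have I: "finite ?I" "card ?I \<le> 4"
    unfolding prescribed_numerators_def using card_admissible_numerators_le[OF P] by (simp_all add: P_def)
  show ?thesis
  proof (rule card_quotient_le_invariants[OF equiv_congruent_immersions I, where Q = Q])
    fix x assume x: "x \<in> ?S"
    obtain E1 E2 E3 where gen: "generic_position E1 E2 E3" and b: "bounded_with_helicoidal_ends x E1 E2 E3 (A, \<alpha>) (B, \<beta>) (C, \<gamma>)"
      using lines[OF x] by blast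
    define u where "u = (\<lambda>j::nat. if j = 0 then dir E1 else if j = 1 then dir E2 else dir E3)"
    have u: "norm (u j) = 1" for j
      using gen by (auto simp: u_def generic_position_def skew_lines_def)
    have d: "det (vector [u 0, u 1, u 2] :: real^3^3) \<noteq> 0" using gen by (simp add: u_def generic_position_def)
    show "\<exists>N\<in>?I. Q x N"
      by (rule bounded_immersion_numerator[OF imm[OF x] b u_def u]) (use u d in \<open>auto simp: Q_def P_def\<close>)
  next
    fix x y N assume x: "x \<in> ?S" and y: "y \<in> ?S" and "Q x N" "Q y N"
    then obtain u u' where
      u: "\<And>j. norm (u j) = 1" "det (vector [u 0, u 1, u 2] :: real^3^3) \<noteq> 0"
        "\<And>j. vholo (reflected (u j) (dz_form Sigma01 x)) (slit_plane (side j))"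
      and u': "\<And>j. vholo (reflected (u' j) (dz_form Sigma01 y)) (slit_plane (side j))"
      and nx: "null_data upper_half (dz_form Sigma01 x) (\<lambda>z. unit_coeff * poly P z / poly cusp_poly z)
        (\<lambda>z. unit_coeff * poly N z / (poly cusp_poly z)\<^sup>2)"
      and ny: "null_data upper_half (dz_form Sigma01 y) (\<lambda>z. unit_coeff * poly P z / poly cusp_poly z)
        (\<lambda>z. unit_coeff * poly N z / (poly cusp_poly z)\<^sup>2)"
      unfolding Q_def by blast
    have "P \<noteq> 0" using P(1) by auto
    then have "finite {z. poly P z = 0}" by (rule poly_roots_finite)
    moreover have "\<not> finite upper_half"
    proof -
      have "\<i> \<in> upper_half" by (simp add: upper_half_def)
      then show ?thesis using finite_imp_not_open open_upper_half by blast
    qed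
    ultimately obtain z0 where z0: "z0 \<in> upper_half" "poly P z0 \<noteq> 0"
      by (metis (mono_tags) finite_subset mem_Collect_eq subsetI)
    have "unit_coeff * poly P z0 / poly cusp_poly z0 \<noteq> 0"
      using z0 by (auto simp: unit_coeff_def poly_cusp_poly_eq_0_iff upper_half_def)
    from rotation_between_null_curves[OF nx ny z0(1) this u(3) u' u(1,2)]
    obtain R where "rotation_matrix R" "\<And>z. z \<in> upper_half \<Longrightarrow> dz_form Sigma01 y z = cmat R *v dz_form Sigma01 x z"
      by blast
    then show "(x, y) \<in> congruent_immersions"
      by (rule congruent_of_rotated_dz_forms[OF imm[OF x] imm[OF y]])
  qed
qed

end
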